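(* Let $\pi:P\to Q$ be a principal $G$-bundle, $W$ an effective left $G$-space, and $\bar\pi:M=P\times_GW\to Q$ the associated bundle. Let $N$ be a manifold, $S:TN\times M\to TM$ a $\bar\pi$-projectable Stratonovich operator with projected operator $S_Q:TN\times Q\to TQ$, and $A\in\Omega^1(P;\mathfrak{g})$ an auxiliary principal connection on $\pi:P\to Q$. Let $\kappa_p$, $\widehat A_p$, $\widehat V_{[p,w]}$ and $$S_{P\times W}(x,(p,w))=\widehat A_p\circ S_Q(x,\pi(p))\times(T_w\kappa_p)^{-1}\circ\widehat V_{[p,w]}\circ S(x,[p,w])$$ be as in the context. Suppose that $(T_w\kappa_p)^{-1}\circ\widehat V_{[p,w]}\circ S(x,[p,w])$ does not depend on $p\in P$. Then there exists a unique $G$-invariant Stratonovich operator $S_W:TN\times W\to TW$ from $N$ to $W$ determined by the relation $$T_w\kappa_p\circ S_W(x,w)=\widehat V_{[p,w]}\circ S(x,[p,w])$$ for any $x\in N$, $w\in W$, and $p\in P$. Moreover, $S_{P\times W}$ admits the skew-product decomposition $$S_{P\times W}(x,(p,w))=\widehat A_p\circ S_Q(x,\pi(p))\times S_W(x,w).$$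
   Context: Manifolds are smooth and finite dimensional. A Stratonovich operator from $N$ to $M$, written $S:TN\times M\to TM$, is a family of linear maps $S(x,y):T_xN\to T_yM$ depending smoothly on $(x,y)\in N\times M$. It is invariant under a left $G$-action $\Phi$ on $M$ if $S(x,\Phi_g(y))=T_y\Phi_g\circ S(x,y)$ for all $g\in G$, $x\in N$, $y\in M$. Associated bundle: $G$ is a Lie group acting on $P$ on the right (principal action), and on the manifold $W$ on the left. $P\times_GW$ is the quotient of $P\times W$ by $(p\cdot g,w)\sim(p,g\cdot w)$; its elements are written $[p,w]=\kappa(p,w)$, $\kappa:P\times W\to P\times_GW$ is the projection, and $\bar\pi([p,w])=\pi(p)$. For each $p\in P$, $\kappa_p:W\to\bar\pi^{-1}(\pi(p))$, $\kappa_p(w)=[p,w]$, is a diffeomorphism; for $w\in W$, $\kappa_w(p):=\kappa(p,w)$. $S$ is $\bar\pi$-projectable if $S_Q(x,q):=T_{[p,w]}\bar\pi\circ S(x,[p,w])\in\mathcal{L}(T_xN,T_qQ)$, for any $[p,w]$ with $\bar\pi([p,w])=q$, is well defined. Connections: $\widehat A_p:T_{\pi(p)}Q\to\mathrm{Hor}_pP\subseteq T_pP$ is the horizontal lift map at $p$ defined by $A$. The induced connection $\mathbf{A}$ on $M=P\times_GW$ is given by the (well defined) horizontal lift maps $\widehat{\mathbf{A}}_{[p,w]}=T_p\kappa_w\circ\widehat A_p:T_{\pi(p)}Q\to T_{[p,w]}M$. Its horizontal space at $[p,w]$ is the image of $\widehat{\mathbf{A}}_{[p,w]}$, its vertical space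 is $\mathrm{Ver}_{[p,w]}M=\ker T_{[p,w]}\bar\pi$, and $\widehat V_{[p,w]}:T_{[p,w]}M\to\mathrm{Ver}_{[p,w]}M$ is the projection onto the vertical space along the horizontal space. $(T_w\kappa_p)^{-1}$ is the inverse of the isomorphism $T_w\kappa_p:T_wW\to\mathrm{Ver}_{[p,w]}M$. Skew-product: a Stratonovich operator $S$ from $N$ to $M_1\times M_2$ admits a skew-product decomposition if $S(x,(m_1,m_2))=(S_1(x,m_1,m_2),S_2(x,m_2))$ for some Stratonovich operator $S_2$ from $N$ to $M_2$ and some $M_2$-dependent Stratonovich operator $S_1(x,m_1,m_2):T_xN\to T_{m_1}M_1$. *)

theory Defs
  imports "HOL-Analysis.Analysis" "HOL-Algebra.Group"
begin

section \<open>Smooth maps between normed spaces\<close>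

text \<open>
  Meant for open subsets \<open>S\<close> of finite-dimensional spaces, where requiring all directional
  derivatives \<open>x \<mapsto> Df(x) v\<close> to be of class \<open>C\<^sup>k\<close> is the same as requiring it of \<open>Df\<close>.
\<close>

primrec Ck_on :: "nat \<Rightarrow> ('a::real_normed_vector \<Rightarrow> 'b::real_normed_vector) \<Rightarrow> 'a set \<Rightarrow> bool" where
  "Ck_on 0 f S \<longleftrightarrow> continuous_on S f"
| "Ck_on (Suc k) f S \<longleftrightarrow>
     (\<forall>x\<in>S. f differentiable (at x)) \<and> (\<forall>v. Ck_on k (\<lambda>x. frechet_derivative f (at x) v) S)"

definition smooth_on :: "'a::real_normed_vector set \<Rightarrow> ('a \<Rightarrow> 'b::real_normed_vector) \<Rightarrow> bool" where
  "smooth_on S f \<longleftrightarrow> (\<forall>k. Ck_on k f S)"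

section \<open>Manifolds\<close>

text \<open>
  A manifold is given by an atlas (not required to be maximal); its underlying set and its topology
  are read off from the atlas.  The model space \<open>'e\<close> is any finite-dimensional real inner product
  space; \<^class>\<open>euclidean_space\<close> is not used because it excludes dimension zero.
  The values of \<open>cmap c\<close> outside \<open>cdom c\<close> are irrelevant.
\<close>

datatype ('a, 'e) chart = Chart (cdom: "'a set") (cmap: "'a \<Rightarrow> 'e")

type_synonym ('a, 'e) atlas = "('a, 'e) chart set"

abbreviation cimg :: "('a, 'e) chart \<Rightarrow> 'e set" where
  "cimg c \<equiv> cmap c ` cdom c"

abbreviation cinv :: "('a, 'e) chart \<Rightarrow> 'e \<Rightarrow> 'a" where
  "cinv c \<equiv> inv_into (cdom c) (cmap c)"

definition points :: "('a, 'e) atlas \<Rightarrow> 'a set" where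
  "points M = (\<Union>c\<in>M. cdom c)"

definition atlas_open :: "('a, 'e::real_inner) atlas \<Rightarrow> 'a set \<Rightarrow> bool" where
  "atlas_open M U \<longleftrightarrow> U \<subseteq> points M \<and> (\<forall>c\<in>M. open (cmap c ` (U \<inter> cdom c)))"

definition smooth_atlas :: "('a, 'e::real_inner) atlas \<Rightarrow> bool" where
  "smooth_atlas M \<longleftrightarrow>
     (\<forall>c\<in>M. inj_on (cmap c) (cdom c)) \<and>
     (\<forall>c\<in>M. \<forall>d\<in>M. open (cmap c ` (cdom c \<inter> cdom d)) \<and>
        smooth_on (cmap c ` (cdom c \<inter> cdom d)) (cmap d \<circ> cinv c))"

definition manifold :: "('a, 'e::real_inner) atlas \<Rightarrow> bool" where
  "manifold M \<longleftrightarrow>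
     (\<exists>B :: 'e set. finite B \<and> span B = UNIV) \<and> smooth_atlas M \<and>
     Hausdorff_space (topology (atlas_open M)) \<and> second_countable (topology (atlas_open M))"

lemma istopology_atlas_open:
  assumes "smooth_atlas M"
  shows "istopology (atlas_open M)"
proof -
  have inj: "inj_on (cmap c) (cdom c)" if "c \<in> M" for c
    using assms that by (auto simp: smooth_atlas_def)
  have "atlas_open M (U \<inter> V)" if "atlas_open M U" "atlas_open M V" for U V
  proof -
    have "cmap c ` (U \<inter> V \<inter> cdom c) = cmap c ` (U \<inter> cdom c) \<inter> cmap c ` (V \<inter> cdom c)"
      if "c \<in> M" for c
    proof -
      have "U \<inter> V \<inter> cdom c = (U \<inter> cdom c) \<inter> (V \<inter> cdom c)"
        by blast
      then show ?thesis
        using inj_on_image_Int[OF inj[OF that], of "U \<inter> cdom c" "V \<inter> cdom c"] by simp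
    qed
    with that show ?thesis
      unfolding atlas_open_def by (simp add: open_Int le_infI1)
  qed
  moreover have "atlas_open M (\<Union>\<K>)" if "\<forall>K\<in>\<K>. atlas_open M K" for \<K>
  proof -
    have eq: "cmap c ` (\<Union>\<K> \<inter> cdom c) = (\<Union>K\<in>\<K>. cmap c ` (K \<inter> cdom c))" for c
      by auto
    with that show ?thesis
      unfolding atlas_open_def eq by (auto intro!: open_UN)
  qed
  ultimately show ?thesis
    unfolding istopology_def by blast
qed

definition open_submanifold :: "('a, 'e) atlas \<Rightarrow> 'a set \<Rightarrow> ('a, 'e) atlas" where
  "open_submanifold M U = {Chart (cdom c \<inter> U) (cmap c) | c. c \<in> M}"

definition prod_manifold ::
  "('a, 'e) atlas \<Rightarrow> ('b, 'f) atlas \<Rightarrow> ('a \<times> 'b, 'e \<times> 'f) atlas" (infixr "\<times>\<^sub>M" 75) where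
  "M \<times>\<^sub>M N = {Chart (cdom c \<times> cdom d) (map_prod (cmap c) (cmap d)) | c d. c \<in> M \<and> d \<in> N}"

text \<open>Openness of \<open>cmap c ` (cdom c \<inter> f -` cdom d)\<close> encodes continuity of \<open>f\<close>.\<close>

definition smooth_map ::
  "('a, 'e::real_inner) atlas \<Rightarrow> ('b, 'f::real_inner) atlas \<Rightarrow> ('a \<Rightarrow> 'b) \<Rightarrow> bool" where
  "smooth_map M N f \<longleftrightarrow> f ` points M \<subseteq> points N \<and>
     (\<forall>c\<in>M. \<forall>d\<in>N. open (cmap c ` (cdom c \<inter> f -` cdom d)) \<and>
        smooth_on (cmap c ` (cdom c \<inter> f -` cdom d)) (cmap d \<circ> f \<circ> cinv c))"

definition diffeo ::
  "('a, 'e::real_inner) atlas \<Rightarrow> ('b, 'f::real_inner) atlas \<Rightarrow> ('a \<Rightarrow> 'b) \<Rightarrow> bool" where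
  "diffeo M N f \<longleftrightarrow> bij_betw f (points M) (points N) \<and>
     smooth_map M N f \<and> smooth_map N M (inv_into (points M) f)"

section \<open>Tangent spaces\<close>

text \<open>
  A tangent vector at \<open>x\<close> is the family of its coordinate representations, one for each chart
  around \<open>x\<close>, related by the derivatives of the coordinate changes (and \<open>0\<close> at all other
  charts).  The vector space operations are pointwise.
\<close>

type_synonym ('a, 'e) tvec = "('a, 'e) chart \<Rightarrow> 'e"

definition tspace :: "('a, 'e::real_inner) atlas \<Rightarrow> 'a \<Rightarrow> ('a, 'e) tvec set" where
  "tspace M x = {v.
     (\<forall>c\<in>M. \<forall>d\<in>M. x \<in> cdom c \<and> x \<in> cdom d \<longrightarrow>
        v d = frechet_derivative (cmap d \<circ> cinv c) (at (cmap c x)) (v c)) \<and>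
     (\<forall>c. \<not> (c \<in> M \<and> x \<in> cdom c) \<longrightarrow> v c = 0)}"

definition tzero :: "('a, 'e::real_vector) tvec" where
  "tzero = (\<lambda>_. 0)"

definition tadd :: "('a, 'e::real_vector) tvec \<Rightarrow> ('a, 'e) tvec \<Rightarrow> ('a, 'e) tvec" where
  "tadd u v = (\<lambda>c. u c + v c)"

definition tscale :: "real \<Rightarrow> ('a, 'e::real_vector) tvec \<Rightarrow> ('a, 'e) tvec" where
  "tscale r v = (\<lambda>c. r *\<^sub>R v c)"

definition tlinear ::
  "('a, 'e::real_vector) tvec set \<Rightarrow> ('b, 'f::real_vector) tvec set \<Rightarrow>
   (('a, 'e) tvec \<Rightarrow> ('b, 'f) tvec) \<Rightarrow> bool" where
  "tlinear V W f \<longleftrightarrow> f ` V \<subseteq> W \<and>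
     (\<forall>u\<in>V. \<forall>v\<in>V. f (tadd u v) = tadd (f u) (f v)) \<and>
     (\<forall>r. \<forall>v\<in>V. f (tscale r v) = tscale r (f v))"

text \<open>\<open>tcoord M c x e\<close> is the tangent vector at \<open>x\<close> whose representation in the chart \<open>c\<close> is \<open>e\<close>.\<close>

definition tcoord :: "('a, 'e::real_inner) atlas \<Rightarrow> ('a, 'e) chart \<Rightarrow> 'a \<Rightarrow> 'e \<Rightarrow> ('a, 'e) tvec" where
  "tcoord M c x e = (\<lambda>d. if d \<in> M \<and> x \<in> cdom d
     then frechet_derivative (cmap d \<circ> cinv c) (at (cmap c x)) e else 0)"

text \<open>The tangent map \<open>T\<^sub>xf\<close>; by the chain rule the choice of the chart \<open>c\<close> is immaterial.\<close>

definition tmap ::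
  "('a, 'e::real_inner) atlas \<Rightarrow> ('b, 'f::real_inner) atlas \<Rightarrow> ('a \<Rightarrow> 'b) \<Rightarrow> 'a \<Rightarrow>
   ('a, 'e) tvec \<Rightarrow> ('b, 'f) tvec" where
  "tmap M N f x v = (\<lambda>d. if d \<in> N \<and> f x \<in> cdom d
     then let c = (SOME c. c \<in> M \<and> x \<in> cdom c)
          in frechet_derivative (cmap d \<circ> f \<circ> cinv c) (at (cmap c x)) (v c)
     else 0)"

text \<open>The identification of \<open>T\<^sub>xM \<times> T\<^sub>yN\<close> with the tangent space of \<open>M \<times> N\<close> at \<open>(x, y)\<close>.\<close>

definition tpair ::
  "('a, 'e::real_inner) atlas \<Rightarrow> ('b, 'f::real_inner) atlas \<Rightarrow> 'a \<Rightarrow> 'b \<Rightarrow>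
   ('a, 'e) tvec \<Rightarrow> ('b, 'f) tvec \<Rightarrow> ('a \<times> 'b, 'e \<times> 'f) tvec" where
  "tpair M N x y u v = (THE z. z \<in> tspace (M \<times>\<^sub>M N) (x, y) \<and>
     tmap (M \<times>\<^sub>M N) M fst (x, y) z = u \<and> tmap (M \<times>\<^sub>M N) N snd (x, y) z = v)"

section \<open>Stratonovich operators\<close>

definition stratonovich ::
  "('n, 'en::real_inner) atlas \<Rightarrow> ('m, 'em::real_inner) atlas \<Rightarrow>
   ('n \<Rightarrow> 'm \<Rightarrow> ('n, 'en) tvec \<Rightarrow> ('m, 'em) tvec) \<Rightarrow> bool" where
  "stratonovich N M S \<longleftrightarrow>
     (\<forall>x\<in>points N. \<forall>y\<in>points M. tlinear (tspace N x) (tspace M y) (S x y)) \<and>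
     (\<forall>c\<in>N. \<forall>d\<in>M. \<forall>e. smooth_on (cimg c \<times> cimg d)
        (\<lambda>(a, b). S (cinv c a) (cinv d b) (tcoord N c (cinv c a) e) d))"

definition dep_stratonovich ::
  "('n, 'en::real_inner) atlas \<Rightarrow> ('m1, 'e1::real_inner) atlas \<Rightarrow> ('m2, 'e2::real_inner) atlas \<Rightarrow>
   ('n \<Rightarrow> 'm1 \<Rightarrow> 'm2 \<Rightarrow> ('n, 'en) tvec \<Rightarrow> ('m1, 'e1) tvec) \<Rightarrow> bool" where
  "dep_stratonovich N M1 M2 S \<longleftrightarrow>
     (\<forall>x\<in>points N. \<forall>y\<in>points M1. \<forall>z\<in>points M2. tlinear (tspace N x) (tspace M1 y) (S x y z)) \<and>
     (\<forall>c\<in>N. \<forall>d\<in>M1. \<forall>d'\<in>M2. \<forall>e. smooth_on (cimg c \<times> cimg d \<times> cimg d')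
        (\<lambda>(a, b, b'). S (cinv c a) (cinv d b) (cinv d' b') (tcoord N c (cinv c a) e) d))"

definition invariant_operator ::
  "('g, 'x) monoid_scheme \<Rightarrow> ('n, 'en::real_inner) atlas \<Rightarrow> ('m, 'em::real_inner) atlas \<Rightarrow>
   ('g \<Rightarrow> 'm \<Rightarrow> 'm) \<Rightarrow> ('n \<Rightarrow> 'm \<Rightarrow> ('n, 'en) tvec \<Rightarrow> ('m, 'em) tvec) \<Rightarrow> bool" where
  "invariant_operator G N M \<Phi> S \<longleftrightarrow>
     (\<forall>g\<in>carrier G. \<forall>x\<in>points N. \<forall>y\<in>points M. \<forall>v\<in>tspace N x.
        S x (\<Phi> g y) v = tmap M M (\<Phi> g) y (S x y v))"

definition skew_product ::
  "('n, 'en::real_inner) atlas \<Rightarrow> ('m1, 'e1::real_inner) atlas \<Rightarrow> ('m2, 'e2::real_inner) atlas \<Rightarrow>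
   ('n \<Rightarrow> 'm1 \<times> 'm2 \<Rightarrow> ('n, 'en) tvec \<Rightarrow> ('m1 \<times> 'm2, 'e1 \<times> 'e2) tvec) \<Rightarrow>
   ('n \<Rightarrow> 'm1 \<Rightarrow> 'm2 \<Rightarrow> ('n, 'en) tvec \<Rightarrow> ('m1, 'e1) tvec) \<Rightarrow>
   ('n \<Rightarrow> 'm2 \<Rightarrow> ('n, 'en) tvec \<Rightarrow> ('m2, 'e2) tvec) \<Rightarrow> bool" where
  "skew_product N M1 M2 S S1 S2 \<longleftrightarrow>
     stratonovich N (M1 \<times>\<^sub>M M2) S \<and> dep_stratonovich N M1 M2 S1 \<and> stratonovich N M2 S2 \<and>
     (\<forall>x\<in>points N. \<forall>m1\<in>points M1. \<forall>m2\<in>points M2. \<forall>v\<in>tspace N x.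
        S x (m1, m2) v = tpair M1 M2 m1 m2 (S1 x m1 m2 v) (S2 x m2 v))"

definition projectable ::
  "('n, 'en::real_inner) atlas \<Rightarrow> ('m, 'em::real_inner) atlas \<Rightarrow> ('q, 'eq::real_inner) atlas \<Rightarrow>
   ('m \<Rightarrow> 'q) \<Rightarrow> ('n \<Rightarrow> 'm \<Rightarrow> ('n, 'en) tvec \<Rightarrow> ('m, 'em) tvec) \<Rightarrow> bool" where
  "projectable N M Q \<rho> S \<longleftrightarrow>
     (\<forall>x\<in>points N. \<forall>m\<in>points M. \<forall>m'\<in>points M. \<rho> m = \<rho> m' \<longrightarrow>
        (\<forall>v\<in>tspace N x. tmap M Q \<rho> m (S x m v) = tmap M Q \<rho> m' (S x m' v)))"

definition projected_operator ::
  "('m, 'em::real_inner) atlas \<Rightarrow> ('q, 'eq::real_inner) atlas \<Rightarrow> ('m \<Rightarrow> 'q) \<Rightarrow>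
   ('n \<Rightarrow> 'm \<Rightarrow> ('n, 'en) tvec \<Rightarrow> ('m, 'em) tvec) \<Rightarrow>
   'n \<Rightarrow> 'q \<Rightarrow> ('n, 'en) tvec \<Rightarrow> ('q, 'eq) tvec" where
  "projected_operator M Q \<rho> S x q v =
     (THE u. \<forall>m\<in>points M. \<rho> m = q \<longrightarrow> u = tmap M Q \<rho> m (S x m v))"

section \<open>Lie groups, actions and principal bundles\<close>

definition lie_group :: "('g, 'x) monoid_scheme \<Rightarrow> ('g, 'eg::real_inner) atlas \<Rightarrow> bool" where
  "lie_group G \<G> \<longleftrightarrow> group G \<and> manifold \<G> \<and> points \<G> = carrier G \<and>
     smooth_map (\<G> \<times>\<^sub>M \<G>) \<G> (\<lambda>(g, h). g \<otimes>\<^bsub>G\<^esub> h) \<and> smooth_map \<G> \<G> (\<lambda>g. inv\<^bsub>G\<^esub> g)"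

definition smooth_left_action ::
  "('g, 'x) monoid_scheme \<Rightarrow> ('g, 'eg::real_inner) atlas \<Rightarrow> ('w, 'ew::real_inner) atlas \<Rightarrow>
   ('g \<Rightarrow> 'w \<Rightarrow> 'w) \<Rightarrow> bool" where
  "smooth_left_action G \<G> W \<Phi> \<longleftrightarrow> smooth_map (\<G> \<times>\<^sub>M W) W (\<lambda>(g, w). \<Phi> g w) \<and>
     (\<forall>w\<in>points W. \<Phi> \<one>\<^bsub>G\<^esub> w = w \<and>
        (\<forall>g\<in>carrier G. \<forall>h\<in>carrier G. \<Phi> (g \<otimes>\<^bsub>G\<^esub> h) w = \<Phi> g (\<Phi> h w)))"

definition effective ::
  "('g, 'x) monoid_scheme \<Rightarrow> ('w, 'ew) atlas \<Rightarrow> ('g \<Rightarrow> 'w \<Rightarrow> 'w) \<Rightarrow> bool" where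
  "effective G W \<Phi> \<longleftrightarrow> (\<forall>g\<in>carrier G. (\<forall>w\<in>points W. \<Phi> g w = w) \<longrightarrow> g = \<one>\<^bsub>G\<^esub>)"

definition smooth_right_action ::
  "('g, 'x) monoid_scheme \<Rightarrow> ('g, 'eg::real_inner) atlas \<Rightarrow> ('p, 'ep::real_inner) atlas \<Rightarrow>
   ('p \<Rightarrow> 'g \<Rightarrow> 'p) \<Rightarrow> bool" where
  "smooth_right_action G \<G> P R \<longleftrightarrow> smooth_map (P \<times>\<^sub>M \<G>) P (\<lambda>(p, g). R p g) \<and>
     (\<forall>p\<in>points P. R p \<one>\<^bsub>G\<^esub> = p \<and>
        (\<forall>g\<in>carrier G. \<forall>h\<in>carrier G. R p (g \<otimes>\<^bsub>G\<^esub> h) = R (R p g) h))"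

definition principal_bundle ::
  "('g, 'x) monoid_scheme \<Rightarrow> ('g, 'eg::real_inner) atlas \<Rightarrow> ('p, 'ep::real_inner) atlas \<Rightarrow>
   ('q, 'eq::real_inner) atlas \<Rightarrow> ('p \<Rightarrow> 'g \<Rightarrow> 'p) \<Rightarrow> ('p \<Rightarrow> 'q) \<Rightarrow> bool" where
  "principal_bundle G \<G> P Q R \<pi> \<longleftrightarrow>
     lie_group G \<G> \<and> manifold P \<and> manifold Q \<and> smooth_right_action G \<G> P R \<and>
     smooth_map P Q \<pi> \<and> \<pi> ` points P = points Q \<and>
     (\<forall>p\<in>points P. \<forall>g\<in>carrier G. R p g = p \<longrightarrow> g = \<one>\<^bsub>G\<^esub>) \<and>
     (\<forall>p\<in>points P. \<forall>p'\<in>points P. \<pi> p = \<pi> p' \<longleftrightarrow> (\<exists>g\<in>carrier G. p' = R p g)) \<and>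
     (\<forall>q\<in>points Q. \<exists>U \<phi>. atlas_open Q U \<and> q \<in> U \<and>
        diffeo (open_submanifold P (\<pi> -` U)) (open_submanifold Q U \<times>\<^sub>M \<G>) (\<lambda>p. (\<pi> p, \<phi> p)) \<and>
        (\<forall>p\<in>points P. \<pi> p \<in> U \<longrightarrow> (\<forall>g\<in>carrier G. \<phi> (R p g) = \<phi> p \<otimes>\<^bsub>G\<^esub> g)))"

section \<open>Principal connections\<close>

text \<open>The Lie algebra is the tangent space of the group at its unit.\<close>

abbreviation lie_algebra ::
  "('g, 'x) monoid_scheme \<Rightarrow> ('g, 'eg::real_inner) atlas \<Rightarrow> ('g, 'eg) tvec set" where
  "lie_algebra G \<G> \<equiv> tspace \<G> \<one>\<^bsub>G\<^esub>"

definition Ad ::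
  "('g, 'x) monoid_scheme \<Rightarrow> ('g, 'eg::real_inner) atlas \<Rightarrow> 'g \<Rightarrow> ('g, 'eg) tvec \<Rightarrow> ('g, 'eg) tvec" where
  "Ad G \<G> g = tmap \<G> \<G> (\<lambda>h. g \<otimes>\<^bsub>G\<^esub> h \<otimes>\<^bsub>G\<^esub> inv\<^bsub>G\<^esub> g) \<one>\<^bsub>G\<^esub>"

text \<open>
  In the reproduction condition, \<open>tmap \<G> P (R p) \<one> \<xi>\<close> is the value at \<open>p\<close> of the
  infinitesimal generator of \<open>\<xi>\<close>.
\<close>

definition principal_connection ::
  "('g, 'x) monoid_scheme \<Rightarrow> ('g, 'eg::real_inner) atlas \<Rightarrow> ('p, 'ep::real_inner) atlas \<Rightarrow>
   ('p \<Rightarrow> 'g \<Rightarrow> 'p) \<Rightarrow> ('p \<Rightarrow> ('p, 'ep) tvec \<Rightarrow> ('g, 'eg) tvec) \<Rightarrow> bool" where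
  "principal_connection G \<G> P R A \<longleftrightarrow>
     (\<forall>p\<in>points P. tlinear (tspace P p) (lie_algebra G \<G>) (A p)) \<and>
     (\<forall>c\<in>P. \<forall>k\<in>\<G>. \<one>\<^bsub>G\<^esub> \<in> cdom k \<longrightarrow>
        (\<forall>e. smooth_on (cimg c) (\<lambda>a. A (cinv c a) (tcoord P c (cinv c a) e) k))) \<and>
     (\<forall>p\<in>points P. \<forall>\<xi>\<in>lie_algebra G \<G>. A p (tmap \<G> P (R p) \<one>\<^bsub>G\<^esub> \<xi>) = \<xi>) \<and>
     (\<forall>p\<in>points P. \<forall>g\<in>carrier G. \<forall>v\<in>tspace P p.
        A (R p g) (tmap P P (\<lambda>p'. R p' g) p v) = Ad G \<G> (inv\<^bsub>G\<^esub> g) (A p v))"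

definition hor_lift ::
  "('p, 'ep::real_inner) atlas \<Rightarrow> ('q, 'eq::real_inner) atlas \<Rightarrow> ('p \<Rightarrow> 'q) \<Rightarrow>
   ('p \<Rightarrow> ('p, 'ep) tvec \<Rightarrow> ('g, 'eg::real_inner) tvec) \<Rightarrow> 'p \<Rightarrow> ('q, 'eq) tvec \<Rightarrow> ('p, 'ep) tvec" where
  "hor_lift P Q \<pi> A p u = (THE h. h \<in> tspace P p \<and> A p h = tzero \<and> tmap P Q \<pi> p h = u)"

section \<open>Associated bundles\<close>

definition assoc_rel ::
  "('g, 'x) monoid_scheme \<Rightarrow> ('p, 'ep) atlas \<Rightarrow> ('w, 'ew) atlas \<Rightarrow>
   ('p \<Rightarrow> 'g \<Rightarrow> 'p) \<Rightarrow> ('g \<Rightarrow> 'w \<Rightarrow> 'w) \<Rightarrow> (('p \<times> 'w) \<times> ('p \<times> 'w)) set" where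
  "assoc_rel G P W R \<Phi> =
     {((R p g, w), (p, \<Phi> g w)) | p g w. p \<in> points P \<and> g \<in> carrier G \<and> w \<in> points W}"

definition assoc_class ::
  "('g, 'x) monoid_scheme \<Rightarrow> ('p, 'ep) atlas \<Rightarrow> ('w, 'ew) atlas \<Rightarrow>
   ('p \<Rightarrow> 'g \<Rightarrow> 'p) \<Rightarrow> ('g \<Rightarrow> 'w \<Rightarrow> 'w) \<Rightarrow> 'p \<Rightarrow> 'w \<Rightarrow> ('p \<times> 'w) set" where
  "assoc_class G P W R \<Phi> p w = assoc_rel G P W R \<Phi> `` {(p, w)}"

text \<open>
  The quotient manifold \<open>P \<times>\<^sub>G W\<close>, with its usual smooth structure: every smooth local section \<open>\<sigma>\<close>
  of \<open>P\<close> over an open set \<open>U\<close> gives a trivialisation \<open>(q, w) \<mapsto> [\<sigma> q, w]\<close> over \<open>U\<close>, and the charts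
  are the inverses of these trivialisations followed by products of charts of \<open>Q\<close> and \<open>W\<close>.
\<close>

definition assoc_bundle ::
  "('g, 'x) monoid_scheme \<Rightarrow> ('p, 'ep::real_inner) atlas \<Rightarrow> ('q, 'eq::real_inner) atlas \<Rightarrow>
   ('w, 'ew::real_inner) atlas \<Rightarrow> ('p \<Rightarrow> 'g \<Rightarrow> 'p) \<Rightarrow> ('g \<Rightarrow> 'w \<Rightarrow> 'w) \<Rightarrow> ('p \<Rightarrow> 'q) \<Rightarrow>
   (('p \<times> 'w) set, 'eq \<times> 'ew) atlas" where
  "assoc_bundle G P Q W R \<Phi> \<pi> =
     {let D = (U \<inter> cdom c) \<times> cdom d; t = (\<lambda>(q, w). assoc_class G P W R \<Phi> (\<sigma> q) w)
      in Chart (t ` D) (map_prod (cmap c) (cmap d) \<circ> inv_into D t)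
      | U \<sigma> c d. atlas_open Q U \<and> smooth_map (open_submanifold Q U) P \<sigma> \<and> (\<forall>q\<in>U. \<pi> (\<sigma> q) = q) \<and>
          c \<in> Q \<and> d \<in> W}"

definition assoc_proj :: "('p \<Rightarrow> 'q) \<Rightarrow> ('p \<times> 'w) set \<Rightarrow> 'q" where
  "assoc_proj \<pi> m = (THE q. \<forall>(p, w)\<in>m. \<pi> p = q)"

text \<open>
  In what follows \<open>\<kappa> p w = [p, w]\<close>.  The horizontal lift at \<open>m\<close> of the induced connection is given by
  any representative \<open>(p, w)\<close> of the equivalence class \<open>m\<close>.
\<close>

definition assoc_hor_lift ::
  "('p, 'ep::real_inner) atlas \<Rightarrow> ('q, 'eq::real_inner) atlas \<Rightarrow> ('p \<Rightarrow> 'q) \<Rightarrow>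
   ('p \<Rightarrow> ('p, 'ep) tvec \<Rightarrow> ('g, 'eg::real_inner) tvec) \<Rightarrow>
   (('p \<times> 'w) set, 'em::real_inner) atlas \<Rightarrow> ('p \<Rightarrow> 'w \<Rightarrow> ('p \<times> 'w) set) \<Rightarrow>
   ('p \<times> 'w) set \<Rightarrow> ('q, 'eq) tvec \<Rightarrow> (('p \<times> 'w) set, 'em) tvec" where
  "assoc_hor_lift P Q \<pi> A M \<kappa> m u =
     (THE h. \<forall>(p, w)\<in>m. h = tmap P M (\<lambda>p'. \<kappa> p' w) p (hor_lift P Q \<pi> A p u))"

definition hor_space ::
  "('p, 'ep::real_inner) atlas \<Rightarrow> ('q, 'eq::real_inner) atlas \<Rightarrow> ('p \<Rightarrow> 'q) \<Rightarrow>
   ('p \<Rightarrow> ('p, 'ep) tvec \<Rightarrow> ('g, 'eg::real_inner) tvec) \<Rightarrow>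
   (('p \<times> 'w) set, 'em::real_inner) atlas \<Rightarrow> ('p \<Rightarrow> 'w \<Rightarrow> ('p \<times> 'w) set) \<Rightarrow>
   ('p \<times> 'w) set \<Rightarrow> (('p \<times> 'w) set, 'em) tvec set" where
  "hor_space P Q \<pi> A M \<kappa> m = assoc_hor_lift P Q \<pi> A M \<kappa> m ` tspace Q (assoc_proj \<pi> m)"

definition ver_space ::
  "('m, 'em::real_inner) atlas \<Rightarrow> ('q, 'eq::real_inner) atlas \<Rightarrow> ('m \<Rightarrow> 'q) \<Rightarrow> 'm \<Rightarrow>
   ('m, 'em) tvec set" where
  "ver_space M Q \<rho> m = {v \<in> tspace M m. tmap M Q \<rho> m v = tzero}"

definition ver_proj ::
  "('p, 'ep::real_inner) atlas \<Rightarrow> ('q, 'eq::real_inner) atlas \<Rightarrow> ('p \<Rightarrow> 'q) \<Rightarrow>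
   ('p \<Rightarrow> ('p, 'ep) tvec \<Rightarrow> ('g, 'eg::real_inner) tvec) \<Rightarrow>
   (('p \<times> 'w) set, 'em::real_inner) atlas \<Rightarrow> ('p \<Rightarrow> 'w \<Rightarrow> ('p \<times> 'w) set) \<Rightarrow>
   ('p \<times> 'w) set \<Rightarrow> (('p \<times> 'w) set, 'em) tvec \<Rightarrow> (('p \<times> 'w) set, 'em) tvec" where
  "ver_proj P Q \<pi> A M \<kappa> m v =
     (THE u. u \<in> ver_space M Q (assoc_proj \<pi>) m \<and>
        (\<exists>h\<in>hor_space P Q \<pi> A M \<kappa> m. v = tadd u h))"

text \<open>The operator \<open>(T\<^sub>w\<kappa>\<^sub>p)\<inverse> \<circ> V\<^bsub>[p, w]\<^esub> \<circ> S(x, [p, w])\<close> from \<open>T\<^sub>xN\<close> to \<open>T\<^sub>wW\<close>.\<close>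

definition fibre_operator ::
  "('p, 'ep::real_inner) atlas \<Rightarrow> ('q, 'eq::real_inner) atlas \<Rightarrow> ('w, 'ew::real_inner) atlas \<Rightarrow>
   ('p \<Rightarrow> 'q) \<Rightarrow> ('p \<Rightarrow> ('p, 'ep) tvec \<Rightarrow> ('g, 'eg::real_inner) tvec) \<Rightarrow>
   (('p \<times> 'w) set, 'em::real_inner) atlas \<Rightarrow> ('p \<Rightarrow> 'w \<Rightarrow> ('p \<times> 'w) set) \<Rightarrow>
   ('n \<Rightarrow> ('p \<times> 'w) set \<Rightarrow> ('n, 'en) tvec \<Rightarrow> (('p \<times> 'w) set, 'em) tvec) \<Rightarrow>
   'n \<Rightarrow> 'p \<Rightarrow> 'w \<Rightarrow> ('n, 'en) tvec \<Rightarrow> ('w, 'ew) tvec" where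
  "fibre_operator P Q W \<pi> A M \<kappa> S x p w v =
     inv_into (tspace W w) (tmap W M (\<kappa> p) w) (ver_proj P Q \<pi> A M \<kappa> (\<kappa> p w) (S x (\<kappa> p w) v))"

end

theory Submission
  imports Defs
begin

text \<open>
  Fix \<open>p\<^sub>0\<close> and a local section \<open>\<sigma>\<close> of \<open>P\<close> through \<open>p\<^sub>0\<close>.  It identifies \<open>M\<close> locally with \<open>Q \<times> W\<close>, and the
  second component of this identification is a smooth local left inverse of \<open>\<kappa>\<^bsub>p\<^sub>0\<^esub>\<close>.  Its tangent map
  therefore inverts \<open>T\<^sub>w\<kappa>\<^bsub>p\<^sub>0\<^esub>\<close> on vertical vectors, so that \<open>S\<^sub>W(x, w) = (T\<^sub>w\<kappa>\<^bsub>p\<^sub>0\<^esub>)\<inverse> \<circ> V \<circ> S(x, [p\<^sub>0, w])\<close> is a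
  composition of smooth families of linear maps.  The required identity holds at \<open>p\<^sub>0\<close> by construction and
  at every other \<open>p\<close> by independence; injectivity of \<open>T\<^sub>w\<kappa>\<^sub>p\<close> gives uniqueness, and together with
  \<open>[p g, w] = [p, g w]\<close> it gives invariance.  Horizontal lifts are smooth because they arise from an
  arbitrary smooth lift \<open>h\<close> by subtracting the infinitesimal generator of \<open>A h\<close>.
\<close>

section \<open>Calculus in finite-dimensional inner product spaces\<close>

text \<open>Smoothness is prescribed chart by chart, which is awkward to compose. The development
  therefore works with germs at a point: \<open>smooth_at\<close> for maps and
  \<open>smooth_along\<close> for tangent vectors along a map. These are stable under composition,
  tangent maps and local modification, and the chartwise conditions of \<open>smooth_map\<close> and
  \<open>stratonovich\<close> are converted to and from them. The obstacle is that
  \<open>hor_lift\<close>, \<open>ver_proj\<close> and \<open>fibre_operator\<close> are given by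
  definite descriptions or by \<open>inv_into\<close>, which say nothing about dependence on
  parameters. Each is first replaced by a closed formula built from smooth maps. Fixing p0 pays off
  because all points [p0, w] lie over the single point \<pi>(p0): one local section handles every w,
  and the fibre operator needs horizontal lifts only at p0. Independence of p then transfers the
  result to \<open>S_PW\<close>.\<close>

definition fin_dim :: "'e::real_vector itself \<Rightarrow> bool" where
  "fin_dim _ \<longleftrightarrow> (\<exists>B :: 'e set. finite B \<and> span B = UNIV)"

lemma fin_dim_expansion:
  assumes "fin_dim TYPE('e::real_inner)"
  obtains B where "finite B" "\<And>x::'e. (\<Sum>b\<in>B. ((x \<bullet> b) / (b \<bullet> b)) *\<^sub>R b) = x"
proof -
  from assms obtain B0 :: "'e set" where B0: "finite B0" "span B0 = UNIV"
    by (auto simp: fin_dim_def)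
  obtain B where B: "finite B" "span B = span B0" "pairwise orthogonal B"
    using basis_orthogonal[OF B0(1)] by blast
  have "(\<Sum>b\<in>B. ((x \<bullet> b) / (b \<bullet> b)) *\<^sub>R b) = x" for x
  proof -
    have "x \<in> span B" using B B0 by simp
    then obtain u where u: "x = (\<Sum>b\<in>B. u b *\<^sub>R b)"
      by (auto simp: span_finite[OF B(1)])
    \<comment> \<open>Neither unit length nor b \<noteq> 0 is available, hence the divisor b
      \<bullet> b; for b = 0 both sides are multiples of the zero vector.\<close>
    have "((x \<bullet> b) / (b \<bullet> b)) *\<^sub>R b = u b *\<^sub>R b" if b: "b \<in> B" for b
    proof -
      have "x \<bullet> b = (\<Sum>a\<in>B. u a * (a \<bullet> b))"
        by (simp add: u inner_sum_left)
      also have "\<dots> = (\<Sum>a\<in>B. if a = b then u b * (b \<bullet> b) else 0)"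
        by (rule sum.cong) (use B(3) b in \<open>auto simp: pairwise_def orthogonal_def\<close>)
      also have "\<dots> = u b * (b \<bullet> b)"
        using B(1) b by simp
      finally show ?thesis by simp
    qed
    then have "(\<Sum>b\<in>B. ((x \<bullet> b) / (b \<bullet> b)) *\<^sub>R b) = (\<Sum>b\<in>B. u b *\<^sub>R b)"
      by (rule sum.cong[OF refl])
    then show ?thesis by (simp only: u)
  qed
  with B(1) that show ?thesis by blast
qed

lemma fin_dim_prod:
  assumes "fin_dim TYPE('a::real_vector)" "fin_dim TYPE('b::real_vector)"
  shows "fin_dim TYPE('a \<times> 'b)"
proof -
  from assms obtain B :: "'a set" and C :: "'b set"
    where B: "finite B" "span B = UNIV" and C: "finite C" "span C = UNIV"
    by (auto simp: fin_dim_def)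
  define D where "D = (\<lambda>x. (x, 0 :: 'b)) ` B \<union> (\<lambda>y. (0 :: 'a, y)) ` C"
  have lin: "linear (\<lambda>x::'a. (x, 0 :: 'b))" "linear (\<lambda>y::'b. (0 :: 'a, y))"
    by (auto intro!: linearI)
  have "(x, y) \<in> span D" for x y
  proof -
    have "(x, 0) \<in> span ((\<lambda>x. (x, 0 :: 'b)) ` B)" "(0, y) \<in> span ((\<lambda>y. (0 :: 'a, y)) ` C)"
      using B C by (auto simp: linear_span_image[OF lin(1)] linear_span_image[OF lin(2)])
    then have "(x, 0) \<in> span D" "(0, y) \<in> span D"
      using span_mono[of _ D] unfolding D_def by blast+
    from span_add[OF this] show ?thesis by simp
  qed
  then have "finite D" "span D = UNIV"
    using B(1) C(1) unfolding D_def by auto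
  then show ?thesis unfolding fin_dim_def by blast
qed

section \<open>Calculus of maps of class C^k\<close>

lemma Ck_on_subset: "Ck_on k f S \<Longrightarrow> T \<subseteq> S \<Longrightarrow> Ck_on k f T"
  by (induction k arbitrary: f) (auto intro: continuous_on_subset)

text \<open>Openness makes agreement on S an agreement of germs, so that it passes to derivatives
  and the induction can continue.\<close>

lemma Ck_on_cong:
  assumes "open S" "\<And>x. x \<in> S \<Longrightarrow> f x = g x" "Ck_on k f S"
  shows "Ck_on k g S"
  using assms(2,3)
proof (induction k arbitrary: f g)
  case 0
  then show ?case using continuous_on_cong[of S S f g] by auto
next
  case (Suc k)
  have der: "(g has_derivative frechet_derivative f (at x)) (at x)" if "x \<in> S" for x
    using has_derivative_transform_within_open[OF _ assms(1) that Suc.prems(1)] Suc.prems(2) that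
    by (auto simp: frechet_derivative_works)
  have "frechet_derivative f (at x) v = frechet_derivative g (at x) v" if "x \<in> S" for x v
    by (metis frechet_derivative_at[OF der[OF that]])
  then have "Ck_on k (\<lambda>x. frechet_derivative g (at x) v) S" for v
    using Suc.IH[of "\<lambda>x. frechet_derivative f (at x) v"] Suc.prems by auto
  with der show ?case by (auto simp: differentiable_def)
qed

text \<open>Derivatives are unique, so any explicit family of them may be used. The rules below can
  thus supply the product or chain rule directly instead of reasoning about
  \<open>frechet_derivative\<close>.\<close>

lemma Ck_on_SucI:
  assumes "open S" "\<And>x. x \<in> S \<Longrightarrow> (f has_derivative f' x) (at x)"
    "\<And>v. Ck_on k (\<lambda>x. f' x v) S"
  shows "Ck_on (Suc k) f S"
proof -
  have "f' x v = frechet_derivative f (at x) v" if "x \<in> S" for x v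
    by (metis frechet_derivative_at[OF assms(2)[OF that]])
  then have "Ck_on k (\<lambda>x. frechet_derivative f (at x) v) S" for v
    by (intro Ck_on_cong[OF assms(1) _ assms(3)[of v]])
  with assms(2) show ?thesis by (auto simp: differentiable_def)
qed

lemma Ck_on_Suc_derivative:
  "Ck_on (Suc k) f S \<Longrightarrow> x \<in> S \<Longrightarrow> (f has_derivative frechet_derivative f (at x)) (at x)"
  by (simp add: frechet_derivative_works)

lemma Ck_on_Suc_directional_derivative:
  "Ck_on (Suc k) f S \<Longrightarrow> Ck_on k (\<lambda>x. frechet_derivative f (at x) v) S"
  by simp

lemma Ck_on_Suc_imp: "Ck_on (Suc k) f S \<Longrightarrow> Ck_on k f S"
proof (induction k arbitrary: f)
  case 0
  then show ?case
    by (auto intro!: continuous_at_imp_continuous_on differentiable_imp_continuous_within)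
next
  case (Suc k)
  have "Ck_on k (\<lambda>x. frechet_derivative f (at x) v) S" for v
    by (rule Suc.IH[OF Ck_on_Suc_directional_derivative[OF Suc.prems]])
  with Suc.prems show ?case by (simp only: Ck_on.simps(2)) blast
qed

lemma Ck_on_const: "Ck_on k (\<lambda>x. c) S"
  by (induction k arbitrary: c) auto

lemma Ck_on_bounded_linear:
  assumes "bounded_linear L" "open S" "Ck_on k f S"
  shows "Ck_on k (\<lambda>x. L (f x)) S"
  using assms(3)
proof (induction k arbitrary: f)
  case 0
  then show ?case by (simp add: bounded_linear.continuous_on[OF assms(1)])
next
  case (Suc k)
  show ?case
    by (rule Ck_on_SucI[OF assms(2) bounded_linear.has_derivative[OF assms(1)
          Ck_on_Suc_derivative[OF Suc.prems]]]) (use Suc in auto)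
qed

lemma Ck_on_ident: "open S \<Longrightarrow> Ck_on k (\<lambda>x. x) S"
  by (cases k) (auto intro!: Ck_on_SucI[OF _ has_derivative_ident] Ck_on_const continuous_on_id
      simp del: Ck_on.simps(2))

lemma Ck_on_add:
  assumes "open S" "Ck_on k f S" "Ck_on k g S"
  shows "Ck_on k (\<lambda>x. f x + g x) S"
  using assms(2,3)
proof (induction k arbitrary: f g)
  case 0
  then show ?case by (auto intro: continuous_on_add)
next
  case (Suc k)
  show ?case
    by (rule Ck_on_SucI[OF assms(1) has_derivative_add[OF
          Ck_on_Suc_derivative[OF Suc.prems(1)] Ck_on_Suc_derivative[OF Suc.prems(2)]]])
      (use Suc in auto)
qed

lemma Ck_on_sum:
  assumes "open S" "finite B" "\<And>b. b \<in> B \<Longrightarrow> Ck_on k (f b) S"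
  shows "Ck_on k (\<lambda>x. \<Sum>b\<in>B. f b x) S"
  using assms(2,3) by (induction B) (auto intro!: Ck_on_add Ck_on_const assms(1))

text \<open>The product rule mixes f and g with their derivatives, so the induction step needs the
  factors themselves in class C^k; hence the appeal to \<open>Ck_on_Suc_imp\<close>.\<close>

lemma Ck_on_scaleR:
  assumes "open S" "Ck_on k f S" "Ck_on k g S"
  shows "Ck_on k (\<lambda>x. f x *\<^sub>R g x) S"
  using assms(2,3)
proof (induction k arbitrary: f g)
  case 0
  then show ?case by (auto intro: continuous_on_scaleR)
next
  case (Suc k)
  note fg = Suc.prems[THEN Ck_on_Suc_imp] Suc.prems[THEN Ck_on_Suc_directional_derivative]
  have "Ck_on k (\<lambda>x. f x *\<^sub>R frechet_derivative g (at x) v +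
      frechet_derivative f (at x) v *\<^sub>R g x) S" for v
    by (intro Ck_on_add assms(1) Suc.IH fg)
  note deriv = this
  show ?case
    by (rule Ck_on_SucI[OF assms(1) has_derivative_scaleR[OF
          Ck_on_Suc_derivative[OF Suc.prems(1)] Ck_on_Suc_derivative[OF Suc.prems(2)]]])
      (assumption | rule deriv)+
qed

lemma Ck_on_Pair:
  assumes "open S" "Ck_on k f S" "Ck_on k g S"
  shows "Ck_on k (\<lambda>x. (f x, g x)) S"
  using assms(2,3)
proof (induction k arbitrary: f g)
  case 0
  then show ?case by (auto intro: continuous_on_Pair)
next
  case (Suc k)
  show ?case
    by (rule Ck_on_SucI[OF assms(1) has_derivative_Pair[OF
          Ck_on_Suc_derivative[OF Suc.prems(1)] Ck_on_Suc_derivative[OF Suc.prems(2)]]])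
      (use Suc in auto)
qed

lemma linear_fin_dim_expansion:
  fixes L :: "'e::real_inner \<Rightarrow> 'b::real_vector"
  assumes "linear L" "\<And>x::'e. (\<Sum>b\<in>B. ((x \<bullet> b) / (b \<bullet> b)) *\<^sub>R b) = x"
  shows "L x = (\<Sum>b\<in>B. ((x \<bullet> b) / (b \<bullet> b)) *\<^sub>R L b)"
proof -
  have "L x = L (\<Sum>b\<in>B. ((x \<bullet> b) / (b \<bullet> b)) *\<^sub>R b)"
    by (simp only: assms(2))
  then show ?thesis
    by (simp only: linear_sum[OF assms(1)] linear_cmul[OF assms(1)])
qed

text \<open>The varying vector is expanded in an orthogonal basis; this is where finite dimension enters.\<close>

lemma Ck_on_linear_apply:
  fixes L :: "'a::real_normed_vector \<Rightarrow> 'e::real_inner \<Rightarrow> 'b::real_normed_vector"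
  assumes fin: "fin_dim TYPE('e)" and S: "open S" and lin: "\<And>x. x \<in> S \<Longrightarrow> linear (L x)"
    and L: "\<And>e. Ck_on k (\<lambda>x. L x e) S" and v: "Ck_on k v S"
  shows "Ck_on k (\<lambda>x. L x (v x)) S"
proof -
  obtain B :: "'e set" where B: "finite B" "\<And>x. (\<Sum>b\<in>B. ((x \<bullet> b) / (b \<bullet> b)) *\<^sub>R b) = x"
    using fin_dim_expansion[OF fin] by blast
  have bl: "bounded_linear (\<lambda>x. (x \<bullet> b) / (b \<bullet> b))" for b :: 'e
    by (rule bounded_linear_compose[OF bounded_linear_divide bounded_linear_inner_left])
  have "Ck_on k (\<lambda>x. \<Sum>b\<in>B. ((v x \<bullet> b) / (b \<bullet> b)) *\<^sub>R L x b) S"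
    by (intro Ck_on_sum Ck_on_scaleR S B(1) L Ck_on_bounded_linear[OF bl S v])
  then show ?thesis
    by (rule Ck_on_cong[OF S, rotated]) (rule linear_fin_dim_expansion[OF lin B(2), symmetric])
qed

text \<open>By the chain rule the derivative in direction v is Dg(f x) applied to Df(x) v, where
  both the linear map and its argument vary with x. The induction hypothesis handles Dg(f x) e for
  fixed e, and \<open>Ck_on_linear_apply\<close> admits the varying argument. This is why the
  induction generalises over g, while f only drops one order.\<close>

lemma Ck_on_compose:
  fixes f :: "'a::real_normed_vector \<Rightarrow> 'e::real_inner" and g :: "'e \<Rightarrow> 'b::real_normed_vector"
  assumes fin: "fin_dim TYPE('e)" and S: "open S" "open T" "f ` S \<subseteq> T"
    and f: "Ck_on k f S" and g: "Ck_on k g T"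
  shows "Ck_on k (\<lambda>x. g (f x)) S"
  using f g
proof (induction k arbitrary: g)
  case 0
  then show ?case using S(3) by (auto intro: continuous_on_compose2)
next
  case (Suc k)
  have der: "((\<lambda>x. g (f x)) has_derivative
      (\<lambda>v. frechet_derivative g (at (f x)) (frechet_derivative f (at x) v))) (at x)"
    if x: "x \<in> S" for x
    by (rule has_derivative_compose[OF Ck_on_Suc_derivative[OF Suc.prems(1) x]
          Ck_on_Suc_derivative[OF Suc.prems(2)]]) (use x S(3) in blast)
  show ?case
  proof (rule Ck_on_SucI[OF S(1) der], assumption)
    fix v
    show "Ck_on k (\<lambda>x. frechet_derivative g (at (f x)) (frechet_derivative f (at x) v)) S"
    proof (rule Ck_on_linear_apply[OF fin S(1)])
      show "linear (frechet_derivative g (at (f x)))" if "x \<in> S" for x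
        using Suc.prems(2) S(3) that by (auto intro: linear_frechet_derivative)
      show "Ck_on k (\<lambda>x. frechet_derivative g (at (f x)) e) S" for e
        by (rule Suc.IH[OF Ck_on_Suc_imp[OF Suc.prems(1)]
              Ck_on_Suc_directional_derivative[OF Suc.prems(2)]])
    qed (use Suc.prems in simp)
  qed
qed

lemma smooth_on_subset: "smooth_on S f \<Longrightarrow> T \<subseteq> S \<Longrightarrow> smooth_on T f"
  using Ck_on_subset unfolding smooth_on_def by blast

lemma smooth_on_cong:
  "smooth_on S f \<Longrightarrow> open S \<Longrightarrow> (\<And>x. x \<in> S \<Longrightarrow> f x = g x) \<Longrightarrow> smooth_on S g"
  using Ck_on_cong unfolding smooth_on_def by metis

lemma smooth_on_imp_continuous_on: "smooth_on S f \<Longrightarrow> continuous_on S f"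
  unfolding smooth_on_def by (metis Ck_on.simps(1))

lemma smooth_on_differentiable: "smooth_on S f \<Longrightarrow> x \<in> S \<Longrightarrow> f differentiable at x"
  unfolding smooth_on_def by (metis Ck_on.simps(2))

lemma smooth_on_directional_derivative:
  "smooth_on S f \<Longrightarrow> smooth_on S (\<lambda>x. frechet_derivative f (at x) v)"
  unfolding smooth_on_def by (metis Ck_on.simps(2))

lemma Ck_on_local:
  assumes "\<And>x. x \<in> S \<Longrightarrow> \<exists>T. open T \<and> x \<in> T \<and> Ck_on k f T"
  shows "Ck_on k f S"
  using assms
proof (induction k arbitrary: f)
  case 0
  have "continuous (at x) f" if "x \<in> S" for x
    using 0[OF that] by (auto simp: continuous_on_eq_continuous_at)
  then show ?case by (simp add: continuous_at_imp_continuous_on)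
next
  case (Suc k)
  have "Ck_on k (\<lambda>x. frechet_derivative f (at x) v) S" for v
    by (rule Suc.IH) (use Suc.prems in \<open>fastforce\<close>)
  moreover have "f differentiable at x" if "x \<in> S" for x
    using Suc.prems[OF that] by auto
  ultimately show ?case by simp
qed

section \<open>Germs of smooth maps\<close>

text \<open>One neighbourhood serves all orders of differentiability. With germs, domains of
  coordinate expressions need not be tracked: eventual equality replaces them.\<close>

definition smooth_near :: "('a::real_normed_vector \<Rightarrow> 'b::real_normed_vector) \<Rightarrow> 'a \<Rightarrow> bool" where
  "smooth_near f a \<longleftrightarrow> (\<exists>S. open S \<and> a \<in> S \<and> smooth_on S f)"

lemma smooth_nearI: "open S \<Longrightarrow> a \<in> S \<Longrightarrow> smooth_on S f \<Longrightarrow> smooth_near f a"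
  unfolding smooth_near_def by blast

lemma smooth_on_if_smooth_near: "(\<And>x. x \<in> S \<Longrightarrow> smooth_near f x) \<Longrightarrow> smooth_on S f"
  unfolding smooth_near_def smooth_on_def by (intro allI Ck_on_local) blast

lemma smooth_near_cong:
  assumes "smooth_near f a" "\<forall>\<^sub>F x in nhds a. f x = g x"
  shows "smooth_near g a"
proof -
  obtain S T where "open S" "a \<in> S" "smooth_on S f" "open T" "a \<in> T" "\<And>x. x \<in> T \<Longrightarrow> f x = g x"
    using assms unfolding smooth_near_def eventually_nhds by blast
  then show ?thesis
    by (intro smooth_nearI[of "S \<inter> T"] smooth_on_cong[of _ f g]) (auto intro: smooth_on_subset)
qed

lemma smooth_near_tendsto: "smooth_near f a \<Longrightarrow> filterlim f (nhds (f a)) (nhds a)"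
  unfolding smooth_near_def
  by (metis smooth_on_imp_continuous_on continuous_on_eq_continuous_at isCont_def tendsto_at_iff_tendsto_nhds)

lemma smooth_near_has_derivative:
  "smooth_near f a \<Longrightarrow> (f has_derivative frechet_derivative f (at a)) (at a)"
  unfolding smooth_near_def using smooth_on_differentiable frechet_derivative_works by blast

lemma smooth_near_linear: "smooth_near f a \<Longrightarrow> linear (frechet_derivative f (at a))"
  using smooth_near_has_derivative has_derivative_linear by blast

lemma eventually_smooth_near: "smooth_near f a \<Longrightarrow> \<forall>\<^sub>F x in nhds a. smooth_near f x"
  unfolding smooth_near_def eventually_nhds by blast

lemma smooth_near_const: "smooth_near (\<lambda>x. c) a"
  by (rule smooth_nearI[of UNIV]) (auto simp: smooth_on_def Ck_on_const)

lemma smooth_near_ident: "smooth_near (\<lambda>x. x) a"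
  by (rule smooth_nearI[of UNIV]) (auto simp: smooth_on_def Ck_on_ident)

lemma smooth_near_bounded_linear:
  "bounded_linear L \<Longrightarrow> smooth_near f a \<Longrightarrow> smooth_near (\<lambda>x. L (f x)) a"
  unfolding smooth_near_def smooth_on_def using Ck_on_bounded_linear by blast

lemmas smooth_near_fst = smooth_near_bounded_linear[OF bounded_linear_fst]
lemmas smooth_near_snd = smooth_near_bounded_linear[OF bounded_linear_snd]

lemma smooth_near_conj:
  assumes "smooth_near f a" "smooth_near g a"
  obtains S where "open S" "a \<in> S" "smooth_on S f" "smooth_on S g"
proof -
  obtain S T where "open S" "a \<in> S" "smooth_on S f" "open T" "a \<in> T" "smooth_on T g"
    using assms unfolding smooth_near_def by blast
  then show ?thesis
    by (intro that[of "S \<inter> T"]) (auto intro: smooth_on_subset)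
qed

lemma smooth_near_add:
  "smooth_near f a \<Longrightarrow> smooth_near g a \<Longrightarrow> smooth_near (\<lambda>x. f x + g x) a"
  by (erule (1) smooth_near_conj) (auto intro!: smooth_nearI Ck_on_add simp: smooth_on_def)

lemma smooth_near_Pair:
  "smooth_near f a \<Longrightarrow> smooth_near g a \<Longrightarrow> smooth_near (\<lambda>x. (f x, g x)) a"
  by (erule (1) smooth_near_conj) (auto intro!: smooth_nearI Ck_on_Pair simp: smooth_on_def)

lemma smooth_near_compose:
  fixes f :: "'a::real_normed_vector \<Rightarrow> 'e::real_inner" and g :: "'e \<Rightarrow> 'b::real_normed_vector"
  assumes fin: "fin_dim TYPE('e)" and f: "smooth_near f a" and g: "smooth_near g (f a)"
  shows "smooth_near (\<lambda>x. g (f x)) a"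
proof -
  obtain S T where S: "open S" "a \<in> S" "smooth_on S f" and T: "open T" "f a \<in> T" "smooth_on T g"
    using f g unfolding smooth_near_def by blast
  have "open (S \<inter> f -` T)"
    using continuous_open_preimage[OF smooth_on_imp_continuous_on[OF S(3)] S(1) T(1)] by simp
  moreover have "smooth_on (S \<inter> f -` T) (\<lambda>x. g (f x))"
    unfolding smooth_on_def
  proof
    fix k
    have "Ck_on k f (S \<inter> f -` T)" "Ck_on k g T"
      using smooth_on_subset[OF S(3), of "S \<inter> f -` T"] T(3) by (auto simp: smooth_on_def)
    moreover have "f ` (S \<inter> f -` T) \<subseteq> T" by auto
    ultimately show "Ck_on k (\<lambda>x. g (f x)) (S \<inter> f -` T)"
      using Ck_on_compose[OF fin \<open>open (S \<inter> f -` T)\<close> T(1)] by blast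
  qed
  ultimately show ?thesis
    using S T by (intro smooth_nearI) auto
qed

text \<open>The neighbourhood on which x -> L x e is smooth may depend on e. Expanding v in a finite
  basis leaves only finitely many vectors e, so one neighbourhood can be chosen for all of
  them.\<close>

lemma smooth_near_linear_apply:
  fixes L :: "'a::real_normed_vector \<Rightarrow> 'e::real_inner \<Rightarrow> 'b::real_normed_vector"
  assumes fin: "fin_dim TYPE('e)" and lin: "\<forall>\<^sub>F x in nhds a. linear (L x)"
    and L: "\<And>e. smooth_near (\<lambda>x. L x e) a" and v: "smooth_near v a"
  shows "smooth_near (\<lambda>x. L x (v x)) a"
proof -
  obtain B :: "'e set" where B: "finite B" "\<And>x. (\<Sum>b\<in>B. ((x \<bullet> b) / (b \<bullet> b)) *\<^sub>R b) = x"
    using fin_dim_expansion[OF fin] by blast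
  have "\<exists>S. open S \<and> a \<in> S \<and> (\<forall>b\<in>B. smooth_on S (\<lambda>x. L x b))"
    using B(1)
  proof (induction B)
    case (insert b B)
    then obtain S where S: "open S" "a \<in> S" "\<forall>b\<in>B. smooth_on S (\<lambda>x. L x b)" by blast
    obtain T where T: "open T" "a \<in> T" "smooth_on T (\<lambda>x. L x b)"
      using L[of b] by (auto simp: smooth_near_def)
    from S T show ?case by (intro exI[of _ "S \<inter> T"]) (auto intro: smooth_on_subset)
  qed auto
  then obtain S where S: "open S" "a \<in> S" "\<And>b. b \<in> B \<Longrightarrow> smooth_on S (\<lambda>x. L x b)" by blast
  obtain T where T: "open T" "a \<in> T" "smooth_on T v"
    using v by (auto simp: smooth_near_def)
  obtain U where U: "open U" "a \<in> U" "\<And>x. x \<in> U \<Longrightarrow> linear (L x)"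
    using lin by (auto simp: eventually_nhds)
  define O' where "O' = S \<inter> T \<inter> U"
  have O': "open O'" "a \<in> O'" using S T U by (auto simp: O'_def)
  have bl: "bounded_linear (\<lambda>x. (x \<bullet> b) / (b \<bullet> b))" for b :: 'e
    by (rule bounded_linear_compose[OF bounded_linear_divide bounded_linear_inner_left])
  have "smooth_on O' (\<lambda>x. \<Sum>b\<in>B. ((v x \<bullet> b) / (b \<bullet> b)) *\<^sub>R L x b)"
    unfolding smooth_on_def
  proof (intro allI Ck_on_sum Ck_on_scaleR O'(1) B(1) Ck_on_bounded_linear[OF bl O'(1)])
    show "Ck_on k v O'" "Ck_on k (\<lambda>x. L x b) O'" if "b \<in> B" for b k
      using S(3)[OF that] T(3) unfolding smooth_on_def O'_def by (auto intro: Ck_on_subset)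
  qed
  moreover have "(\<Sum>b\<in>B. ((v x \<bullet> b) / (b \<bullet> b)) *\<^sub>R L x b) = L x (v x)" if "x \<in> O'" for x
    using linear_fin_dim_expansion[OF U(3) B(2), symmetric] that by (auto simp: O'_def)
  ultimately have "smooth_on O' (\<lambda>x. L x (v x))"
    by (rule smooth_on_cong[OF _ O'(1)])
  with O' show ?thesis by (rule smooth_nearI)
qed

text \<open>Base point and argument of the derivative both move with x, as they do in the coordinate
  formula for a tangent map applied to a vector field along a map.\<close>

lemma smooth_near_derivative:
  fixes f :: "'a::real_normed_vector \<Rightarrow> 'e::real_inner" and g :: "'e \<Rightarrow> 'b::real_normed_vector"
  assumes fin: "fin_dim TYPE('e)" and f: "smooth_near f a" and g: "smooth_near g (f a)"
    and v: "smooth_near v a"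
  shows "smooth_near (\<lambda>x. frechet_derivative g (at (f x)) (v x)) a"
proof (rule smooth_near_linear_apply[OF fin _ _ v])
  have "\<forall>\<^sub>F x in nhds a. smooth_near g (f x)"
    using eventually_compose_filterlim[OF eventually_smooth_near[OF g] smooth_near_tendsto[OF f]] .
  then show "\<forall>\<^sub>F x in nhds a. linear (frechet_derivative g (at (f x)))"
    by eventually_elim (rule smooth_near_linear)
  fix e
  have "smooth_near (\<lambda>y. frechet_derivative g (at y) e) (f a)"
    using g unfolding smooth_near_def by (blast intro: smooth_on_directional_derivative)
  then show "smooth_near (\<lambda>x. frechet_derivative g (at (f x)) e) a"
    by (rule smooth_near_compose[OF fin f])
qed

lemma frechet_derivative_cong:
  assumes "smooth_near f a" "\<forall>\<^sub>F x in nhds a. f x = g x"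
  shows "frechet_derivative g (at a) = frechet_derivative f (at a)"
proof -
  obtain S where S: "open S" "a \<in> S" "\<And>x. x \<in> S \<Longrightarrow> f x = g x"
    using assms(2) unfolding eventually_nhds by blast
  show ?thesis
    using has_derivative_transform_within_open[OF smooth_near_has_derivative[OF assms(1)] S]
    by (metis frechet_derivative_at)
qed

lemma frechet_derivative_chain:
  assumes "smooth_near f a" "smooth_near g (f a)"
  shows "frechet_derivative (\<lambda>x. g (f x)) (at a) v =
    frechet_derivative g (at (f a)) (frechet_derivative f (at a) v)"
  by (metis frechet_derivative_at[OF has_derivative_compose[OF
        smooth_near_has_derivative[OF assms(1)] smooth_near_has_derivative[OF assms(2)]]])

section \<open>Smooth maps at a point\<close>

text \<open>The part of \<^const>\<open>manifold\<close> that the differential calculus needs: the total space of an associated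
  bundle is not shown to be Hausdorff or second countable.\<close>

definition regular_atlas :: "('a, 'e::real_inner) atlas \<Rightarrow> bool" where
  "regular_atlas M \<longleftrightarrow> fin_dim TYPE('e) \<and> smooth_atlas M"

lemma manifold_regular_atlas: "manifold M \<Longrightarrow> regular_atlas M"
  by (simp add: manifold_def regular_atlas_def fin_dim_def)

lemma points_chart: "x \<in> points M \<longleftrightarrow> (\<exists>c\<in>M. x \<in> cdom c)"
  by (auto simp: points_def)

lemma chart_in_points: "c \<in> M \<Longrightarrow> x \<in> cdom c \<Longrightarrow> x \<in> points M"
  by (auto simp: points_def)

lemma pointsE: "x \<in> points M \<Longrightarrow> (\<And>c. c \<in> M \<Longrightarrow> x \<in> cdom c \<Longrightarrow> thesis) \<Longrightarrow> thesis"
  by (auto simp: points_def)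

lemma cinv_in: "a \<in> cimg c \<Longrightarrow> cinv c a \<in> cdom c"
  by (rule inv_into_into)

lemma cmap_cinv: "a \<in> cimg c \<Longrightarrow> cmap c (cinv c a) = a"
  by (rule f_inv_into_f)

lemma regular_atlas_fin: "regular_atlas (M :: ('a, 'e::real_inner) atlas) \<Longrightarrow> fin_dim TYPE('e)"
  by (simp add: regular_atlas_def)

lemma cinv_cmap: "regular_atlas M \<Longrightarrow> c \<in> M \<Longrightarrow> x \<in> cdom c \<Longrightarrow> cinv c (cmap c x) = x"
  unfolding regular_atlas_def smooth_atlas_def by (blast intro: inv_into_f_f)

lemma open_overlap:
  "regular_atlas M \<Longrightarrow> c \<in> M \<Longrightarrow> d \<in> M \<Longrightarrow> open (cmap c ` (cdom c \<inter> cdom d))"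
  unfolding regular_atlas_def smooth_atlas_def by blast

lemma open_cimg: "regular_atlas M \<Longrightarrow> c \<in> M \<Longrightarrow> open (cimg c)"
  using open_overlap[of M c c] by simp

lemma eventually_cimg:
  "regular_atlas M \<Longrightarrow> c \<in> M \<Longrightarrow> x \<in> cdom c \<Longrightarrow> \<forall>\<^sub>F a in nhds (cmap c x). a \<in> cimg c"
  using open_cimg by (blast intro: eventually_nhds_in_open)

lemma smooth_near_transition:
  assumes "regular_atlas M" "c \<in> M" "d \<in> M" "x \<in> cdom c" "x \<in> cdom d"
  shows "smooth_near (\<lambda>a. cmap d (cinv c a)) (cmap c x)"
proof (rule smooth_nearI)
  show "smooth_on (cmap c ` (cdom c \<inter> cdom d)) (\<lambda>a. cmap d (cinv c a))"
    using assms unfolding regular_atlas_def smooth_atlas_def comp_def by blast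
qed (use assms in \<open>auto intro: open_overlap\<close>)

section \<open>Neighbourhood filters in the atlas topology\<close>

definition mnhds :: "('a, 'e::real_inner) atlas \<Rightarrow> 'a \<Rightarrow> 'a filter" where
  "mnhds M x = nhdsin (topology (atlas_open M)) x"

lemma eventually_mnhds:
  assumes M: "regular_atlas M" and x: "x \<in> points M"
  shows "eventually P (mnhds M x) \<longleftrightarrow> (\<exists>U. atlas_open M U \<and> x \<in> U \<and> (\<forall>y\<in>U. P y))"
proof -
  have op: "openin (topology (atlas_open M)) = atlas_open M"
    using istopology_atlas_open M by (metis regular_atlas_def topology_inverse')
  have "atlas_open M (points M)"
    unfolding atlas_open_def
  proof (intro conjI ballI subset_refl)
    fix c assume c: "c \<in> M"
    then have "points M \<inter> cdom c = cdom c" by (auto simp: points_def)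
    with open_cimg[OF M c] show "open (cmap c ` (points M \<inter> cdom c))" by simp
  qed
  with x have "x \<in> topspace (topology (atlas_open M))"
    unfolding topspace_def op by blast
  then show ?thesis
    by (simp add: mnhds_def eventually_nhdsin op)
qed

text \<open>Neighbourhoods may be computed in one chart because transition maps are continuous: the
  chart preimage U of an open set S is open in every other chart too. As \<open>atlas_open\<close>
  demands openness in all charts, this is the nontrivial direction.\<close>

lemma mnhds_chart:
  assumes M: "regular_atlas M" and c: "c \<in> M" "x \<in> cdom c"
  shows "mnhds M x = filtermap (cinv c) (nhds (cmap c x))"
proof (rule filter_eqI)
  fix P
  have x: "x \<in> points M" using c by (rule chart_in_points)
  show "eventually P (mnhds M x) = eventually P (filtermap (cinv c) (nhds (cmap c x)))"
    unfolding eventually_mnhds[OF M x] eventually_filtermap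
  proof
    assume "\<exists>U. atlas_open M U \<and> x \<in> U \<and> (\<forall>y\<in>U. P y)"
    then obtain U where U: "atlas_open M U" "x \<in> U" "\<forall>y\<in>U. P y" by blast
    show "\<forall>\<^sub>F a in nhds (cmap c x). P (cinv c a)"
      unfolding eventually_nhds
    proof (intro exI[of _ "cmap c ` (U \<inter> cdom c)"] conjI ballI)
      show "P (cinv c a)" if "a \<in> cmap c ` (U \<inter> cdom c)" for a
        using that U(3) cinv_cmap[OF M c(1)] by auto
    qed (use U c in \<open>auto simp: atlas_open_def\<close>)
  next
    assume "\<forall>\<^sub>F a in nhds (cmap c x). P (cinv c a)"
    then obtain S where S: "open S" "cmap c x \<in> S" "\<forall>a\<in>S. P (cinv c a)"
      unfolding eventually_nhds by blast
    define U where "U = {y \<in> cdom c. cmap c y \<in> S}"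
    have "atlas_open M U"
      unfolding atlas_open_def
    proof (intro conjI ballI)
      show "U \<subseteq> points M" using c(1) by (auto simp: U_def points_def)
      fix d assume d: "d \<in> M"
      let ?V = "cmap d ` (cdom d \<inter> cdom c)"
      have "continuous_on ?V (\<lambda>a. cmap c (cinv d a))"
        using M c(1) d unfolding regular_atlas_def smooth_atlas_def comp_def
        by (intro smooth_on_imp_continuous_on) blast
      then have "open (?V \<inter> (\<lambda>a. cmap c (cinv d a)) -` S)"
        using continuous_open_preimage open_overlap[OF M d c(1)] S(1) by blast
      also have "?V \<inter> (\<lambda>a. cmap c (cinv d a)) -` S = cmap d ` (U \<inter> cdom d)"
        using cinv_cmap[OF M d] by (auto simp: U_def)
      finally show "open (cmap d ` (U \<inter> cdom d))" .
    qed
    moreover have "P y" if "y \<in> U" for y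
      using that S(3) cinv_cmap[OF M c(1)] by (force simp: U_def)
    ultimately show "\<exists>U. atlas_open M U \<and> x \<in> U \<and> (\<forall>y\<in>U. P y)"
      using c(2) S(2) by (intro exI[of _ U]) (auto simp: U_def)
  qed
qed

lemma eventually_mnhds_chart:
  assumes "regular_atlas M" "c \<in> M" "x \<in> cdom c"
  shows "eventually P (mnhds M x) \<longleftrightarrow> (\<forall>\<^sub>F a in nhds (cmap c x). P (cinv c a))"
  by (simp add: mnhds_chart[OF assms] eventually_filtermap)

lemma eventually_cdom:
  assumes "regular_atlas M" "c \<in> M" "x \<in> cdom c"
  shows "\<forall>\<^sub>F y in mnhds M x. y \<in> cdom c"
  unfolding eventually_mnhds_chart[OF assms]
  by (rule eventually_mono[OF eventually_cimg[OF assms]]) (rule cinv_in)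

lemma eventually_points:
  "regular_atlas M \<Longrightarrow> x \<in> points M \<Longrightarrow> \<forall>\<^sub>F y in mnhds M x. y \<in> points M"
  by (erule pointsE) (auto intro: eventually_mono[OF eventually_cdom] chart_in_points)

lemma eventually_mnhds_self:
  "regular_atlas M \<Longrightarrow> x \<in> points M \<Longrightarrow> eventually P (mnhds M x) \<Longrightarrow> P x"
  by (auto simp: eventually_mnhds)

lemma eventually_mnhds_open:
  "regular_atlas M \<Longrightarrow> atlas_open M U \<Longrightarrow> x \<in> U \<Longrightarrow> \<forall>\<^sub>F y in mnhds M x. y \<in> U"
  by (subst eventually_mnhds) (auto simp: atlas_open_def)

section \<open>Smoothness of functions and maps at a point\<close>

definition smooth_fun_at :: "('a, 'e::real_inner) atlas \<Rightarrow> ('a \<Rightarrow> 'v::real_normed_vector) \<Rightarrow> 'a \<Rightarrow> bool" where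
  "smooth_fun_at M h x \<longleftrightarrow> x \<in> points M \<and>
     (\<forall>c\<in>M. x \<in> cdom c \<longrightarrow> smooth_near (\<lambda>a. h (cinv c a)) (cmap c x))"

text \<open>Smoothness of a map is reduced to that of vector-valued functions through target charts.
  The \<open>filterlim\<close> clause is continuity at x; it keeps nearby values inside the target
  chart, where the coordinate expression is meaningful.\<close>

definition smooth_at ::
  "('a, 'e::real_inner) atlas \<Rightarrow> ('b, 'f::real_inner) atlas \<Rightarrow> ('a \<Rightarrow> 'b) \<Rightarrow> 'a \<Rightarrow> bool" where
  "smooth_at M N f x \<longleftrightarrow> x \<in> points M \<and> f x \<in> points N \<and>
     filterlim f (mnhds N (f x)) (mnhds M x) \<and>
     (\<forall>d\<in>N. f x \<in> cdom d \<longrightarrow> smooth_fun_at M (\<lambda>y. cmap d (f y)) x)"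

lemma smooth_fun_atD:
  "smooth_fun_at M h x \<Longrightarrow> c \<in> M \<Longrightarrow> x \<in> cdom c \<Longrightarrow> smooth_near (\<lambda>a. h (cinv c a)) (cmap c x)"
  by (simp add: smooth_fun_at_def)

lemma smooth_at_in: "smooth_at M N f x \<Longrightarrow> x \<in> points M" "smooth_at M N f x \<Longrightarrow> f x \<in> points N"
  by (simp_all add: smooth_at_def)

lemma smooth_at_filterlim: "smooth_at M N f x \<Longrightarrow> filterlim f (mnhds N (f x)) (mnhds M x)"
  by (simp add: smooth_at_def)

lemma smooth_at_eventually:
  "smooth_at M N f x \<Longrightarrow> eventually P (mnhds N (f x)) \<Longrightarrow> \<forall>\<^sub>F y in mnhds M x. P (f y)"
  by (rule eventually_compose_filterlim[OF _ smooth_at_filterlim])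

lemma smooth_at_cmap:
  "smooth_at M N f x \<Longrightarrow> d \<in> N \<Longrightarrow> f x \<in> cdom d \<Longrightarrow> smooth_fun_at M (\<lambda>y. cmap d (f y)) x"
  by (simp add: smooth_at_def)

lemma smooth_fun_atI:
  assumes M: "regular_atlas M" and c: "c \<in> M" "x \<in> cdom c"
    and h: "smooth_near (\<lambda>a. h (cinv c a)) (cmap c x)"
  shows "smooth_fun_at M h x"
  unfolding smooth_fun_at_def
proof (intro conjI ballI impI chart_in_points[OF c])
  fix d assume d: "d \<in> M" "x \<in> cdom d"
  have "smooth_near (\<lambda>a. h (cinv c (cmap c (cinv d a)))) (cmap d x)"
    using smooth_near_compose[OF regular_atlas_fin[OF M] smooth_near_transition[OF M d(1) c(1) d(2) c(2)],
        of "\<lambda>a. h (cinv c a)"] h by (simp add: cinv_cmap[OF M] d)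
  moreover have "\<forall>\<^sub>F a in nhds (cmap d x). h (cinv c (cmap c (cinv d a))) = h (cinv d a)"
    using eventually_cdom[OF M c] unfolding eventually_mnhds_chart[OF M d]
    by eventually_elim (simp add: cinv_cmap[OF M c(1)])
  ultimately show "smooth_near (\<lambda>a. h (cinv d a)) (cmap d x)"
    by (rule smooth_near_cong)
qed

lemma smooth_fun_at_cong:
  assumes M: "regular_atlas M" and h: "smooth_fun_at M h x" "\<forall>\<^sub>F y in mnhds M x. h y = k y"
  shows "smooth_fun_at M k x"
proof -
  obtain c where c: "c \<in> M" "x \<in> cdom c" using h(1) by (auto simp: smooth_fun_at_def points_chart)
  show ?thesis
    using smooth_fun_atI[OF M c smooth_near_cong[OF smooth_fun_atD[OF h(1) c]]] h(2)
    by (simp add: eventually_mnhds_chart[OF M c])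
qed

text \<open>Continuity at x is recovered from the coordinates: near x the map is the chart inverse
  applied to its own smooth coordinate expression. All other charts are reached by transition
  maps.\<close>

lemma smooth_atI:
  assumes M: "regular_atlas M" and N: "regular_atlas N"
    and c: "c \<in> M" "x \<in> cdom c" and d: "d \<in> N" "f x \<in> cdom d"
    and ev: "\<forall>\<^sub>F a in nhds (cmap c x). f (cinv c a) \<in> cdom d"
    and f: "smooth_near (\<lambda>a. cmap d (f (cinv c a))) (cmap c x)"
  shows "smooth_at M N f x"
  unfolding smooth_at_def
proof (intro conjI ballI impI chart_in_points[OF c] chart_in_points[OF d])
  have *: "\<forall>\<^sub>F a in nhds (cmap c x). cinv d (cmap d (f (cinv c a))) = f (cinv c a)"
    using ev by eventually_elim (simp add: cinv_cmap[OF N d(1)])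
  have lim: "filterlim (\<lambda>a. cmap d (f (cinv c a))) (nhds (cmap d (f x))) (nhds (cmap c x))"
    using smooth_near_tendsto[OF f] by (simp add: cinv_cmap[OF M c])
  have "filterlim (cinv d) (mnhds N (f x)) (nhds (cmap d (f x)))"
    by (simp add: filterlim_def mnhds_chart[OF N d])
  from filterlim_compose[OF this lim]
  have "filterlim (\<lambda>a. f (cinv c a)) (mnhds N (f x)) (nhds (cmap c x))"
    using filterlim_cong[OF refl refl *] by blast
  then show "filterlim f (mnhds N (f x)) (mnhds M x)"
    by (simp add: mnhds_chart[OF M c] filterlim_filtermap)
  fix d' assume d': "d' \<in> N" "f x \<in> cdom d'"
  have "smooth_near (\<lambda>a. cmap d' (cinv d (cmap d (f (cinv c a))))) (cmap c x)"
    using smooth_near_compose[OF regular_atlas_fin[OF N] f, of "\<lambda>a. cmap d' (cinv d a)"]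
      smooth_near_transition[OF N d(1) d'(1) d(2) d'(2)] by (simp add: cinv_cmap[OF M c])
  then have "smooth_near (\<lambda>a. cmap d' (f (cinv c a))) (cmap c x)"
    by (rule smooth_near_cong) (rule eventually_mono[OF *], simp)
  then show "smooth_fun_at M (\<lambda>y. cmap d' (f y)) x"
    by (rule smooth_fun_atI[OF M c])
qed

lemma smooth_fun_at_compose:
  assumes M: "regular_atlas M" and N: "regular_atlas N"
    and f: "smooth_at M N f x" and h: "smooth_fun_at N h (f x)"
  shows "smooth_fun_at M (\<lambda>y. h (f y)) x"
proof -
  obtain c where c: "c \<in> M" "x \<in> cdom c" using f by (auto simp: smooth_at_def points_chart)
  obtain d where d: "d \<in> N" "f x \<in> cdom d" using f by (auto simp: smooth_at_def points_chart)
  have "smooth_near (\<lambda>a. h (cinv d (cmap d (f (cinv c a))))) (cmap c x)"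
    using smooth_near_compose[OF regular_atlas_fin[OF N]
        smooth_fun_atD[OF smooth_at_cmap[OF f d] c], of "\<lambda>a. h (cinv d a)"]
      smooth_fun_atD[OF h d] by (simp add: cinv_cmap[OF M c])
  moreover have "\<forall>\<^sub>F a in nhds (cmap c x). h (cinv d (cmap d (f (cinv c a)))) = h (f (cinv c a))"
    using smooth_at_eventually[OF f eventually_cdom[OF N d]]
    unfolding eventually_mnhds_chart[OF M c] by eventually_elim (simp add: cinv_cmap[OF N d(1)])
  ultimately have "smooth_near (\<lambda>a. h (f (cinv c a))) (cmap c x)"
    by (rule smooth_near_cong)
  then show ?thesis by (rule smooth_fun_atI[OF M c])
qed

lemma smooth_at_compose:
  assumes M: "regular_atlas M" and N: "regular_atlas N" and K: "regular_atlas K"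
    and f: "smooth_at M N f x" and g: "smooth_at N K g (f x)"
  shows "smooth_at M K (\<lambda>y. g (f y)) x"
  unfolding smooth_at_def
  using f g by (auto simp: smooth_at_def intro: filterlim_compose smooth_fun_at_compose[OF M N f])

lemma smooth_at_cong:
  assumes M: "regular_atlas M" and f: "smooth_at M N f x" "\<forall>\<^sub>F y in mnhds M x. f y = g y"
  shows "smooth_at M N g x"
proof -
  have eq: "f x = g x" using eventually_mnhds_self[OF M smooth_at_in(1)[OF f(1)] f(2)] .
  have "filterlim g (mnhds N (f x)) (mnhds M x)"
    using smooth_at_filterlim[OF f(1)] filterlim_cong[OF refl refl f(2)] by blast
  moreover have "smooth_fun_at M (\<lambda>y. cmap d (g y)) x" if "d \<in> N" "f x \<in> cdom d" for d
    by (rule smooth_fun_at_cong[OF M smooth_at_cmap[OF f(1) that]])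
      (rule eventually_mono[OF f(2)], simp)
  ultimately show ?thesis
    using f(1) by (simp add: smooth_at_def eq)
qed

lemma smooth_near_cmap_cinv:
  assumes "regular_atlas M" "c \<in> M" "x \<in> cdom c"
  shows "smooth_near (\<lambda>a. cmap c (cinv c a)) (cmap c x)"
  using smooth_near_transition[of M c c x] assms by blast

lemma smooth_fun_at_cmap:
  "regular_atlas M \<Longrightarrow> c \<in> M \<Longrightarrow> x \<in> cdom c \<Longrightarrow> smooth_fun_at M (cmap c) x"
  by (rule smooth_fun_atI[OF _ _ _ smooth_near_cmap_cinv])

lemma smooth_at_ident: "regular_atlas M \<Longrightarrow> x \<in> points M \<Longrightarrow> smooth_at M M (\<lambda>y. y) x"
  by (auto simp: smooth_at_def filterlim_ident smooth_fun_at_cmap)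

lemma smooth_fun_at_const: "x \<in> points M \<Longrightarrow> smooth_fun_at M (\<lambda>_. v) x"
  by (simp add: smooth_fun_at_def smooth_near_const)

lemma smooth_at_const:
  assumes "regular_atlas N" "x \<in> points M" "y \<in> points N"
  shows "smooth_at M N (\<lambda>_. y) x"
proof -
  have "filterlim (\<lambda>_. y) (mnhds N y) (mnhds M x)"
    unfolding filterlim_iff
  proof (intro allI impI)
    fix P assume "eventually P (mnhds N y)"
    from eventually_mnhds_self[OF assms(1,3) this] show "\<forall>\<^sub>F x in mnhds M x. P y" by simp
  qed
  with assms show ?thesis
    by (auto simp: smooth_at_def smooth_fun_at_const)
qed

text \<open>Bridge from the chartwise \<open>smooth_map\<close> to germs. The way back is
  \<open>smooth_mapI\<close>, which is used to certify local sections.\<close>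

lemma smooth_map_smooth_at:
  assumes M: "regular_atlas M" and N: "regular_atlas N" and f: "smooth_map M N f" and x: "x \<in> points M"
  shows "smooth_at M N f x"
proof -
  obtain c where c: "c \<in> M" "x \<in> cdom c" using x by (rule pointsE)
  have "f ` points M \<subseteq> points N" using f by (simp add: smooth_map_def)
  with x have "f x \<in> points N" by blast
  then obtain d where d: "d \<in> N" "f x \<in> cdom d" by (rule pointsE)
  let ?S = "cmap c ` (cdom c \<inter> f -` cdom d)"
  have S: "open ?S" "smooth_on ?S (\<lambda>a. cmap d (f (cinv c a)))" "cmap c x \<in> ?S"
    using f c d by (simp_all add: smooth_map_def comp_def)
  show ?thesis
  proof (rule smooth_atI[where f = f, OF M N c d])
    show "\<forall>\<^sub>F a in nhds (cmap c x). f (cinv c a) \<in> cdom d"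
      by (rule eventually_mono[OF eventually_nhds_in_open[OF S(1,3)]])
        (auto simp: cinv_cmap[OF M c(1)])
    show "smooth_near (\<lambda>a. cmap d (f (cinv c a))) (cmap c x)"
      using S by (intro smooth_nearI)
  qed
qed

text \<open>Turns a condition that persists near each point into openness in a chart, the form
  demanded by \<open>smooth_map\<close> and \<open>smooth_atlas\<close>.\<close>

lemma open_chart_imageI:
  assumes M: "regular_atlas M" and c: "c \<in> M"
    and ev: "\<And>x. x \<in> cdom c \<inter> U \<Longrightarrow> \<forall>\<^sub>F y in mnhds M x. y \<in> U"
  shows "open (cmap c ` (cdom c \<inter> U))"
proof (subst open_subopen, rule ballI)
  fix a assume "a \<in> cmap c ` (cdom c \<inter> U)"
  then obtain x where x: "x \<in> cdom c" "x \<in> U" "a = cmap c x" by blast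
  have "\<forall>\<^sub>F b in nhds a. cinv c b \<in> U"
    using ev[of x] x unfolding eventually_mnhds_chart[OF M c x(1)] by blast
  moreover have "\<forall>\<^sub>F b in nhds a. b \<in> cimg c"
    using eventually_cimg[OF M c x(1)] x(3) by simp
  ultimately have "\<forall>\<^sub>F b in nhds a. b \<in> cmap c ` (cdom c \<inter> U)"
  proof eventually_elim
    case (elim b)
    with cinv_in[of b c] cmap_cinv[of b c] show ?case
      by (intro image_eqI[of _ _ "cinv c b"]) auto
  qed
  then show "\<exists>T. open T \<and> a \<in> T \<and> T \<subseteq> cmap c ` (cdom c \<inter> U)"
    unfolding eventually_nhds by blast
qed

lemma smooth_mapI:
  assumes M: "regular_atlas M" and N: "regular_atlas N" and f: "\<And>x. x \<in> points M \<Longrightarrow> smooth_at M N f x"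
  shows "smooth_map M N f"
  unfolding smooth_map_def
proof (intro conjI ballI)
  show "f ` points M \<subseteq> points N" using smooth_at_in(2)[OF f] by blast
  fix c d assume c: "c \<in> M" and d: "d \<in> N"
  show "open (cmap c ` (cdom c \<inter> f -` cdom d))"
  proof (rule open_chart_imageI[OF M c])
    fix x assume x: "x \<in> cdom c \<inter> f -` cdom d"
    then show "\<forall>\<^sub>F y in mnhds M x. y \<in> f -` cdom d"
      using smooth_at_eventually[OF f[OF chart_in_points[OF c]] eventually_cdom[OF N d]] by simp
  qed
  show "smooth_on (cmap c ` (cdom c \<inter> f -` cdom d)) (cmap d \<circ> f \<circ> cinv c)"
  proof (rule smooth_on_if_smooth_near)
    fix a assume "a \<in> cmap c ` (cdom c \<inter> f -` cdom d)"
    then obtain x where x: "x \<in> cdom c" "f x \<in> cdom d" "a = cmap c x" by blast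
    show "smooth_near (cmap d \<circ> f \<circ> cinv c) a"
      using smooth_fun_atD[OF smooth_at_cmap[OF f[OF chart_in_points[OF c x(1)]] d x(2)] c x(1)]
      by (simp add: x(3) comp_def)
  qed
qed

section \<open>Open submanifolds\<close>

lemma points_open_submanifold: "points (open_submanifold M U) = points M \<inter> U"
  by (auto simp: points_def open_submanifold_def)

text \<open>Openness of U is asked only at points of M. The intended case is the preimage of an open
  set under \<pi>: since \<pi> is a total function, that preimage may contain elements outside
  \<open>points P\<close>, and then \<open>atlas_open\<close> would fail.\<close>

lemma regular_open_submanifold:
  assumes M: "regular_atlas M" and U: "\<forall>x\<in>points M \<inter> U. \<forall>\<^sub>F y in mnhds M x. y \<in> U"
  shows "regular_atlas (open_submanifold M U)"
proof -
  have op: "open (cmap c ` (cdom c \<inter> U \<inter> (cdom d \<inter> U)))" if "c \<in> M" "d \<in> M" for c d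
  proof -
    have "open (cmap c ` (cdom c \<inter> (cdom d \<inter> U)))"
      using that U by (intro open_chart_imageI[OF M]) (auto intro!: eventually_conj
          eventually_cdom[OF M] simp: chart_in_points)
    then show ?thesis by (simp add: Int_ac)
  qed
  have sm: "smooth_on (cmap c ` (cdom c \<inter> U \<inter> (cdom d \<inter> U)))
      (cmap d \<circ> inv_into (cdom c \<inter> U) (cmap c))" if cd: "c \<in> M" "d \<in> M" for c d
  proof (rule smooth_on_cong[OF smooth_on_subset _ ])
    show "smooth_on (cmap c ` (cdom c \<inter> cdom d)) (cmap d \<circ> cinv c)"
      using M cd by (auto simp: regular_atlas_def smooth_atlas_def)
    show "(cmap d \<circ> cinv c) a = (cmap d \<circ> inv_into (cdom c \<inter> U) (cmap c)) a"
      if "a \<in> cmap c ` (cdom c \<inter> U \<inter> (cdom d \<inter> U))" for a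
    proof -
      have "inj_on (cmap c) (cdom c \<inter> U)"
        using M cd(1) by (auto simp: regular_atlas_def smooth_atlas_def intro: inj_on_subset)
      then show ?thesis using that by (auto simp: inv_into_f_f cinv_cmap[OF M cd(1)])
    qed
  qed (use op[OF cd] in auto)
  have "inj_on (cmap c) (cdom c \<inter> U)" if "c \<in> M" for c
    using M that by (auto simp: regular_atlas_def smooth_atlas_def intro: inj_on_subset)
  with op sm M show ?thesis
    unfolding regular_atlas_def smooth_atlas_def open_submanifold_def by fastforce
qed

lemma smooth_at_open_submanifold:
  assumes M: "regular_atlas M" and U: "\<forall>x\<in>points M \<inter> U. \<forall>\<^sub>F y in mnhds M x. y \<in> U"
    and x: "x \<in> points M" "x \<in> U"
  shows "smooth_at (open_submanifold M U) M (\<lambda>y. y) x" "smooth_at M (open_submanifold M U) (\<lambda>y. y) x"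
proof -
  obtain c where c: "c \<in> M" "x \<in> cdom c" using x by (auto simp: points_chart)
  \<comment> \<open>Restricting a chart leaves its coordinate map unchanged, so the inclusion is the
    identity in coordinates.\<close>
  define c' where "c' = Chart (cdom c \<inter> U) (cmap c)"
  have c': "c' \<in> open_submanifold M U" "x \<in> cdom c'"
    using c x by (auto simp: open_submanifold_def c'_def)
  note R = regular_open_submanifold[OF M U]
  have sel: "cmap c' = cmap c" "cdom c' = cdom c \<inter> U" by (simp_all add: c'_def)
  have ev': "\<forall>\<^sub>F a in nhds (cmap c x). cinv c' a \<in> cdom c" 
    using eventually_cimg[OF R c'] unfolding sel(1)
    by (rule eventually_mono) (use cinv_in[of _ c'] in \<open>auto simp: sel\<close>)
  have ev: "\<forall>\<^sub>F a in nhds (cmap c x). cinv c a \<in> cdom c'"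
    using eventually_conj[OF eventually_cdom[OF M c] bspec[OF U, of x]] x
    by (simp add: eventually_mnhds_chart[OF M c] sel)
  show "smooth_at (open_submanifold M U) M (\<lambda>y. y) x"
    by (rule smooth_atI[where f = "\<lambda>y. y", OF R M c' c]) (use ev' smooth_near_cmap_cinv[OF R c'] in \<open>auto simp: sel(1)\<close>)
  show "smooth_at M (open_submanifold M U) (\<lambda>y. y) x"
    by (rule smooth_atI[where f = "\<lambda>y. y", OF M R c c']) (use ev smooth_near_cmap_cinv[OF M c] in \<open>auto simp: sel(1)\<close>)
qed

lemma eventually_atlas_open:
  "regular_atlas M \<Longrightarrow> atlas_open M U \<Longrightarrow> \<forall>x\<in>points M \<inter> U. \<forall>\<^sub>F y in mnhds M x. y \<in> U"
  by (blast intro: eventually_mnhds_open)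

lemma smooth_map_open_submanifold_smooth_at:
  assumes M: "regular_atlas M" and N: "regular_atlas N" and U: "\<forall>x\<in>points M \<inter> U. \<forall>\<^sub>F y in mnhds M x. y \<in> U"
    and f: "smooth_map (open_submanifold M U) N f" and x: "x \<in> points M" "x \<in> U"
  shows "smooth_at M N f x"
proof -
  note R = regular_open_submanifold[OF M U]
  have "smooth_at (open_submanifold M U) N f x"
    by (rule smooth_map_smooth_at[OF R N f]) (use x in \<open>auto simp: points_open_submanifold\<close>)
  then show ?thesis
    using smooth_at_compose[OF M R N smooth_at_open_submanifold(2)[OF M U x]] by blast
qed

lemma smooth_fun_at_add:
  "smooth_fun_at M h x \<Longrightarrow> smooth_fun_at M k x \<Longrightarrow> smooth_fun_at M (\<lambda>y. h y + k y) x"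
  by (simp add: smooth_fun_at_def smooth_near_add)

lemma smooth_fun_at_bounded_linear:
  "bounded_linear L \<Longrightarrow> smooth_fun_at M h x \<Longrightarrow> smooth_fun_at M (\<lambda>y. L (h y)) x"
  by (auto simp: smooth_fun_at_def intro: smooth_near_bounded_linear)

lemma smooth_fun_at_Pair:
  "smooth_fun_at M h x \<Longrightarrow> smooth_fun_at M k x \<Longrightarrow> smooth_fun_at M (\<lambda>y. (h y, k y)) x"
  by (simp add: smooth_fun_at_def smooth_near_Pair)

lemma smooth_fun_at_germ:
  fixes h :: "'a \<Rightarrow> 'v::real_inner"
  assumes M: "regular_atlas M" and fin: "fin_dim TYPE('v)"
    and h: "smooth_fun_at M h x" and g: "smooth_near g (h x)"
  shows "smooth_fun_at M (\<lambda>y. g (h y)) x"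
proof -
  obtain c where c: "c \<in> M" "x \<in> cdom c" using h(1) by (auto simp: smooth_fun_at_def points_chart)
  show ?thesis
    using smooth_near_compose[OF fin smooth_fun_atD[OF h c], of g] g
    by (intro smooth_fun_atI[OF M c]) (simp add: cinv_cmap[OF M c])
qed

section \<open>Product manifolds\<close>

definition prod_chart :: "('a, 'e) chart \<Rightarrow> ('b, 'f) chart \<Rightarrow> ('a \<times> 'b, 'e \<times> 'f) chart" where
  "prod_chart c d = Chart (cdom c \<times> cdom d) (map_prod (cmap c) (cmap d))"

lemma prod_chart_simps [simp]:
  "cdom (prod_chart c d) = cdom c \<times> cdom d" "cmap (prod_chart c d) = map_prod (cmap c) (cmap d)"
  by (simp_all add: prod_chart_def)

lemma cimg_prod_chart: "cimg (prod_chart c d) = cimg c \<times> cimg d"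
  by (simp add: map_prod_surj_on)

lemma prod_manifold_charts: "M \<times>\<^sub>M N = {prod_chart c d | c d. c \<in> M \<and> d \<in> N}"
  by (simp add: prod_manifold_def prod_chart_def)

lemma prod_chart_in: "c \<in> M \<Longrightarrow> d \<in> N \<Longrightarrow> prod_chart c d \<in> M \<times>\<^sub>M N"
  by (auto simp: prod_manifold_charts)

lemma points_prod: "points (M \<times>\<^sub>M N) = points M \<times> points N"
  by (force simp: points_def prod_manifold_charts)

lemma cinv_prod_chart:
  assumes M: "regular_atlas M" "c \<in> M" and N: "regular_atlas N" "d \<in> N"
    and a: "a \<in> cimg c" "b \<in> cimg d"
  shows "cinv (prod_chart c d) (a, b) = (cinv c a, cinv d b)"
proof (rule inv_into_f_eq)
  have "inj_on (cmap c) (cdom c)" "inj_on (cmap d) (cdom d)"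
    using M N by (auto simp: regular_atlas_def smooth_atlas_def)
  then show "inj_on (cmap (prod_chart c d)) (cdom (prod_chart c d))"
    by (simp add: map_prod_inj_on)
qed (use a in \<open>auto simp: cinv_in cmap_cinv\<close>)

text \<open>\<open>inv_into\<close> of a product map splits into the two inverses only on the image
  of the chart, hence the formulation on a neighbourhood.\<close>

lemma eventually_cinv_prod_chart:
  assumes M: "regular_atlas M" "c \<in> M" and N: "regular_atlas N" "d \<in> N"
    and x: "x \<in> cdom c" "y \<in> cdom d"
  shows "\<forall>\<^sub>F z in nhds (cmap c x, cmap d y).
    cinv (prod_chart c d) z = (cinv c (fst z), cinv d (snd z)) \<and> z \<in> cimg c \<times> cimg d"
proof -
  have "\<forall>\<^sub>F z in nhds (cmap c x, cmap d y). z \<in> cimg c \<times> cimg d"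
    by (rule eventually_nhds_in_open[OF open_Times[OF open_cimg[OF M] open_cimg[OF N]]])
      (use x in auto)
  then show ?thesis
    by eventually_elim (use cinv_prod_chart[OF M N] in auto)
qed

lemma regular_prod:
  assumes M: "regular_atlas (M :: ('a, 'e::real_inner) atlas)"
    and N: "regular_atlas (N :: ('b, 'f::real_inner) atlas)"
  shows "regular_atlas (M \<times>\<^sub>M N)"
  unfolding regular_atlas_def
proof
  show "fin_dim TYPE('e \<times> 'f)"
    using M N by (intro fin_dim_prod regular_atlas_fin)
  have fin: "fin_dim TYPE('e)" "fin_dim TYPE('f)"
    using M N by (simp_all add: regular_atlas_fin)
  show "smooth_atlas (M \<times>\<^sub>M N)"
    unfolding smooth_atlas_def
  proof (intro conjI ballI)
    fix C assume "C \<in> M \<times>\<^sub>M N"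
    then obtain c d where C: "C = prod_chart c d" and cd: "c \<in> M" "d \<in> N"
      by (auto simp: prod_manifold_charts)
    have "inj_on (cmap c) (cdom c)" "inj_on (cmap d) (cdom d)"
      using M N cd by (auto simp: regular_atlas_def smooth_atlas_def)
    then show "inj_on (cmap C) (cdom C)"
      by (simp add: C map_prod_inj_on)
    fix C' assume "C' \<in> M \<times>\<^sub>M N"
    then obtain c' d' where C': "C' = prod_chart c' d'" and cd': "c' \<in> M" "d' \<in> N"
      by (auto simp: prod_manifold_charts)
    have dom: "cmap C ` (cdom C \<inter> cdom C') =
        (cmap c ` (cdom c \<inter> cdom c')) \<times> (cmap d ` (cdom d \<inter> cdom d'))"
      by (force simp: C C')
    show "open (cmap C ` (cdom C \<inter> cdom C'))"
      unfolding dom using M N cd cd' by (intro open_Times open_overlap)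
    show "smooth_on (cmap C ` (cdom C \<inter> cdom C')) (cmap C' \<circ> cinv C)"
      unfolding dom
    proof (rule smooth_on_if_smooth_near, clarify)
      fix x y assume x: "x \<in> cdom c" "x \<in> cdom c'" and y: "y \<in> cdom d" "y \<in> cdom d'"
      have "smooth_near (\<lambda>z. (cmap c' (cinv c (fst z)), cmap d' (cinv d (snd z)))) (cmap c x, cmap d y)"
        using smooth_near_compose[OF fin(2) smooth_near_snd[OF smooth_near_ident],
            of "\<lambda>a. cmap d' (cinv d a)" "(cmap c x, cmap d y)"]
        smooth_near_compose[OF fin(1) smooth_near_fst[OF smooth_near_ident],
            of "\<lambda>a. cmap c' (cinv c a)" "(cmap c x, cmap d y)"]
        smooth_near_transition[OF M cd(1) cd'(1) x] smooth_near_transition[OF N cd(2) cd'(2) y]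
        by (intro smooth_near_Pair) auto
      then show "smooth_near (cmap C' \<circ> cinv C) (cmap c x, cmap d y)"
        by (rule smooth_near_cong)
          (use eventually_cinv_prod_chart[OF M cd(1) N cd(2) x(1) y(1)] in
            \<open>auto elim!: eventually_mono simp: C C'\<close>)
    qed
  qed
qed

lemma smooth_at_fst:
  assumes M: "regular_atlas M" and N: "regular_atlas N" and z: "z \<in> points (M \<times>\<^sub>M N)"
  shows "smooth_at (M \<times>\<^sub>M N) M fst z"
proof -
  obtain x y where xy: "z = (x, y)" by (cases z)
  obtain c d where c: "c \<in> M" "x \<in> cdom c" and d: "d \<in> N" "y \<in> cdom d"
    using z xy by (auto simp: points_prod points_chart)
  note ev = eventually_cinv_prod_chart[OF M c(1) N d(1) c(2) d(2)]
  show ?thesis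
    unfolding xy
  proof (rule smooth_atI[where f = fst, OF regular_prod[OF M N] M prod_chart_in[OF c(1) d(1)] _ c(1)])
    show "\<forall>\<^sub>F a in nhds (cmap (prod_chart c d) (x, y)). fst (cinv (prod_chart c d) a) \<in> cdom c"
      using ev by simp (auto elim!: eventually_mono simp: cinv_in)
    show "smooth_near (\<lambda>a. cmap c (fst (cinv (prod_chart c d) a))) (cmap (prod_chart c d) (x, y))"
      by (rule smooth_near_cong[OF smooth_near_fst[OF smooth_near_ident]])
        (use ev in \<open>auto elim!: eventually_mono simp: cmap_cinv\<close>)
  qed (use c d in auto)
qed

lemma smooth_at_snd:
  assumes M: "regular_atlas M" and N: "regular_atlas N" and z: "z \<in> points (M \<times>\<^sub>M N)"
  shows "smooth_at (M \<times>\<^sub>M N) N snd z"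
proof -
  obtain x y where xy: "z = (x, y)" by (cases z)
  obtain c d where c: "c \<in> M" "x \<in> cdom c" and d: "d \<in> N" "y \<in> cdom d"
    using z xy by (auto simp: points_prod points_chart)
  note ev = eventually_cinv_prod_chart[OF M c(1) N d(1) c(2) d(2)]
  show ?thesis
    unfolding xy
  proof (rule smooth_atI[where f = snd, OF regular_prod[OF M N] N prod_chart_in[OF c(1) d(1)] _ d(1)])
    show "\<forall>\<^sub>F a in nhds (cmap (prod_chart c d) (x, y)). snd (cinv (prod_chart c d) a) \<in> cdom d"
      using ev by simp (auto elim!: eventually_mono simp: cinv_in)
    show "smooth_near (\<lambda>a. cmap d (snd (cinv (prod_chart c d) a))) (cmap (prod_chart c d) (x, y))"
      by (rule smooth_near_cong[OF smooth_near_snd[OF smooth_near_ident]])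
        (use ev in \<open>auto elim!: eventually_mono simp: cmap_cinv\<close>)
  qed (use c d in auto)
qed

lemma smooth_at_Pair:
  assumes L: "regular_atlas L" and M: "regular_atlas M" and N: "regular_atlas N"
    and f: "smooth_at L M f x" and g: "smooth_at L N g x"
  shows "smooth_at L (M \<times>\<^sub>M N) (\<lambda>y. (f y, g y)) x"
proof -
  obtain b where b: "b \<in> L" "x \<in> cdom b" using f by (auto simp: smooth_at_def points_chart)
  obtain c where c: "c \<in> M" "f x \<in> cdom c" using f by (auto simp: smooth_at_def points_chart)
  obtain d where d: "d \<in> N" "g x \<in> cdom d" using g by (auto simp: smooth_at_def points_chart)
  show ?thesis
  proof (rule smooth_atI[where f = "\<lambda>y. (f y, g y)", OF L regular_prod[OF M N] b prod_chart_in[OF c(1) d(1)]])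
    show "\<forall>\<^sub>F a in nhds (cmap b x). (f (cinv b a), g (cinv b a)) \<in> cdom (prod_chart c d)"
      using eventually_conj[OF smooth_at_eventually[OF f eventually_cdom[OF M c]]
          smooth_at_eventually[OF g eventually_cdom[OF N d]]]
      by (simp add: eventually_mnhds_chart[OF L b])
    show "smooth_near (\<lambda>a. cmap (prod_chart c d) (f (cinv b a), g (cinv b a))) (cmap b x)"
      using smooth_fun_atD[OF smooth_at_cmap[OF f c] b]
        smooth_fun_atD[OF smooth_at_cmap[OF g d] b] by (simp add: smooth_near_Pair)
  qed (use c d in auto)
qed

section \<open>Tangent vectors and tangent maps\<close>

lemma tzero_apply [simp]: "tzero c = 0"
  by (simp add: tzero_def)

lemma tadd_apply [simp]: "tadd u v c = u c + v c"
  by (simp add: tadd_def)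

lemma tscale_apply [simp]: "tscale r v c = r *\<^sub>R v c"
  by (simp add: tscale_def)

definition tsub :: "('a, 'e::real_vector) tvec \<Rightarrow> ('a, 'e) tvec \<Rightarrow> ('a, 'e) tvec" where
  "tsub u v = tadd u (tscale (-1) v)"

lemma tsub_apply [simp]: "tsub u v c = u c - v c"
  by (simp add: tsub_def)

lemma tvec_algebra:
  "tadd (tsub u v) v = u" "tsub (tadd u v) v = u" "tsub (tadd u v) u = v" "tsub u tzero = u"
  "tsub u u = tzero" "tadd u tzero = u" "tadd tzero u = u" "tscale 0 u = tzero"
  "tadd u (tsub v u) = v"
  by (simp_all add: fun_eq_iff)

lemma tspace_coord_change:
  "v \<in> tspace M x \<Longrightarrow> c \<in> M \<Longrightarrow> d \<in> M \<Longrightarrow> x \<in> cdom c \<Longrightarrow> x \<in> cdom d \<Longrightarrow>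
    v d = frechet_derivative (\<lambda>a. cmap d (cinv c a)) (at (cmap c x)) (v c)"
  unfolding tspace_def comp_def by blast

lemma tspace_outside: "v \<in> tspace M x \<Longrightarrow> \<not> (c \<in> M \<and> x \<in> cdom c) \<Longrightarrow> v c = 0"
  unfolding tspace_def by blast

lemma tspaceI:
  assumes "\<And>c d. c \<in> M \<Longrightarrow> d \<in> M \<Longrightarrow> x \<in> cdom c \<Longrightarrow> x \<in> cdom d \<Longrightarrow>
      v d = frechet_derivative (\<lambda>a. cmap d (cinv c a)) (at (cmap c x)) (v c)"
    and "\<And>c. \<not> (c \<in> M \<and> x \<in> cdom c) \<Longrightarrow> v c = 0"
  shows "v \<in> tspace M x"
  unfolding tspace_def comp_def using assms by blast

text \<open>A tangent vector is a compatible family, so its value in one chart around x determines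
  those in all others, and at the remaining charts it is 0. Identities between tangent vectors are
  therefore checked in a single chart.\<close>

lemma tspace_eqI:
  assumes "u \<in> tspace M x" "v \<in> tspace M x" "c \<in> M" "x \<in> cdom c" "u c = v c"
  shows "u = v"
proof
  fix d show "u d = v d"
    using tspace_coord_change[OF assms(1,3), of d] tspace_coord_change[OF assms(2,3), of d]
      tspace_outside[OF assms(1), of d] tspace_outside[OF assms(2), of d] assms(4,5)
    by (cases "d \<in> M \<and> x \<in> cdom d") auto
qed

lemma tspace_tzero:
  assumes "regular_atlas M" shows "tzero \<in> tspace M x"
  by (rule tspaceI)
    (use smooth_near_linear[OF smooth_near_transition[OF assms]] linear_0 in force)+

lemma tspace_tadd:
  assumes M: "regular_atlas M" and uv: "u \<in> tspace M x" "v \<in> tspace M x"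
  shows "tadd u v \<in> tspace M x"
proof (rule tspaceI)
  fix c d assume cd: "c \<in> M" "d \<in> M" "x \<in> cdom c" "x \<in> cdom d"
  show "tadd u v d = frechet_derivative (\<lambda>a. cmap d (cinv c a)) (at (cmap c x)) (tadd u v c)"
    using linear_add[OF smooth_near_linear[OF smooth_near_transition[OF M cd]]]
    by (simp add: tspace_coord_change[OF uv(1) cd] tspace_coord_change[OF uv(2) cd])
qed (use uv in \<open>auto simp: tspace_outside\<close>)

lemma tspace_tscale:
  assumes M: "regular_atlas M" and v: "v \<in> tspace M x"
  shows "tscale r v \<in> tspace M x"
proof (rule tspaceI)
  fix c d assume cd: "c \<in> M" "d \<in> M" "x \<in> cdom c" "x \<in> cdom d"
  show "tscale r v d = frechet_derivative (\<lambda>a. cmap d (cinv c a)) (at (cmap c x)) (tscale r v c)"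
    using linear_cmul[OF smooth_near_linear[OF smooth_near_transition[OF M cd]]]
    by (simp add: tspace_coord_change[OF v cd])
qed (use v in \<open>auto simp: tspace_outside\<close>)

lemma tspace_tsub:
  "regular_atlas M \<Longrightarrow> u \<in> tspace M x \<Longrightarrow> v \<in> tspace M x \<Longrightarrow> tsub u v \<in> tspace M x"
  by (simp add: tsub_def tspace_tadd tspace_tscale)

lemma tlinear_in: "tlinear V W f \<Longrightarrow> v \<in> V \<Longrightarrow> f v \<in> W"
  by (auto simp: tlinear_def)

lemma tlinear_tadd: "tlinear V W f \<Longrightarrow> u \<in> V \<Longrightarrow> v \<in> V \<Longrightarrow> f (tadd u v) = tadd (f u) (f v)"
  by (simp add: tlinear_def)

lemma tlinear_tscale: "tlinear V W f \<Longrightarrow> v \<in> V \<Longrightarrow> f (tscale r v) = tscale r (f v)"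
  by (simp add: tlinear_def)

lemma tlinear_tsub:
  assumes "regular_atlas M" "tlinear (tspace M x) W f" "u \<in> tspace M x" "v \<in> tspace M x"
  shows "f (tsub u v) = tsub (f u) (f v)"
  using assms by (simp add: tsub_def tlinear_tadd[OF assms(2)] tlinear_tscale[OF assms(2)] tspace_tscale)

lemma tlinear_tzero:
  assumes "regular_atlas M" "tlinear (tspace M x) W f"
  shows "f tzero = tzero"
  using tlinear_tscale[OF assms(2) tspace_tzero[OF assms(1)], of 0] by (simp add: tvec_algebra)

lemma tlinear_compose:
  "tlinear U V f \<Longrightarrow> tlinear V W g \<Longrightarrow> tlinear U W (\<lambda>u. g (f u))"
  by (auto simp: tlinear_def image_subset_iff)

lemma tlinear_cong:
  assumes M: "regular_atlas M" and eq: "\<And>v. v \<in> tspace M x \<Longrightarrow> f v = g v" and f: "tlinear (tspace M x) W f"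
  shows "tlinear (tspace M x) W g"
  using f eq by (auto simp: tlinear_def image_subset_iff tspace_tadd[OF M] tspace_tscale[OF M])

lemma tlinear_ident: "tlinear V V (\<lambda>v. v)"
  by (simp add: tlinear_def)

lemma tlinear_diff:
  assumes M: "regular_atlas M" and f: "tlinear V (tspace M x) f" and g: "tlinear V (tspace M x) g"
  shows "tlinear V (tspace M x) (\<lambda>v. tsub (f v) (g v))"
  using tlinear_in[OF f] tlinear_in[OF g]
  by (auto simp: tlinear_def tlinear_tadd[OF f] tlinear_tadd[OF g] tlinear_tscale[OF f] tlinear_tscale[OF g]
      fun_eq_iff scaleR_diff_right intro: tspace_tsub[OF M])

section \<open>Tangent vectors with prescribed coordinates\<close>

lemma tcoord_apply:
  "d \<in> M \<Longrightarrow> x \<in> cdom d \<Longrightarrow>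
    tcoord M c x e d = frechet_derivative (\<lambda>a. cmap d (cinv c a)) (at (cmap c x)) e"
  by (simp add: tcoord_def comp_def)

lemma tcoord_self:
  assumes M: "regular_atlas M" and c: "c \<in> M" "x \<in> cdom c"
  shows "tcoord M c x e c = e"
proof -
  have "\<forall>\<^sub>F a in nhds (cmap c x). a = cmap c (cinv c a)"
    by (rule eventually_mono[OF eventually_cimg[OF M c]]) (simp add: cmap_cinv)
  from frechet_derivative_cong[OF smooth_near_ident this] show ?thesis
    by (simp add: tcoord_apply[OF c])
qed

text \<open>Compatibility between two further charts d and d' is the chain rule for passing from c
  through d to d'.\<close>

lemma tcoord_in_tspace:
  assumes M: "regular_atlas M" and c: "c \<in> M" "x \<in> cdom c"
  shows "tcoord M c x e \<in> tspace M x"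
proof (rule tspaceI)
  fix d d' assume d: "d \<in> M" "d' \<in> M" "x \<in> cdom d" "x \<in> cdom d'"
  have *: "\<forall>\<^sub>F a in nhds (cmap c x). cmap d' (cinv c a) = cmap d' (cinv d (cmap d (cinv c a)))"
    using eventually_cdom[OF M d(1,3)] unfolding eventually_mnhds_chart[OF M c]
    by eventually_elim (simp add: cinv_cmap[OF M d(1)])
  have x: "cinv c (cmap c x) = x" using cinv_cmap[OF M c] .
  note t1 = smooth_near_transition[OF M c(1) d(1) c(2) d(3)]
  have t2: "smooth_near (\<lambda>a. cmap d' (cinv d a)) (cmap d (cinv c (cmap c x)))"
    using smooth_near_transition[OF M d(1,2,3,4)] by (simp add: x)
  have "frechet_derivative (\<lambda>a. cmap d' (cinv d (cmap d (cinv c a)))) (at (cmap c x)) =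
      frechet_derivative (\<lambda>a. cmap d' (cinv c a)) (at (cmap c x))"
    by (rule frechet_derivative_cong[OF smooth_near_transition[OF M c(1) d(2) c(2) d(4)] *])
  then show "tcoord M c x e d' =
      frechet_derivative (\<lambda>a. cmap d' (cinv d a)) (at (cmap d x)) (tcoord M c x e d)"
    using frechet_derivative_chain[OF t1 t2, of e]
    by (simp add: tcoord_apply d x)
qed (auto simp: tcoord_def)

lemma tcoord_of_coord:
  assumes M: "regular_atlas M" and c: "c \<in> M" "x \<in> cdom c" and v: "v \<in> tspace M x"
  shows "tcoord M c x (v c) = v"
  by (rule tspace_eqI[OF tcoord_in_tspace[OF M c] v c]) (rule tcoord_self[OF M c])

text \<open>\<open>tmap\<close> is defined through a chosen chart; the choice is immaterial.\<close>

lemma smooth_fun_at_derivative_chart: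
  assumes M: "regular_atlas M" and h: "smooth_fun_at M h x" and v: "v \<in> tspace M x"
    and c: "c \<in> M" "x \<in> cdom c" and d: "d \<in> M" "x \<in> cdom d"
  shows "frechet_derivative (\<lambda>a. h (cinv d a)) (at (cmap d x)) (v d) =
    frechet_derivative (\<lambda>a. h (cinv c a)) (at (cmap c x)) (v c)"
proof -
  have x: "cinv c (cmap c x) = x" using cinv_cmap[OF M c] .
  have "\<forall>\<^sub>F a in nhds (cmap c x). h (cinv c a) = h (cinv d (cmap d (cinv c a)))"
    using eventually_cdom[OF M d] unfolding eventually_mnhds_chart[OF M c]
    by eventually_elim (simp add: cinv_cmap[OF M d(1)])
  from frechet_derivative_cong[OF smooth_fun_atD[OF h c] this]
  have "frechet_derivative (\<lambda>a. h (cinv c a)) (at (cmap c x)) (v c) =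
      frechet_derivative (\<lambda>a. h (cinv d (cmap d (cinv c a)))) (at (cmap c x)) (v c)"
    by simp
  also have "\<dots> = frechet_derivative (\<lambda>a. h (cinv d a)) (at (cmap d x))
      (frechet_derivative (\<lambda>a. cmap d (cinv c a)) (at (cmap c x)) (v c))"
    using frechet_derivative_chain[OF smooth_near_transition[OF M c(1) d(1) c(2) d(2)],
        of "\<lambda>a. h (cinv d a)" "v c"] smooth_fun_atD[OF h d] by (simp add: x)
  finally show ?thesis
    by (simp add: tspace_coord_change[OF v c(1) d(1) c(2) d(2)])
qed

section \<open>Tangent maps and their functoriality\<close>

lemma tmap_chart:
  assumes M: "regular_atlas M" and f: "smooth_at M N f x" and v: "v \<in> tspace M x"
    and c: "c \<in> M" "x \<in> cdom c" and d: "d \<in> N" "f x \<in> cdom d"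
  shows "tmap M N f x v d = frechet_derivative (\<lambda>a. cmap d (f (cinv c a))) (at (cmap c x)) (v c)"
proof -
  define c0 where "c0 = (SOME c. c \<in> M \<and> x \<in> cdom c)"
  have c0: "c0 \<in> M" "x \<in> cdom c0"
    using someI[of "\<lambda>c. c \<in> M \<and> x \<in> cdom c" c] c by (auto simp: c0_def)
  show ?thesis
    using smooth_fun_at_derivative_chart[OF M smooth_at_cmap[OF f d] v c c0] d
    by (simp add: tmap_def Let_def comp_def flip: c0_def)
qed

lemma tmap_outside: "\<not> (d \<in> N \<and> f x \<in> cdom d) \<Longrightarrow> tmap M N f x v d = 0"
  by (auto simp: tmap_def)

lemma tmap_in_tspace:
  assumes M: "regular_atlas M" and N: "regular_atlas N" and f: "smooth_at M N f x" and v: "v \<in> tspace M x"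
  shows "tmap M N f x v \<in> tspace N (f x)"
proof (rule tspaceI)
  fix d d' assume d: "d \<in> N" "d' \<in> N" "f x \<in> cdom d" "f x \<in> cdom d'"
  obtain c where c: "c \<in> M" "x \<in> cdom c" using smooth_at_in(1)[OF f] by (rule pointsE)
  have x: "cinv c (cmap c x) = x" using cinv_cmap[OF M c] .
  note fd = smooth_fun_atD[OF smooth_at_cmap[OF f d(1,3)] c]
  note fd' = smooth_fun_atD[OF smooth_at_cmap[OF f d(2,4)] c]
  have *: "\<forall>\<^sub>F a in nhds (cmap c x). cmap d' (f (cinv c a)) = cmap d' (cinv d (cmap d (f (cinv c a))))"
    using smooth_at_eventually[OF f eventually_cdom[OF N d(1,3)]]
    unfolding eventually_mnhds_chart[OF M c] by eventually_elim (simp add: cinv_cmap[OF N d(1)])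
  have "frechet_derivative (\<lambda>a. cmap d' (cinv d (cmap d (f (cinv c a))))) (at (cmap c x)) =
      frechet_derivative (\<lambda>a. cmap d' (f (cinv c a))) (at (cmap c x))"
    by (rule frechet_derivative_cong[OF fd' *])
  then show "tmap M N f x v d' =
      frechet_derivative (\<lambda>a. cmap d' (cinv d a)) (at (cmap d (f x))) (tmap M N f x v d)"
    using frechet_derivative_chain[OF fd, of "\<lambda>a. cmap d' (cinv d a)" "v c"]
      smooth_near_transition[OF N d]
    by (simp add: tmap_chart[OF M f v c] d x)
qed (auto simp: tmap_outside)

lemma tmap_eqI:
  assumes M: "regular_atlas M" and N: "regular_atlas N" and f: "smooth_at M N f x" and v: "v \<in> tspace M x"
    and c: "c \<in> M" "x \<in> cdom c" and d: "d \<in> N" "f x \<in> cdom d" and z: "z \<in> tspace N (f x)"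
    and eq: "frechet_derivative (\<lambda>a. cmap d (f (cinv c a))) (at (cmap c x)) (v c) = z d"
  shows "tmap M N f x v = z"
  by (rule tspace_eqI[OF tmap_in_tspace[OF M N f v] z d]) (simp add: tmap_chart[OF M f v c d] eq)

lemma tlinear_tmap:
  assumes M: "regular_atlas M" and N: "regular_atlas N" and f: "smooth_at M N f x"
  shows "tlinear (tspace M x) (tspace N (f x)) (tmap M N f x)"
proof -
  obtain c where c: "c \<in> M" "x \<in> cdom c" using smooth_at_in(1)[OF f] by (rule pointsE)
  obtain d where d: "d \<in> N" "f x \<in> cdom d" using smooth_at_in(2)[OF f] by (rule pointsE)
  note lin = smooth_near_linear[OF smooth_fun_atD[OF smooth_at_cmap[OF f d] c]]
  note T = tmap_in_tspace[OF M N f]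
  have "tmap M N f x (tadd u v) = tadd (tmap M N f x u) (tmap M N f x v)"
    if uv: "u \<in> tspace M x" "v \<in> tspace M x" for u v
    by (rule tmap_eqI[OF M N f tspace_tadd[OF M uv] c d tspace_tadd[OF N T[OF uv(1)] T[OF uv(2)]]])
      (simp add: linear_add[OF lin] tmap_chart[OF M f _ c d] uv)
  moreover have "tmap M N f x (tscale r v) = tscale r (tmap M N f x v)" if v: "v \<in> tspace M x" for r v
    by (rule tmap_eqI[OF M N f tspace_tscale[OF M v] c d tspace_tscale[OF N T[OF v]]])
      (simp add: linear_cmul[OF lin] tmap_chart[OF M f _ c d] v)
  ultimately show ?thesis
    using T by (auto simp: tlinear_def)
qed

lemma tmap_compose:
  assumes M: "regular_atlas M" and N: "regular_atlas N" and K: "regular_atlas K"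
    and f: "smooth_at M N f x" and g: "smooth_at N K g (f x)" and v: "v \<in> tspace M x"
  shows "tmap M K (\<lambda>y. g (f y)) x v = tmap N K g (f x) (tmap M N f x v)"
proof -
  obtain b where b: "b \<in> M" "x \<in> cdom b" using smooth_at_in(1)[OF f] by (rule pointsE)
  obtain c where c: "c \<in> N" "f x \<in> cdom c" using smooth_at_in(2)[OF f] by (rule pointsE)
  obtain d where d: "d \<in> K" "g (f x) \<in> cdom d" using smooth_at_in(2)[OF g] by (rule pointsE)
  have x: "cinv b (cmap b x) = x" using cinv_cmap[OF M b] .
  note gf = smooth_at_compose[OF M N K f g]
  note fc = smooth_fun_atD[OF smooth_at_cmap[OF f c] b]
  note Tf = tmap_in_tspace[OF M N f v]
  have "\<forall>\<^sub>F a in nhds (cmap b x).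
      cmap d (g (f (cinv b a))) = cmap d (g (cinv c (cmap c (f (cinv b a)))))"
    using smooth_at_eventually[OF f eventually_cdom[OF N c]]
    unfolding eventually_mnhds_chart[OF M b] by eventually_elim (simp add: cinv_cmap[OF N c(1)])
  from frechet_derivative_cong[OF smooth_fun_atD[OF smooth_at_cmap[OF gf d] b] this]
  have "frechet_derivative (\<lambda>a. cmap d (g (cinv c (cmap c (f (cinv b a)))))) (at (cmap b x)) =
      frechet_derivative (\<lambda>a. cmap d (g (f (cinv b a)))) (at (cmap b x))" .
  then show ?thesis
    using frechet_derivative_chain[OF fc, of "\<lambda>a. cmap d (g (cinv c a))" "v b"]
      smooth_fun_atD[OF smooth_at_cmap[OF g d] c]
    by (intro tmap_eqI[OF M K gf v b d tmap_in_tspace[OF N K g Tf]])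
      (simp add: tmap_chart[OF N g Tf c d] tmap_chart[OF M f v b c] x)
qed

text \<open>Many identities in a bundle hold only over an open set U or only on
  \<open>points\<close>. This lemma turns them into identities of tangent maps.\<close>

lemma tmap_cong:
  assumes M: "regular_atlas M" and N: "regular_atlas N" and f: "smooth_at M N f x"
    and ev: "\<forall>\<^sub>F y in mnhds M x. f y = g y" and v: "v \<in> tspace M x"
  shows "tmap M N g x v = tmap M N f x v"
proof -
  have eq: "f x = g x" using eventually_mnhds_self[OF M smooth_at_in(1)[OF f] ev] .
  note g = smooth_at_cong[OF M f ev]
  obtain c where c: "c \<in> M" "x \<in> cdom c" using smooth_at_in(1)[OF f] by (rule pointsE)
  obtain d where d: "d \<in> N" "f x \<in> cdom d" using smooth_at_in(2)[OF f] by (rule pointsE)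
  have "\<forall>\<^sub>F a in nhds (cmap c x). cmap d (f (cinv c a)) = cmap d (g (cinv c a))"
    using ev unfolding eventually_mnhds_chart[OF M c] by eventually_elim simp
  from frechet_derivative_cong[OF smooth_fun_atD[OF smooth_at_cmap[OF f d] c] this]
  show ?thesis
    by (intro tmap_eqI[OF M N g v c d(1)])
      (use d tmap_in_tspace[OF M N f v] in \<open>auto simp: eq tmap_chart[OF M f v c d]\<close>)
qed

lemma tmap_ident:
  assumes M: "regular_atlas M" and x: "x \<in> points M" and v: "v \<in> tspace M x"
  shows "tmap M M (\<lambda>y. y) x v = v"
proof -
  obtain c where c: "c \<in> M" "x \<in> cdom c" using x by (rule pointsE)
  show ?thesis
    by (rule tmap_eqI[OF M M smooth_at_ident[OF M x] v c c v])
      (use tcoord_self[OF M c] in \<open>simp add: tcoord_apply[OF c]\<close>)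
qed

lemma tmap_const:
  assumes M: "regular_atlas M" and N: "regular_atlas N" and x: "x \<in> points M" and y: "y \<in> points N"
    and v: "v \<in> tspace M x"
  shows "tmap M N (\<lambda>_. y) x v = tzero"
proof -
  obtain c where c: "c \<in> M" "x \<in> cdom c" using x by (rule pointsE)
  obtain d where d: "d \<in> N" "y \<in> cdom d" using y by (rule pointsE)
  show ?thesis
    by (rule tmap_eqI[OF M N smooth_at_const[OF N x y] v c d tspace_tzero[OF N]]) simp
qed

section \<open>Tangent vectors of products\<close>

lemma frechet_derivative_fst: "frechet_derivative fst (at a) = fst"
  by (rule frechet_derivative_at[symmetric]) (rule has_derivative_fst[OF has_derivative_ident])

lemma frechet_derivative_snd: "frechet_derivative snd (at a) = snd"
  by (rule frechet_derivative_at[symmetric]) (rule has_derivative_snd[OF has_derivative_ident])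

lemma tmap_fst_chart:
  assumes M: "regular_atlas M" and N: "regular_atlas N"
    and c: "c \<in> M" "x \<in> cdom c" and d: "d \<in> N" "y \<in> cdom d" and z: "z \<in> tspace (M \<times>\<^sub>M N) (x, y)"
  shows "tmap (M \<times>\<^sub>M N) M fst (x, y) z c = fst (z (prod_chart c d))"
proof -
  have pt: "(x, y) \<in> points (M \<times>\<^sub>M N)"
    using c d by (auto simp: points_prod points_chart)
  have "\<forall>\<^sub>F a in nhds (cmap c x, cmap d y). fst a = cmap c (fst (cinv (prod_chart c d) a))"
    using eventually_cinv_prod_chart[OF M c(1) N d(1) c(2) d(2)]
    by eventually_elim (auto simp: cmap_cinv)
  from frechet_derivative_cong[OF smooth_near_fst[OF smooth_near_ident] this]
  show ?thesis
    using c d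
    by (subst tmap_chart[OF regular_prod[OF M N] smooth_at_fst[OF M N pt] z
          prod_chart_in[OF c(1) d(1)]]) (auto simp: frechet_derivative_fst)
qed

lemma tmap_snd_chart:
  assumes M: "regular_atlas M" and N: "regular_atlas N"
    and c: "c \<in> M" "x \<in> cdom c" and d: "d \<in> N" "y \<in> cdom d" and z: "z \<in> tspace (M \<times>\<^sub>M N) (x, y)"
  shows "tmap (M \<times>\<^sub>M N) N snd (x, y) z d = snd (z (prod_chart c d))"
proof -
  have pt: "(x, y) \<in> points (M \<times>\<^sub>M N)"
    using c d by (auto simp: points_prod points_chart)
  have "\<forall>\<^sub>F a in nhds (cmap c x, cmap d y). snd a = cmap d (snd (cinv (prod_chart c d) a))"
    using eventually_cinv_prod_chart[OF M c(1) N d(1) c(2) d(2)]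
    by eventually_elim (auto simp: cmap_cinv)
  from frechet_derivative_cong[OF smooth_near_snd[OF smooth_near_ident] this]
  show ?thesis
    using c d
    by (subst tmap_chart[OF regular_prod[OF M N] smooth_at_snd[OF M N pt] z
          prod_chart_in[OF c(1) d(1)]]) (auto simp: frechet_derivative_snd)
qed

lemma tspace_prod_eqI:
  assumes M: "regular_atlas M" and N: "regular_atlas N" and x: "x \<in> points M" and y: "y \<in> points N"
    and z: "z \<in> tspace (M \<times>\<^sub>M N) (x, y)" and z': "z' \<in> tspace (M \<times>\<^sub>M N) (x, y)"
    and eq: "tmap (M \<times>\<^sub>M N) M fst (x, y) z = tmap (M \<times>\<^sub>M N) M fst (x, y) z'"
      "tmap (M \<times>\<^sub>M N) N snd (x, y) z = tmap (M \<times>\<^sub>M N) N snd (x, y) z'"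
  shows "z = z'"
proof -
  obtain c where c: "c \<in> M" "x \<in> cdom c" using x by (rule pointsE)
  obtain d where d: "d \<in> N" "y \<in> cdom d" using y by (rule pointsE)
  have "z (prod_chart c d) = z' (prod_chart c d)"
    using eq tmap_fst_chart[OF M N c d z] tmap_fst_chart[OF M N c d z']
      tmap_snd_chart[OF M N c d z] tmap_snd_chart[OF M N c d z'] by (simp add: prod_eq_iff)
  then show ?thesis
    using c d by (intro tspace_eqI[OF z z' prod_chart_in[OF c(1) d(1)]]) auto
qed

text \<open>The definite description is justified by a witness: the vector whose representation in a
  product chart is the pair of the representations of u and v. It is unique because the two
  projections determine both components there.\<close>

lemma tpair:
  assumes M: "regular_atlas M" and N: "regular_atlas N" and x: "x \<in> points M" and y: "y \<in> points N"
    and u: "u \<in> tspace M x" and v: "v \<in> tspace N y"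
  shows tpair_in_tspace: "tpair M N x y u v \<in> tspace (M \<times>\<^sub>M N) (x, y)"
    and tmap_fst_tpair: "tmap (M \<times>\<^sub>M N) M fst (x, y) (tpair M N x y u v) = u"
    and tmap_snd_tpair: "tmap (M \<times>\<^sub>M N) N snd (x, y) (tpair M N x y u v) = v"
proof -
  obtain c where c: "c \<in> M" "x \<in> cdom c" using x by (rule pointsE)
  obtain d where d: "d \<in> N" "y \<in> cdom d" using y by (rule pointsE)
  note MN = regular_prod[OF M N]
  have pt: "(x, y) \<in> points (M \<times>\<^sub>M N)"
    using x y by (simp add: points_prod)
  let ?C = "prod_chart c d"
  have C: "?C \<in> M \<times>\<^sub>M N" "(x, y) \<in> cdom ?C" using c d by (auto simp: prod_chart_in)
  define z where "z = tcoord (M \<times>\<^sub>M N) ?C (x, y) (u c, v d)"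
  have z: "z \<in> tspace (M \<times>\<^sub>M N) (x, y)" and zC: "z ?C = (u c, v d)"
    unfolding z_def by (rule tcoord_in_tspace[OF MN C], rule tcoord_self[OF MN C])
  have "tmap (M \<times>\<^sub>M N) M fst (x, y) z = u"
    by (rule tspace_eqI[OF _ u c])
      (use tmap_in_tspace[OF MN M smooth_at_fst[OF M N pt] z] in
        \<open>auto simp: tmap_fst_chart[OF M N c d z] zC\<close>)
  moreover have "tmap (M \<times>\<^sub>M N) N snd (x, y) z = v"
    by (rule tspace_eqI[OF _ v d])
      (use tmap_in_tspace[OF MN N smooth_at_snd[OF M N pt] z] in
        \<open>auto simp: tmap_snd_chart[OF M N c d z] zC\<close>)
  ultimately have *: "z \<in> tspace (M \<times>\<^sub>M N) (x, y) \<and> tmap (M \<times>\<^sub>M N) M fst (x, y) z = u \<and>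
      tmap (M \<times>\<^sub>M N) N snd (x, y) z = v"
    using z by blast
  have "tpair M N x y u v = z"
    unfolding tpair_def
    by (intro the_equality *) (use * tspace_prod_eqI[OF M N x y] in metis)
  with * show "tpair M N x y u v \<in> tspace (M \<times>\<^sub>M N) (x, y)"
    "tmap (M \<times>\<^sub>M N) M fst (x, y) (tpair M N x y u v) = u"
    "tmap (M \<times>\<^sub>M N) N snd (x, y) (tpair M N x y u v) = v"
    by simp_all
qed

lemma tpair_chart:
  assumes M: "regular_atlas M" and N: "regular_atlas N"
    and c: "c \<in> M" "x \<in> cdom c" and d: "d \<in> N" "y \<in> cdom d"
    and u: "u \<in> tspace M x" and v: "v \<in> tspace N y"
  shows "tpair M N x y u v (prod_chart c d) = (u c, v d)"
  using tpair[OF M N chart_in_points[OF c] chart_in_points[OF d] u v]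
  by (metis tmap_fst_chart[OF M N c d] tmap_snd_chart[OF M N c d] prod.collapse)

lemma tlinear_tpair:
  assumes M: "regular_atlas M" and N: "regular_atlas N" and x: "x \<in> points M" and y: "y \<in> points N"
    and K: "regular_atlas K" and f: "tlinear (tspace K k) (tspace M x) f" and g: "tlinear (tspace K k) (tspace N y) g"
  shows "tlinear (tspace K k) (tspace (M \<times>\<^sub>M N) (x, y)) (\<lambda>v. tpair M N x y (f v) (g v))"
proof -
  obtain c where c: "c \<in> M" "x \<in> cdom c" using x by (rule pointsE)
  obtain d where d: "d \<in> N" "y \<in> cdom d" using y by (rule pointsE)
  note MN = regular_prod[OF M N]
  note fg = tlinear_in[OF f] tlinear_in[OF g]
  let ?C = "prod_chart c d"
  have C: "?C \<in> M \<times>\<^sub>M N" "(x, y) \<in> cdom ?C" using c d by (auto simp: prod_chart_in)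
  have T: "tpair M N x y (f v) (g v) \<in> tspace (M \<times>\<^sub>M N) (x, y)" if "v \<in> tspace K k" for v
    using that by (intro tpair_in_tspace M N x y fg)
  show ?thesis
    unfolding tlinear_def
  proof (intro conjI ballI allI image_subsetI T)
    fix u v assume uv: "u \<in> tspace K k" "v \<in> tspace K k"
    show "tpair M N x y (f (tadd u v)) (g (tadd u v)) =
        tadd (tpair M N x y (f u) (g u)) (tpair M N x y (f v) (g v))"
      by (rule tspace_eqI[OF T[OF tspace_tadd[OF K uv]] tspace_tadd[OF MN T[OF uv(1)] T[OF uv(2)]] C])
        (simp add: tpair_chart[OF M N c d] fg uv tspace_tadd[OF K] tlinear_tadd[OF f] tlinear_tadd[OF g]
          tspace_tadd[OF M] tspace_tadd[OF N])
  next
    fix r v assume v: "v \<in> tspace K k"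
    show "tpair M N x y (f (tscale r v)) (g (tscale r v)) = tscale r (tpair M N x y (f v) (g v))"
      by (rule tspace_eqI[OF T[OF tspace_tscale[OF K v]] tspace_tscale[OF MN T[OF v]] C])
        (simp add: tpair_chart[OF M N c d] fg v tspace_tscale[OF K] tlinear_tscale[OF f] tlinear_tscale[OF g]
          tspace_tscale[OF M] tspace_tscale[OF N])
  qed
qed

lemma smooth_at_slice_right:
  assumes M: "regular_atlas M" and N: "regular_atlas N" and K: "regular_atlas K"
    and F: "smooth_at (M \<times>\<^sub>M N) K F (x, y)"
  shows "smooth_at N K (\<lambda>n. F (x, n)) y"
proof -
  have xy: "x \<in> points M" "y \<in> points N"
    using smooth_at_in(1)[OF F] by (auto simp: points_prod)
  show ?thesis
    by (rule smooth_at_compose[OF N regular_prod[OF M N] K smooth_at_Pair[OF N M N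
            smooth_at_const[OF M xy(2,1)] smooth_at_ident[OF N xy(2)]] F])
qed

lemma tmap_Pair:
  assumes L: "regular_atlas L" and M: "regular_atlas M" and N: "regular_atlas N"
    and f: "smooth_at L M f l" and g: "smooth_at L N g l" and v: "v \<in> tspace L l"
  shows "tmap L (M \<times>\<^sub>M N) (\<lambda>y. (f y, g y)) l v = tpair M N (f l) (g l) (tmap L M f l v) (tmap L N g l v)"
proof -
  note MN = regular_prod[OF M N]
  note fg = smooth_at_Pair[OF L M N f g]
  note pt = smooth_at_in(2)[OF f] smooth_at_in(2)[OF g]
  note Tfg = tmap_in_tspace[OF L M f v] tmap_in_tspace[OF L N g v]
  have "tmap (M \<times>\<^sub>M N) M fst (f l, g l) (tmap L (M \<times>\<^sub>M N) (\<lambda>y. (f y, g y)) l v) = tmap L M f l v"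
    using tmap_compose[OF L MN M fg, of fst, OF smooth_at_fst[OF M N] v] smooth_at_in(2)[OF fg] by simp
  moreover have "tmap (M \<times>\<^sub>M N) N snd (f l, g l) (tmap L (M \<times>\<^sub>M N) (\<lambda>y. (f y, g y)) l v) = tmap L N g l v"
    using tmap_compose[OF L MN N fg, of snd, OF smooth_at_snd[OF M N] v] smooth_at_in(2)[OF fg] by simp
  ultimately show ?thesis
    by (intro tspace_prod_eqI[OF M N pt tmap_in_tspace[OF L MN fg v] tpair_in_tspace[OF M N pt Tfg]])
      (simp_all add: tmap_fst_tpair[OF M N pt Tfg] tmap_snd_tpair[OF M N pt Tfg])
qed

lemma tpair_split:
  assumes M: "regular_atlas M" and N: "regular_atlas N" and x: "x \<in> points M" and y: "y \<in> points N"
    and u: "u \<in> tspace M x" and v: "v \<in> tspace N y"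
  shows "tpair M N x y u v = tadd (tpair M N x y u tzero) (tpair M N x y tzero v)"
proof -
  obtain c where c: "c \<in> M" "x \<in> cdom c" using x by (rule pointsE)
  obtain d where d: "d \<in> N" "y \<in> cdom d" using y by (rule pointsE)
  note MN = regular_prod[OF M N]
  have C: "prod_chart c d \<in> M \<times>\<^sub>M N" "(x, y) \<in> cdom (prod_chart c d)"
    using c d by (auto simp: prod_chart_in)
  show ?thesis
    by (rule tspace_eqI[OF _ _ C])
      (simp_all add: tpair_in_tspace[OF M N x y] tspace_tadd[OF MN] u v tspace_tzero[OF M]
        tspace_tzero[OF N] tpair_chart[OF M N c d])
qed

text \<open>The total derivative is the sum of the partial ones: each partial tangent map is the
  full tangent map of F on a pair with one zero entry, and every pair is a sum of two such pairs. It
  will be applied to identities that write a point through a local section together with a group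
  element or a fibre coordinate.\<close>

lemma tmap_split:
  assumes L: "regular_atlas L" and M: "regular_atlas M" and N: "regular_atlas N" and K: "regular_atlas K"
    and f: "smooth_at L M f l" and g: "smooth_at L N g l"
    and F: "smooth_at (M \<times>\<^sub>M N) K F (f l, g l)" and v: "v \<in> tspace L l"
  shows "tmap L K (\<lambda>y. F (f y, g y)) l v =
    tadd (tmap M K (\<lambda>m. F (m, g l)) (f l) (tmap L M f l v))
         (tmap N K (\<lambda>n. F (f l, n)) (g l) (tmap L N g l v))"
proof -
  note MN = regular_prod[OF M N]
  note pt = smooth_at_in(2)[OF f] smooth_at_in(2)[OF g]
  note Tfg = tmap_in_tspace[OF L M f v] tmap_in_tspace[OF L N g v]
  note z = tspace_tzero[OF M] tspace_tzero[OF N]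
  let ?T = "tmap (M \<times>\<^sub>M N) K F (f l, g l)"
  have 1: "tmap M K (\<lambda>m. F (m, g l)) (f l) u = ?T (tpair M N (f l) (g l) u tzero)"
    if u: "u \<in> tspace M (f l)" for u
    using tmap_compose[OF M MN K smooth_at_Pair[OF M M N smooth_at_ident[OF M pt(1)]
          smooth_at_const[OF N pt]] F u]
    by (simp add: tmap_Pair[OF M M N smooth_at_ident[OF M pt(1)] smooth_at_const[OF N pt] u]
        tmap_ident[OF M pt(1) u] tmap_const[OF M N pt u])
  have 2: "tmap N K (\<lambda>n. F (f l, n)) (g l) u = ?T (tpair M N (f l) (g l) tzero u)"
    if u: "u \<in> tspace N (g l)" for u
    using tmap_compose[OF N MN K smooth_at_Pair[OF N M N smooth_at_const[OF M pt(2,1)]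
          smooth_at_ident[OF N pt(2)]] F u]
    by (simp add: tmap_Pair[OF N M N smooth_at_const[OF M pt(2,1)] smooth_at_ident[OF N pt(2)] u]
        tmap_ident[OF N pt(2) u] tmap_const[OF N M pt(2,1) u])
  have "tmap L K (\<lambda>y. F (f y, g y)) l v = ?T (tpair M N (f l) (g l) (tmap L M f l v) (tmap L N g l v))"
    using tmap_compose[OF L MN K smooth_at_Pair[OF L M N f g] F v] by (simp add: tmap_Pair[OF L M N f g v])
  also have "\<dots> = tadd (?T (tpair M N (f l) (g l) (tmap L M f l v) tzero))
      (?T (tpair M N (f l) (g l) tzero (tmap L N g l v)))"
    using tlinear_tadd[OF tlinear_tmap[OF MN K F] tpair_in_tspace[OF M N pt Tfg(1) z(2)]
        tpair_in_tspace[OF M N pt z(1) Tfg(2)]]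
    by (simp add: tpair_split[OF M N pt Tfg])
  finally show ?thesis
    by (simp add: 1[OF Tfg(1)] 2[OF Tfg(2)])
qed

section \<open>Smooth families of tangent vectors\<close>

text \<open>Tangent maps at nearby points can be handled only if smoothness spreads from x to a
  neighbourhood. It does, because \<open>smooth_near\<close> refers to an open set and continuity
  keeps nearby values in one target chart.\<close>

lemma smooth_at_eventually_smooth_at:
  assumes M: "regular_atlas M" and N: "regular_atlas N" and f: "smooth_at M N f x"
  shows "\<forall>\<^sub>F y in mnhds M x. smooth_at M N f y"
proof -
  obtain c where c: "c \<in> M" "x \<in> cdom c" using smooth_at_in(1)[OF f] by (rule pointsE)
  obtain d where d: "d \<in> N" "f x \<in> cdom d" using smooth_at_in(2)[OF f] by (rule pointsE)
  have ev: "\<forall>\<^sub>F a in nhds (cmap c x). f (cinv c a) \<in> cdom d"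
    using smooth_at_eventually[OF f eventually_cdom[OF N d]]
    by (simp add: eventually_mnhds_chart[OF M c])
  \<comment> \<open>The chart condition must hold around every nearby point, not just at it;
    \<open>eventually_eventually\<close> supplies the nested form.\<close>
  from ev have "\<forall>\<^sub>F a in nhds (cmap c x). \<forall>\<^sub>F b in nhds a. f (cinv c b) \<in> cdom d"
    by (simp add: eventually_eventually)
  moreover note ev
    eventually_smooth_near[OF smooth_fun_atD[OF smooth_at_cmap[OF f d] c]]
    eventually_cimg[OF M c]
  ultimately show ?thesis
    unfolding eventually_mnhds_chart[OF M c]
  proof eventually_elim
    case (elim a)
    then show ?case
      by (intro smooth_atI[where f = f, OF M N c(1) _ d(1)]) (simp_all add: cinv_in cmap_cinv)
  qed
qed

lemma smooth_fun_at_derivative: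
  fixes h :: "'a \<Rightarrow> 'v::real_inner"
  assumes M: "regular_atlas M" and fin: "fin_dim TYPE('v)"
    and h: "smooth_fun_at M h x" and g: "smooth_near g (h x)" and v: "smooth_fun_at M v x"
  shows "smooth_fun_at M (\<lambda>y. frechet_derivative g (at (h y)) (v y)) x"
proof -
  obtain c where c: "c \<in> M" "x \<in> cdom c" using h by (auto simp: smooth_fun_at_def points_chart)
  show ?thesis
    using smooth_near_derivative[OF fin smooth_fun_atD[OF h c] _ smooth_fun_atD[OF v c], of g] g
    by (intro smooth_fun_atI[OF M c]) (simp add: cinv_cmap[OF M c])
qed

text \<open>A smooth vector field along the map f, in germ form. It is the common shape of values of
  operators, connection forms, lifts and projections, whose base point moves together with the
  vector.\<close>

definition smooth_along ::
  "('y, 'ey::real_inner) atlas \<Rightarrow> ('a, 'e::real_inner) atlas \<Rightarrow> ('y \<Rightarrow> 'a) \<Rightarrow> ('y \<Rightarrow> ('a, 'e) tvec) \<Rightarrow> 'y \<Rightarrow> bool"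
  where
  "smooth_along Y M f X y \<longleftrightarrow> smooth_at Y M f y \<and> (\<forall>\<^sub>F z in mnhds Y y. X z \<in> tspace M (f z)) \<and>
     (\<forall>d\<in>M. f y \<in> cdom d \<longrightarrow> smooth_fun_at Y (\<lambda>z. X z d) y)"

lemma smooth_alongD:
  assumes "smooth_along Y M f X y"
  shows "smooth_at Y M f y" "\<forall>\<^sub>F z in mnhds Y y. X z \<in> tspace M (f z)"
    "d \<in> M \<Longrightarrow> f y \<in> cdom d \<Longrightarrow> smooth_fun_at Y (\<lambda>z. X z d) y"
  using assms by (simp_all add: smooth_along_def)

text \<open>One chart is enough: components in another chart arise by applying the derivative of the
  transition map, at a moving point, to a moving vector, and \<open>smooth_fun_at_derivative\<close>
  keeps this smooth.\<close>

lemma smooth_alongI: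
  assumes Y: "regular_atlas Y" and M: "regular_atlas M" and f: "smooth_at Y M f y"
    and ev: "\<forall>\<^sub>F z in mnhds Y y. X z \<in> tspace M (f z)"
    and d: "d \<in> M" "f y \<in> cdom d" and X: "smooth_fun_at Y (\<lambda>z. X z d) y"
  shows "smooth_along Y M f X y"
  unfolding smooth_along_def
proof (intro conjI f ev ballI impI)
  fix d' assume d': "d' \<in> M" "f y \<in> cdom d'"
  have "smooth_fun_at Y (\<lambda>z. frechet_derivative (\<lambda>a. cmap d' (cinv d a)) (at (cmap d (f z))) (X z d)) y"
    by (rule smooth_fun_at_derivative[OF Y regular_atlas_fin[OF M] smooth_at_cmap[OF f d]
          smooth_near_transition[OF M d(1) d'(1) d(2) d'(2)] X])
  moreover have "\<forall>\<^sub>F z in mnhds Y y.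
      frechet_derivative (\<lambda>a. cmap d' (cinv d a)) (at (cmap d (f z))) (X z d) = X z d'"
    using ev smooth_at_eventually[OF f eventually_cdom[OF M d]]
      smooth_at_eventually[OF f eventually_cdom[OF M d']]
    by eventually_elim (rule tspace_coord_change[OF _ d(1) d'(1), symmetric])
  ultimately show "smooth_fun_at Y (\<lambda>z. X z d') y"
    by (rule smooth_fun_at_cong[OF Y])
qed

lemma smooth_along_eventually_points:
  assumes "regular_atlas M" "smooth_along Y M f X y"
  shows "\<forall>\<^sub>F z in mnhds Y y. f z \<in> points M"
  by (rule smooth_at_eventually[OF smooth_alongD(1)[OF assms(2)]
        eventually_points[OF assms(1) smooth_at_in(2)[OF smooth_alongD(1)[OF assms(2)]]]])

lemma smooth_along_cong:
  assumes Y: "regular_atlas Y" and X: "smooth_along Y M f X y"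
    and ev: "\<forall>\<^sub>F z in mnhds Y y. f z = g z \<and> X z = X' z"
  shows "smooth_along Y M g X' y"
proof -
  have eq: "f y = g y"
    using eventually_mnhds_self[OF Y smooth_at_in(1)[OF smooth_alongD(1)[OF X]] ev] by blast
  have "smooth_at Y M g y"
    by (rule smooth_at_cong[OF Y smooth_alongD(1)[OF X]]) (rule eventually_mono[OF ev], simp)
  moreover have "\<forall>\<^sub>F z in mnhds Y y. X' z \<in> tspace M (g z)"
    using smooth_alongD(2)[OF X] ev by eventually_elim simp
  moreover have "smooth_fun_at Y (\<lambda>z. X' z d) y" if "d \<in> M" "f y \<in> cdom d" for d
    by (rule smooth_fun_at_cong[OF Y smooth_alongD(3)[OF X that]]) (rule eventually_mono[OF ev], simp)
  ultimately show ?thesis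
    by (simp add: smooth_along_def eq)
qed

lemma smooth_along_tadd:
  assumes M: "regular_atlas M" and X: "smooth_along Y M f X y" and X': "smooth_along Y M f X' y"
  shows "smooth_along Y M f (\<lambda>z. tadd (X z) (X' z)) y"
  unfolding smooth_along_def
proof (intro conjI ballI impI smooth_alongD(1)[OF X])
  show "\<forall>\<^sub>F z in mnhds Y y. tadd (X z) (X' z) \<in> tspace M (f z)"
    using smooth_alongD(2)[OF X] smooth_alongD(2)[OF X'] by eventually_elim (rule tspace_tadd[OF M])
qed (simp add: smooth_fun_at_add smooth_alongD(3)[OF X] smooth_alongD(3)[OF X'])

lemma smooth_along_tscale:
  assumes M: "regular_atlas M" and X: "smooth_along Y M f X y"
  shows "smooth_along Y M f (\<lambda>z. tscale r (X z)) y"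
  unfolding smooth_along_def
proof (intro conjI ballI impI smooth_alongD(1)[OF X])
  show "\<forall>\<^sub>F z in mnhds Y y. tscale r (X z) \<in> tspace M (f z)"
    using smooth_alongD(2)[OF X] by eventually_elim (rule tspace_tscale[OF M])
qed (simp add: smooth_fun_at_bounded_linear[OF bounded_linear_scaleR_right] smooth_alongD(3)[OF X])

lemma smooth_along_tsub:
  assumes "regular_atlas M" "smooth_along Y M f X y" "smooth_along Y M f X' y"
  shows "smooth_along Y M f (\<lambda>z. tsub (X z) (X' z)) y"
  unfolding tsub_def by (intro smooth_along_tadd smooth_along_tscale assms)

lemma smooth_along_tpair:
  assumes Y: "regular_atlas Y" and M: "regular_atlas M" and N: "regular_atlas N"
    and X: "smooth_along Y M f X y" and V: "smooth_along Y N g V y"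
  shows "smooth_along Y (M \<times>\<^sub>M N) (\<lambda>z. (f z, g z)) (\<lambda>z. tpair M N (f z) (g z) (X z) (V z)) y"
proof -
  note f = smooth_alongD(1)[OF X] and g = smooth_alongD(1)[OF V]
  obtain c where c: "c \<in> M" "f y \<in> cdom c" using smooth_at_in(2)[OF f] by (rule pointsE)
  obtain d where d: "d \<in> N" "g y \<in> cdom d" using smooth_at_in(2)[OF g] by (rule pointsE)
  show ?thesis
  proof (rule smooth_alongI[OF Y regular_prod[OF M N] smooth_at_Pair[OF Y M N f g]
        _ prod_chart_in[OF c(1) d(1)]])
    show "\<forall>\<^sub>F z in mnhds Y y. tpair M N (f z) (g z) (X z) (V z) \<in> tspace (M \<times>\<^sub>M N) (f z, g z)"
      using smooth_along_eventually_points[OF M X] smooth_along_eventually_points[OF N V]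
        smooth_alongD(2)[OF X] smooth_alongD(2)[OF V]
      by eventually_elim (rule tpair_in_tspace[OF M N])
    have "\<forall>\<^sub>F z in mnhds Y y. (X z c, V z d) = tpair M N (f z) (g z) (X z) (V z) (prod_chart c d)"
      using smooth_at_eventually[OF f eventually_cdom[OF M c]]
        smooth_at_eventually[OF g eventually_cdom[OF N d]]
        smooth_alongD(2)[OF X] smooth_alongD(2)[OF V]
      by eventually_elim (simp add: tpair_chart[OF M N c(1) _ d(1)])
    from smooth_fun_at_cong[OF Y _ this]
    show "smooth_fun_at Y (\<lambda>z. tpair M N (f z) (g z) (X z) (V z) (prod_chart c d)) y"
      by (simp add: smooth_fun_at_Pair smooth_alongD(3)[OF X c] smooth_alongD(3)[OF V d])
  qed (use c d in auto)
qed

text \<open>The map h z depends on the parameter z but is differentiated only in its own argument.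
  Its tangent map is thus a partial derivative of the joint map, i.e. the joint derivative applied
  to a vector whose first component is 0.\<close>

lemma smooth_along_tmap:
  assumes Y: "regular_atlas Y" and M: "regular_atlas M" and K: "regular_atlas K"
    and H: "smooth_at (Y \<times>\<^sub>M M) K (\<lambda>z. h (fst z) (snd z)) (y, f y)"
    and X: "smooth_along Y M f X y"
  shows "smooth_along Y K (\<lambda>z. h z (f z)) (\<lambda>z. tmap M K (h z) (f z) (X z)) y"
proof -
  note f = smooth_alongD(1)[OF X] and YM = regular_prod[OF Y M]
  note y = smooth_at_in(1)[OF f]
  note yf = smooth_at_Pair[OF Y Y M smooth_at_ident[OF Y y] f]
  have hf: "smooth_at Y K (\<lambda>z. h z (f z)) y"
    using smooth_at_compose[OF Y YM K yf H] by simp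
  have evH: "\<forall>\<^sub>F z in mnhds Y y. smooth_at (Y \<times>\<^sub>M M) K (\<lambda>z. h (fst z) (snd z)) (z, f z)"
    using smooth_at_eventually[OF yf smooth_at_eventually_smooth_at[OF YM K H]] .
  have slice: "smooth_at M K (h z) (f z)"
    if "smooth_at (Y \<times>\<^sub>M M) K (\<lambda>z. h (fst z) (snd z)) (z, f z)" for z
    using smooth_at_slice_right[OF Y M K that] by simp
  obtain c where c: "c \<in> Y" "y \<in> cdom c" using y by (rule pointsE)
  obtain d where d: "d \<in> M" "f y \<in> cdom d" using smooth_at_in(2)[OF f] by (rule pointsE)
  obtain e where e: "e \<in> K" "h y (f y) \<in> cdom e" using smooth_at_in(2)[OF hf] by (rule pointsE)
  let ?C = "prod_chart c d"
  have C: "?C \<in> Y \<times>\<^sub>M M" using c d by (simp add: prod_chart_in)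
  define Hc where "Hc = (\<lambda>a. cmap e (h (fst (cinv ?C a)) (snd (cinv ?C a))))"
  have Hc: "smooth_near Hc (cmap c z, cmap d (f z))"
    if "smooth_at (Y \<times>\<^sub>M M) K (\<lambda>z. h (fst z) (snd z)) (z, f z)"
      "z \<in> cdom c" "f z \<in> cdom d" "h z (f z) \<in> cdom e" for z
    using smooth_fun_atD[OF smooth_at_cmap[OF that(1) e(1)] C] that(2-4) by (simp add: Hc_def)
  have fin: "fin_dim TYPE('b \<times> 'd)"
    using Y M by (intro fin_dim_prod regular_atlas_fin)
  show ?thesis
  proof (rule smooth_alongI[OF Y K hf _ e])
    show "\<forall>\<^sub>F z in mnhds Y y. tmap M K (h z) (f z) (X z) \<in> tspace K (h z (f z))"
      using evH smooth_alongD(2)[OF X] by eventually_elim (rule tmap_in_tspace[OF M K slice])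
    have "smooth_fun_at Y (\<lambda>z. frechet_derivative Hc (at (cmap c z, cmap d (f z))) (0, X z d)) y"
      by (rule smooth_fun_at_derivative[OF Y fin _ _ smooth_fun_at_Pair[OF smooth_fun_at_const[OF y]]])
        (intro smooth_fun_at_Pair smooth_fun_at_cmap[OF Y c] smooth_at_cmap[OF f d] Hc H c d e
          smooth_alongD(3)[OF X d])+
    moreover have "\<forall>\<^sub>F z in mnhds Y y. frechet_derivative Hc (at (cmap c z, cmap d (f z))) (0, X z d) =
        tmap M K (h z) (f z) (X z) e"
      using evH smooth_alongD(2)[OF X] eventually_cdom[OF Y c]
        smooth_at_eventually[OF f eventually_cdom[OF M d]]
        smooth_at_eventually[OF hf eventually_cdom[OF K e]]
    proof eventually_elim
      case (elim z)
      \<comment> \<open>The slice with first coordinate frozen at that of z; the chain rule along it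
        produces the zero first component.\<close>
      have pair: "((\<lambda>b. (cmap c z, b)) has_derivative (\<lambda>v. (0, v))) (at b)" for b :: 'd
        by (rule has_derivative_Pair[OF has_derivative_const has_derivative_ident])
      have "\<forall>\<^sub>F b in nhds (cmap d (f z)). cmap e (h z (cinv d b)) = Hc (cmap c z, b)"
        using eventually_cimg[OF M d(1) elim(4)]
        by eventually_elim
          (use elim(3) in \<open>simp add: Hc_def cinv_prod_chart[OF Y c(1) M d(1)] cinv_cmap[OF Y c(1)]
            del: prod_chart_simps\<close>)
      from frechet_derivative_cong[OF smooth_fun_atD[OF smooth_at_cmap[OF slice[OF elim(1)]
          e(1) elim(5)] d(1) elim(4)] this]
      have "tmap M K (h z) (f z) (X z) e =
          frechet_derivative (\<lambda>b. Hc (cmap c z, b)) (at (cmap d (f z))) (X z d)"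
        by (simp add: tmap_chart[OF M slice[OF elim(1)] elim(2) d(1) elim(4) e(1) elim(5)])
      also have "\<dots> = frechet_derivative Hc (at (cmap c z, cmap d (f z))) (0, X z d)"
        using frechet_derivative_at[OF has_derivative_compose[OF pair
              smooth_near_has_derivative[OF Hc[OF elim(1,3,4,5)]]]]
        by metis
      finally show ?case by simp
    qed
    ultimately show "smooth_fun_at Y (\<lambda>z. tmap M K (h z) (f z) (X z) e) y"
      by (rule smooth_fun_at_cong[OF Y])
  qed
qed

lemma smooth_along_tmap_const:
  assumes Y: "regular_atlas Y" and M: "regular_atlas M" and K: "regular_atlas K"
    and h: "smooth_at M K h (f y)" and X: "smooth_along Y M f X y"
  shows "smooth_along Y K (\<lambda>z. h (f z)) (\<lambda>z. tmap M K h (f z) (X z)) y"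
proof (rule smooth_along_tmap[OF Y M K _ X])
  note f = smooth_alongD(1)[OF X]
  have "(y, f y) \<in> points (Y \<times>\<^sub>M M)"
    using smooth_at_in[OF f] by (simp add: points_prod)
  from smooth_at_compose[OF regular_prod[OF Y M] M K smooth_at_snd[OF Y M this], of h] h
  show "smooth_at (Y \<times>\<^sub>M M) K (\<lambda>z. h (snd z)) (y, f y)" by simp
qed

text \<open>Smoothness of a family of linear maps is tested on vectors with constant coordinates.
  Linearity and a basis of the model space extend it to an arbitrary smooth field X.\<close>

lemma smooth_along_linear:
  assumes Y: "regular_atlas Y" and M: "regular_atlas M" and K: "regular_atlas K"
    and X: "smooth_along Y M f X y" and c: "c \<in> M" "f y \<in> cdom c" and g: "smooth_at Y K g y"
    and lin: "\<forall>\<^sub>F z in mnhds Y y. tlinear (tspace M (f z)) (tspace K (g z)) (L z)"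
    and L: "\<And>e. smooth_along Y K g (\<lambda>z. L z (tcoord M c (f z) e)) y"
  shows "smooth_along Y K g (\<lambda>z. L z (X z)) y"
proof -
  note f = smooth_alongD(1)[OF X]
  obtain b where b: "b \<in> Y" "y \<in> cdom b" using smooth_at_in(1)[OF f] by (rule pointsE)
  obtain d where d: "d \<in> K" "g y \<in> cdom d" using smooth_at_in(2)[OF g] by (rule pointsE)
  note evc = smooth_at_eventually[OF f eventually_cdom[OF M c]]
  have "\<forall>\<^sub>F z in mnhds Y y. linear (\<lambda>e. L z (tcoord M c (f z) e) d)"
    using lin evc
  proof eventually_elim
    case (elim z)
    note T = tcoord_in_tspace[OF M c(1) elim(2)]
    have "tcoord M c (f z) (u + v) = tadd (tcoord M c (f z) u) (tcoord M c (f z) v)" for u v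
      by (rule tspace_eqI[OF T tspace_tadd[OF M T T] c(1) elim(2)]) (simp add: tcoord_self[OF M c(1) elim(2)])
    moreover have "tcoord M c (f z) (r *\<^sub>R v) = tscale r (tcoord M c (f z) v)" for r v
      by (rule tspace_eqI[OF T tspace_tscale[OF M T] c(1) elim(2)]) (simp add: tcoord_self[OF M c(1) elim(2)])
    ultimately show ?case
      by (intro linearI) (simp_all add: tlinear_tadd[OF elim(1) T T] tlinear_tscale[OF elim(1) T])
  qed
  then have "\<forall>\<^sub>F a in nhds (cmap b y). linear (\<lambda>e. L (cinv b a) (tcoord M c (f (cinv b a)) e) d)"
    by (simp add: eventually_mnhds_chart[OF Y b])
  from smooth_near_linear_apply[OF regular_atlas_fin[OF M] this
      smooth_fun_atD[OF smooth_alongD(3)[OF L d] b] smooth_fun_atD[OF smooth_alongD(3)[OF X c] b]]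
  have "smooth_fun_at Y (\<lambda>z. L z (tcoord M c (f z) (X z c)) d) y"
    by (rule smooth_fun_atI[OF Y b])
  moreover have "\<forall>\<^sub>F z in mnhds Y y. L z (tcoord M c (f z) (X z c)) d = L z (X z) d"
    using evc smooth_alongD(2)[OF X] by eventually_elim (simp add: tcoord_of_coord[OF M c(1)])
  ultimately have sm: "smooth_fun_at Y (\<lambda>z. L z (X z) d) y"
    by (rule smooth_fun_at_cong[OF Y])
  show ?thesis
  proof (rule smooth_alongI[where X = "\<lambda>z. L z (X z)", OF Y K g _ d sm])
    show "\<forall>\<^sub>F z in mnhds Y y. L z (X z) \<in> tspace K (g z)"
      using lin smooth_alongD(2)[OF X] by eventually_elim (rule tlinear_in)
  qed
qed

section \<open>Stratonovich operators and smooth families\<close>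

lemma smooth_fun_at_prodE:
  assumes M: "regular_atlas M" and N: "regular_atlas N" and c: "c \<in> M" "d \<in> N"
    and h: "\<And>x y. x \<in> cdom c \<Longrightarrow> y \<in> cdom d \<Longrightarrow> smooth_fun_at (M \<times>\<^sub>M N) h (x, y)"
  shows "smooth_on (cimg c \<times> cimg d) (\<lambda>(a, b). h (cinv c a, cinv d b))"
proof (rule smooth_on_if_smooth_near, clarify)
  fix x y assume x: "x \<in> cdom c" "y \<in> cdom d"
  have "smooth_near (\<lambda>a. h (cinv (prod_chart c d) a)) (cmap c x, cmap d y)"
    using smooth_fun_atD[OF h[OF x] prod_chart_in[OF c]] x by simp
  then show "smooth_near (\<lambda>(a, b). h (cinv c a, cinv d b)) (cmap c x, cmap d y)"
    by (rule smooth_near_cong)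
      (use eventually_cinv_prod_chart[OF M c(1) N c(2) x] in \<open>auto elim!: eventually_mono\<close>)
qed

lemma stratonovich_tlinear:
  "stratonovich N M S \<Longrightarrow> x \<in> points N \<Longrightarrow> y \<in> points M \<Longrightarrow> tlinear (tspace N x) (tspace M y) (S x y)"
  by (simp add: stratonovich_def)

text \<open>Pulls the defining condition of \<open>stratonovich\<close>, which lives on products of
  chart images, back along arbitrary smooth maps f and g. The vector keeps constant coordinates e in
  the chart c.\<close>

lemma stratonovich_smooth_along:
  assumes Y: "regular_atlas Y" and N: "regular_atlas N" and M: "regular_atlas M"
    and S: "stratonovich N M S" and f: "smooth_at Y N f y" and g: "smooth_at Y M g y"
    and c: "c \<in> N" "f y \<in> cdom c"
  shows "smooth_along Y M g (\<lambda>z. S (f z) (g z) (tcoord N c (f z) e)) y"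
proof -
  obtain d where d: "d \<in> M" "g y \<in> cdom d" using smooth_at_in(2)[OF g] by (rule pointsE)
  note evc = smooth_at_eventually[OF f eventually_cdom[OF N c]]
  note evd = smooth_at_eventually[OF g eventually_cdom[OF M d]]
  let ?F = "\<lambda>(a, b). S (cinv c a) (cinv d b) (tcoord N c (cinv c a) e) d"
  have "smooth_on (cimg c \<times> cimg d) ?F"
    using S c(1) d(1) by (simp add: stratonovich_def)
  then have F: "smooth_near ?F (cmap c (f y), cmap d (g y))"
    by (rule smooth_nearI[rotated -1]) (use c d in \<open>auto intro: open_Times open_cimg N M\<close>)
  have fin: "fin_dim TYPE('d \<times> 'f)"
    using N M by (intro fin_dim_prod regular_atlas_fin)
  show ?thesis
  proof (rule smooth_alongI[OF Y M g _ d])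
    show "\<forall>\<^sub>F z in mnhds Y y. S (f z) (g z) (tcoord N c (f z) e) \<in> tspace M (g z)"
      using evc evd
    proof eventually_elim
      case (elim z)
      then show ?case
        by (intro tlinear_in[OF stratonovich_tlinear[OF S]] chart_in_points[OF c(1)]
            chart_in_points[OF d(1)] tcoord_in_tspace[OF N c(1)])
    qed
    have "smooth_fun_at Y (\<lambda>z. ?F (cmap c (f z), cmap d (g z))) y"
      by (rule smooth_fun_at_germ[where g = ?F and h = "\<lambda>z. (cmap c (f z), cmap d (g z))",
            OF Y fin _ F])
        (intro smooth_fun_at_Pair smooth_at_cmap[OF f c] smooth_at_cmap[OF g d])
    moreover have "\<forall>\<^sub>F z in mnhds Y y.
        ?F (cmap c (f z), cmap d (g z)) = S (f z) (g z) (tcoord N c (f z) e) d"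
      using evc evd by eventually_elim (simp add: cinv_cmap[OF N c(1)] cinv_cmap[OF M d(1)])
    ultimately show "smooth_fun_at Y (\<lambda>z. S (f z) (g z) (tcoord N c (f z) e) d) y"
      by (rule smooth_fun_at_cong[OF Y])
  qed
qed

text \<open>With N \<times> M itself as the parameter manifold and its projections as the maps,
  smoothness along them gives back the chartwise condition.\<close>

lemma stratonovichI:
  assumes N: "regular_atlas N" and M: "regular_atlas M"
    and lin: "\<And>x y. x \<in> points N \<Longrightarrow> y \<in> points M \<Longrightarrow> tlinear (tspace N x) (tspace M y) (S x y)"
    and sm: "\<And>x y c e. c \<in> N \<Longrightarrow> x \<in> cdom c \<Longrightarrow> y \<in> points M \<Longrightarrow>
      smooth_along (N \<times>\<^sub>M M) M snd (\<lambda>z. S (fst z) (snd z) (tcoord N c (fst z) e)) (x, y)"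
  shows "stratonovich N M S"
  unfolding stratonovich_def
proof (intro conjI ballI allI lin)
  fix c d e assume c: "c \<in> N" and d: "d \<in> M"
  have "smooth_fun_at (N \<times>\<^sub>M M) (\<lambda>z. S (fst z) (snd z) (tcoord N c (fst z) e) d) (x, y)"
    if "x \<in> cdom c" "y \<in> cdom d" for x y
    using smooth_alongD(3)[OF sm[OF c that(1) chart_in_points[OF d that(2)]] d] that(2) by simp
  from smooth_fun_at_prodE[OF N M c d this]
  show "smooth_on (cimg c \<times> cimg d) (\<lambda>(a, b). S (cinv c a) (cinv d b) (tcoord N c (cinv c a) e) d)"
    by simp
qed

lemma dep_stratonovichI:
  assumes N: "regular_atlas N" and M1: "regular_atlas M1" and M2: "regular_atlas M2"
    and lin: "\<And>x y z. x \<in> points N \<Longrightarrow> y \<in> points M1 \<Longrightarrow> z \<in> points M2 \<Longrightarrow>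
      tlinear (tspace N x) (tspace M1 y) (S x y z)"
    and sm: "\<And>x y z c e. c \<in> N \<Longrightarrow> x \<in> cdom c \<Longrightarrow> y \<in> points M1 \<Longrightarrow> z \<in> points M2 \<Longrightarrow>
      smooth_along (N \<times>\<^sub>M (M1 \<times>\<^sub>M M2)) M1 (\<lambda>z. fst (snd z))
        (\<lambda>z. S (fst z) (fst (snd z)) (snd (snd z)) (tcoord N c (fst z) e)) (x, (y, z))"
  shows "dep_stratonovich N M1 M2 S"
  unfolding dep_stratonovich_def
proof (intro conjI ballI allI lin)
  fix c d d' e assume c: "c \<in> N" and d: "d \<in> M1" "d' \<in> M2"
  let ?D = "prod_chart d d'"
  have D: "?D \<in> M1 \<times>\<^sub>M M2" using d by (simp add: prod_chart_in)
  have "smooth_fun_at (N \<times>\<^sub>M (M1 \<times>\<^sub>M M2))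
      (\<lambda>z. S (fst z) (fst (snd z)) (snd (snd z)) (tcoord N c (fst z) e) d) (x, w)"
    if x: "x \<in> cdom c" and w: "w \<in> cdom ?D" for x w
  proof -
    obtain y z where w': "w = (y, z)" by (cases w)
    with w have yz: "y \<in> cdom d" "z \<in> cdom d'" by auto
    show ?thesis
      using smooth_alongD(3)[OF sm[OF c x chart_in_points[OF d(1) yz(1)] chart_in_points[OF d(2) yz(2)]] d(1)]
        yz(1) by (simp add: w')
  qed
  from smooth_fun_at_prodE[OF N regular_prod[OF M1 M2] c D this]
  have "smooth_on (cimg c \<times> cimg ?D) (\<lambda>(a, b). S (cinv c a) (fst (cinv ?D b)) (snd (cinv ?D b))
      (tcoord N c (cinv c a) e) d)"
    by simp
  moreover have "open (cimg c \<times> cimg d \<times> cimg d')"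
    by (intro open_Times open_cimg[OF N c] open_cimg[OF M1 d(1)] open_cimg[OF M2 d(2)])
  ultimately show "smooth_on (cimg c \<times> cimg d \<times> cimg d')
      (\<lambda>(a, b, b'). S (cinv c a) (cinv d b) (cinv d' b') (tcoord N c (cinv c a) e) d)"
    unfolding cimg_prod_chart
    by (rule smooth_on_cong) (auto simp del: prod_chart_simps simp: cinv_prod_chart[OF M1 d(1) M2 d(2)])
qed

section \<open>Principal bundles\<close>

locale principal_bundle_data =
  fixes G :: "('g, 'x) monoid_scheme"
    and \<G> :: "('g, 'eg::real_inner) atlas"
    and P :: "('p, 'ep::real_inner) atlas"
    and Q :: "('q, 'eq::real_inner) atlas"
    and R :: "'p \<Rightarrow> 'g \<Rightarrow> 'p"
    and \<pi> :: "'p \<Rightarrow> 'q"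
  assumes principal: "principal_bundle G \<G> P Q R \<pi>"
begin

sublocale group G
  using principal by (simp add: principal_bundle_def lie_group_def)

lemma regular_G: "regular_atlas \<G>" and points_G: "points \<G> = carrier G"
  and regular_P: "regular_atlas P" and regular_Q: "regular_atlas Q"
  using principal by (auto simp: principal_bundle_def lie_group_def manifold_regular_atlas)

lemma smooth_pi: "p \<in> points P \<Longrightarrow> smooth_at P Q \<pi> p"
  using smooth_map_smooth_at[OF regular_P regular_Q] principal by (simp add: principal_bundle_def)

lemma pi_in: "p \<in> points P \<Longrightarrow> \<pi> p \<in> points Q"
  by (rule smooth_at_in(2)[OF smooth_pi])

lemma pi_surj: "q \<in> points Q \<Longrightarrow> \<exists>p\<in>points P. \<pi> p = q"
  using principal unfolding principal_bundle_def by (metis imageE)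

section \<open>Smoothness of the action and of the group operations\<close>

lemma smooth_R:
  assumes "p \<in> points P" "g \<in> carrier G"
  shows "smooth_at (P \<times>\<^sub>M \<G>) P (\<lambda>z. R (fst z) (snd z)) (p, g)"
proof -
  have "smooth_map (P \<times>\<^sub>M \<G>) P (\<lambda>z. R (fst z) (snd z))"
    using principal by (simp add: principal_bundle_def smooth_right_action_def case_prod_beta')
  then show ?thesis
    using smooth_map_smooth_at[OF regular_prod[OF regular_P regular_G] regular_P] assms
    by (simp add: points_prod points_G)
qed

lemma smooth_mult:
  assumes "g \<in> carrier G" "h \<in> carrier G"
  shows "smooth_at (\<G> \<times>\<^sub>M \<G>) \<G> (\<lambda>z. fst z \<otimes>\<^bsub>G\<^esub> snd z) (g, h)"
proof -
  have "smooth_map (\<G> \<times>\<^sub>M \<G>) \<G> (\<lambda>z. fst z \<otimes>\<^bsub>G\<^esub> snd z)"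
    using principal by (simp add: principal_bundle_def lie_group_def case_prod_beta')
  then show ?thesis
    using smooth_map_smooth_at[OF regular_prod[OF regular_G regular_G] regular_G] assms
    by (simp add: points_prod points_G)
qed

lemma smooth_inv: "g \<in> carrier G \<Longrightarrow> smooth_at \<G> \<G> (\<lambda>g. inv\<^bsub>G\<^esub> g) g"
  using smooth_map_smooth_at[OF regular_G regular_G] principal
  by (simp add: principal_bundle_def lie_group_def points_G)

lemma smooth_at_R:
  assumes Y: "regular_atlas Y" and f: "smooth_at Y P f y" and g: "smooth_at Y \<G> g y"
  shows "smooth_at Y P (\<lambda>z. R (f z) (g z)) y"
  using smooth_at_compose[OF Y regular_prod[OF regular_P regular_G] regular_P
      smooth_at_Pair[OF Y regular_P regular_G f g] smooth_R] smooth_at_in(2)[OF f] smooth_at_in(2)[OF g]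
  by (simp add: points_G)

lemma smooth_at_mult:
  assumes Y: "regular_atlas Y" and f: "smooth_at Y \<G> f y" and g: "smooth_at Y \<G> g y"
  shows "smooth_at Y \<G> (\<lambda>z. f z \<otimes>\<^bsub>G\<^esub> g z) y"
  using smooth_at_compose[OF Y regular_prod[OF regular_G regular_G] regular_G
      smooth_at_Pair[OF Y regular_G regular_G f g] smooth_mult] smooth_at_in(2)[OF f] smooth_at_in(2)[OF g]
  by (simp add: points_G)

lemma smooth_at_inv:
  assumes Y: "regular_atlas Y" and f: "smooth_at Y \<G> f y"
  shows "smooth_at Y \<G> (\<lambda>z. inv\<^bsub>G\<^esub> f z) y"
  using smooth_at_compose[OF Y regular_G regular_G f smooth_inv] smooth_at_in(2)[OF f] by (simp add: points_G)

lemma R_in: "p \<in> points P \<Longrightarrow> g \<in> carrier G \<Longrightarrow> R p g \<in> points P"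
  using smooth_at_in(2)[OF smooth_R] by simp

lemma R_one: "p \<in> points P \<Longrightarrow> R p \<one>\<^bsub>G\<^esub> = p"
  using principal by (simp add: principal_bundle_def smooth_right_action_def)

lemma R_mult:
  "p \<in> points P \<Longrightarrow> g \<in> carrier G \<Longrightarrow> h \<in> carrier G \<Longrightarrow> R p (g \<otimes>\<^bsub>G\<^esub> h) = R (R p g) h"
  using principal by (simp add: principal_bundle_def smooth_right_action_def)

lemma pi_eq_iff:
  "p \<in> points P \<Longrightarrow> p' \<in> points P \<Longrightarrow> \<pi> p = \<pi> p' \<longleftrightarrow> (\<exists>g\<in>carrier G. p' = R p g)"
  using principal unfolding principal_bundle_def by blast

lemma pi_R: "p \<in> points P \<Longrightarrow> g \<in> carrier G \<Longrightarrow> \<pi> (R p g) = \<pi> p"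
  using pi_eq_iff[of p "R p g"] R_in by auto

lemma R_free:
  assumes p: "p \<in> points P" and gh: "g \<in> carrier G" "h \<in> carrier G" and eq: "R p g = R p h"
  shows "g = h"
proof -
  have "R p (g \<otimes>\<^bsub>G\<^esub> inv\<^bsub>G\<^esub> h) = p"
    using p gh by (simp add: R_mult eq) (simp flip: R_mult add: R_one)
  then have "g \<otimes>\<^bsub>G\<^esub> inv\<^bsub>G\<^esub> h = \<one>\<^bsub>G\<^esub>"
    using principal p gh unfolding principal_bundle_def by (meson inv_closed m_closed)
  then show ?thesis using gh by (metis inv_equality inv_inv inv_closed)
qed

section \<open>The translation function: the group element between two points of a fibre\<close>

definition "division p p' = (THE g. g \<in> carrier G \<and> p' = R p g)"

lemma division_R: "p \<in> points P \<Longrightarrow> g \<in> carrier G \<Longrightarrow> division p (R p g) = g"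
  unfolding division_def by (rule the_equality) (auto dest: R_free)

lemma division:
  assumes "p \<in> points P" "p' \<in> points P" "\<pi> p = \<pi> p'"
  shows "division p p' \<in> carrier G" "R p (division p p') = p'"
  using assms pi_eq_iff[of p p'] by (auto simp: division_R)

lemma division_self: "p \<in> points P \<Longrightarrow> division p p = \<one>\<^bsub>G\<^esub>"
  using division_R[of p "\<one>\<^bsub>G\<^esub>"] by (simp add: R_one)

section \<open>Local sections and local trivializations\<close>

definition "local_section U \<sigma> \<longleftrightarrow>
  atlas_open Q U \<and> smooth_map (open_submanifold Q U) P \<sigma> \<and> (\<forall>q\<in>U. \<pi> (\<sigma> q) = q)"

lemma local_sectionD:
  assumes "local_section U \<sigma>" "q \<in> U"
  shows "q \<in> points Q" "smooth_at Q P \<sigma> q" "\<sigma> q \<in> points P" "\<pi> (\<sigma> q) = q"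
    "\<forall>\<^sub>F q' in mnhds Q q. q' \<in> U"
proof -
  have U: "atlas_open Q U" using assms by (simp add: local_section_def)
  then show q: "q \<in> points Q" using assms(2) by (auto simp: atlas_open_def)
  show "smooth_at Q P \<sigma> q"
    by (rule smooth_map_open_submanifold_smooth_at[OF regular_Q regular_P
          eventually_atlas_open[OF regular_Q U]]) (use assms q in \<open>auto simp: local_section_def\<close>)
  then show "\<sigma> q \<in> points P" by (rule smooth_at_in)
  show "\<pi> (\<sigma> q) = q" using assms by (simp add: local_section_def)
  show "\<forall>\<^sub>F q' in mnhds Q q. q' \<in> U"
    by (rule eventually_mnhds_open[OF regular_Q U assms(2)])
qed

lemma local_triviality:
  "q \<in> points Q \<Longrightarrow> \<exists>U \<phi>. atlas_open Q U \<and> q \<in> U \<and>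
     diffeo (open_submanifold P (\<pi> -` U)) (open_submanifold Q U \<times>\<^sub>M \<G>) (\<lambda>p. (\<pi> p, \<phi> p)) \<and>
     (\<forall>p\<in>points P. \<pi> p \<in> U \<longrightarrow> (\<forall>g\<in>carrier G. \<phi> (R p g) = \<phi> p \<otimes>\<^bsub>G\<^esub> g))"
  using principal unfolding principal_bundle_def by (elim conjE) (erule bspec)

text \<open>A trivialization (\<pi>, \<phi>) has no reason to satisfy \<phi>(p) = 1. Taking \<sigma>
  at the constant level \<phi>(p) makes the section pass through p, and \<gamma> = \<phi>(p)^(-1)
  \<phi> measures the group element relative to this section. Equivariance of \<phi> yields p' =
  \<sigma>(\<pi> p') \<gamma>(p').\<close>

lemma local_trivialization:
  assumes p: "p \<in> points P"
  obtains U \<sigma> \<gamma> where "local_section U \<sigma>" "\<pi> p \<in> U" "\<sigma> (\<pi> p) = p"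
    "\<And>p'. p' \<in> points P \<Longrightarrow> \<pi> p' \<in> U \<Longrightarrow>
      smooth_at P \<G> \<gamma> p' \<and> \<gamma> p' \<in> carrier G \<and> p' = R (\<sigma> (\<pi> p')) (\<gamma> p')"
proof -
  obtain U \<phi> where U: "atlas_open Q U" "\<pi> p \<in> U"
    and dif: "diffeo (open_submanifold P (\<pi> -` U)) (open_submanifold Q U \<times>\<^sub>M \<G>) (\<lambda>p. (\<pi> p, \<phi> p))"
    and equi: "\<And>p' g. p' \<in> points P \<Longrightarrow> \<pi> p' \<in> U \<Longrightarrow> g \<in> carrier G \<Longrightarrow> \<phi> (R p' g) = \<phi> p' \<otimes>\<^bsub>G\<^esub> g"
    using local_triviality[OF pi_in[OF p]] by metis
  define PU where "PU = open_submanifold P (\<pi> -` U)"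
  define QU where "QU = open_submanifold Q U"
  define \<psi> where "\<psi> = (\<lambda>p. (\<pi> p, \<phi> p))"
  have evU: "\<forall>x\<in>points Q \<inter> U. \<forall>\<^sub>F y in mnhds Q x. y \<in> U"
    by (rule eventually_atlas_open[OF regular_Q U(1)])
  have evPU: "\<forall>x\<in>points P \<inter> \<pi> -` U. \<forall>\<^sub>F y in mnhds P x. y \<in> \<pi> -` U"
    using smooth_at_eventually[OF smooth_pi] evU pi_in by fastforce
  have PU: "regular_atlas PU" and QU: "regular_atlas QU"
    unfolding PU_def QU_def
    by (rule regular_open_submanifold[OF regular_P evPU], rule regular_open_submanifold[OF regular_Q evU])
  have UQ: "U \<subseteq> points Q" using U(1) by (simp add: atlas_open_def)
  have pPU: "points PU = points P \<inter> \<pi> -` U" and pQU: "points QU = U"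
    using UQ by (auto simp: PU_def QU_def points_open_submanifold)
  note QUG = regular_prod[OF QU regular_G]
  have bij: "bij_betw \<psi> (points PU) (U \<times> carrier G)" and sm: "smooth_map PU (QU \<times>\<^sub>M \<G>) \<psi>"
    and sm': "smooth_map (QU \<times>\<^sub>M \<G>) PU (inv_into (points PU) \<psi>)"
    using dif by (simp_all add: diffeo_def PU_def QU_def \<psi>_def points_prod points_G
        pQU[unfolded QU_def])
  define \<sigma> where "\<sigma> = (\<lambda>q. inv_into (points PU) \<psi> (q, \<phi> p))"
  define \<gamma> where "\<gamma> = (\<lambda>p'. inv\<^bsub>G\<^esub> (\<phi> p) \<otimes>\<^bsub>G\<^esub> \<phi> p')"
  have phi: "\<phi> p' \<in> carrier G" if "p' \<in> points P" "\<pi> p' \<in> U" for p'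
    using bij_betw_apply[OF bij, of p'] that by (simp add: pPU \<psi>_def)
  have inj: "p' = p''" if "p' \<in> points P" "\<pi> p' \<in> U" "p'' \<in> points P" "\<psi> p' = \<psi> p''" for p' p''
    using inj_onD[OF bij_betw_imp_inj_on[OF bij] that(4)] that by (auto simp: pPU \<psi>_def)
  have sig: "\<sigma> q \<in> points P" "\<pi> (\<sigma> q) = q" "\<phi> (\<sigma> q) = \<phi> p" if "q \<in> U" for q
  proof -
    have q: "(q, \<phi> p) \<in> \<psi> ` points PU"
      using bij_betw_imp_surj_on[OF bij] that phi[OF p U(2)] by simp
    from inv_into_into[OF q] show "\<sigma> q \<in> points P" by (simp add: \<sigma>_def pPU)
    from f_inv_into_f[OF q] show "\<pi> (\<sigma> q) = q" "\<phi> (\<sigma> q) = \<phi> p"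
      by (auto simp: \<sigma>_def \<psi>_def)
  qed
  have "smooth_at QU P \<sigma> q" if q: "q \<in> points QU" for q
  proof -
    have qU: "q \<in> U" using q pQU by simp
    have pt: "(q, \<phi> p) \<in> points (QU \<times>\<^sub>M \<G>)"
      using q phi[OF p U(2)] by (simp add: points_prod points_G)
    have 1: "smooth_at QU (QU \<times>\<^sub>M \<G>) (\<lambda>q. (q, \<phi> p)) q"
      using pt by (intro smooth_at_Pair QU regular_G smooth_at_ident smooth_at_const)
        (auto simp: points_prod)
    have 2: "smooth_at QU PU \<sigma> q"
      unfolding \<sigma>_def by (rule smooth_at_compose[OF QU QUG PU 1 smooth_map_smooth_at[OF QUG PU sm' pt]])
    have 3: "smooth_at PU P (\<lambda>y. y) (\<sigma> q)"
      unfolding PU_def by (rule smooth_at_open_submanifold(1)[OF regular_P evPU]) (simp_all add: sig[OF qU] qU)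
    show ?thesis by (rule smooth_at_compose[OF QU PU regular_P 2 3])
  qed
  then have "smooth_map QU P \<sigma>" by (rule smooth_mapI[OF QU regular_P])
  then have "local_section U \<sigma>"
    using U(1) sig by (simp add: local_section_def QU_def)
  moreover have "\<sigma> (\<pi> p) = p"
    by (rule inj) (use sig[OF U(2)] p U(2) in \<open>auto simp: \<psi>_def\<close>)
  moreover have "smooth_at P \<G> \<gamma> p' \<and> \<gamma> p' \<in> carrier G \<and> p' = R (\<sigma> (\<pi> p')) (\<gamma> p')"
    if p': "p' \<in> points P" "\<pi> p' \<in> U" for p'
  proof (intro conjI)
    have "smooth_at P PU (\<lambda>y. y) p'"
      unfolding PU_def by (rule smooth_at_open_submanifold(2)[OF regular_P evPU]) (use p' in auto)
    from smooth_at_compose[OF regular_P PU QUG this smooth_map_smooth_at[OF PU QUG sm]]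
    have psi: "smooth_at P (QU \<times>\<^sub>M \<G>) \<psi> p'"
      using p' by (simp add: pPU)
    have "smooth_at P \<G> \<phi> p'"
      using smooth_at_compose[OF regular_P QUG regular_G psi smooth_at_snd[OF QU regular_G smooth_at_in(2)[OF psi]]]
      by (simp add: \<psi>_def)
    then show "smooth_at P \<G> \<gamma> p'"
      unfolding \<gamma>_def
      by (intro smooth_at_mult[OF regular_P] smooth_at_const[OF regular_G p'(1)])
        (simp_all add: points_G phi[OF p U(2)])
    show g: "\<gamma> p' \<in> carrier G"
      unfolding \<gamma>_def using phi[OF p'] phi[OF p U(2)] by simp
    have "\<phi> p \<otimes>\<^bsub>G\<^esub> \<gamma> p' = \<phi> p'"
      unfolding \<gamma>_def using phi[OF p'] phi[OF p U(2)] by (simp flip: m_assoc)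
    \<comment> \<open>The trivialization is injective over U, so it suffices to compare base points
      and values of \<phi>.\<close>
    then show "p' = R (\<sigma> (\<pi> p')) (\<gamma> p')"
      by (intro inj p' R_in sig g) (simp add: \<psi>_def pi_R sig p'(2) g equi)
  qed
  ultimately show ?thesis using that U(2) by blast
qed

text \<open>Relative to one common section, f = \<sigma> \<gamma>(f) and g = \<sigma> \<gamma>(g),
  so the element between them is \<gamma>(f)^(-1) \<gamma>(g). The definite description thereby
  becomes an expression in smooth group operations.\<close>

lemma smooth_at_division:
  assumes Y: "regular_atlas Y" and f: "smooth_at Y P f y" and g: "smooth_at Y P g y"
    and ev: "\<forall>\<^sub>F z in mnhds Y y. \<pi> (f z) = \<pi> (g z)"
  shows "smooth_at Y \<G> (\<lambda>z. division (f z) (g z)) y"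
proof -
  note fy = smooth_at_in(2)[OF f] and gy = smooth_at_in(2)[OF g]
  have eq: "\<pi> (f y) = \<pi> (g y)" by (rule eventually_mnhds_self[OF Y smooth_at_in(1)[OF f] ev])
  obtain U \<sigma> \<gamma> where U: "local_section U \<sigma>" "\<pi> (f y) \<in> U"
    and gam: "\<And>p'. p' \<in> points P \<Longrightarrow> \<pi> p' \<in> U \<Longrightarrow>
      smooth_at P \<G> \<gamma> p' \<and> \<gamma> p' \<in> carrier G \<and> p' = R (\<sigma> (\<pi> p')) (\<gamma> p')"
    using local_trivialization[OF fy] by metis
  have "smooth_at Y \<G> (\<lambda>z. inv\<^bsub>G\<^esub> (\<gamma> (f z)) \<otimes>\<^bsub>G\<^esub> \<gamma> (g z)) y"
    using gam[OF fy U(2)] gam[OF gy] U(2) eq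
    by (intro smooth_at_mult smooth_at_inv smooth_at_compose[OF Y regular_P regular_G f]
        smooth_at_compose[OF Y regular_P regular_G g] Y) simp_all
  moreover have "\<forall>\<^sub>F z in mnhds Y y. inv\<^bsub>G\<^esub> (\<gamma> (f z)) \<otimes>\<^bsub>G\<^esub> \<gamma> (g z) = division (f z) (g z)"
    using ev smooth_at_eventually[OF f eventually_points[OF regular_P fy]]
      smooth_at_eventually[OF g eventually_points[OF regular_P gy]]
      smooth_at_eventually[OF smooth_at_compose[OF Y regular_P regular_Q f smooth_pi[OF fy]]
        local_sectionD(5)[OF U]]
  proof eventually_elim
    case (elim z)
    have 1: "\<gamma> (f z) \<in> carrier G" "f z = R (\<sigma> (\<pi> (f z))) (\<gamma> (f z))"
      "\<gamma> (g z) \<in> carrier G" "g z = R (\<sigma> (\<pi> (f z))) (\<gamma> (g z))"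
      using gam[OF elim(2,4)] gam[OF elim(3)] elim by auto
    note s = local_sectionD(3)[OF U(1) elim(4)]
    have "R (f z) (inv\<^bsub>G\<^esub> (\<gamma> (f z)) \<otimes>\<^bsub>G\<^esub> \<gamma> (g z)) =
        R (R (\<sigma> (\<pi> (f z))) (\<gamma> (f z))) (inv\<^bsub>G\<^esub> (\<gamma> (f z)) \<otimes>\<^bsub>G\<^esub> \<gamma> (g z))"
      using 1(2) by simp
    also have "\<dots> = R (\<sigma> (\<pi> (f z))) (\<gamma> (f z) \<otimes>\<^bsub>G\<^esub> (inv\<^bsub>G\<^esub> (\<gamma> (f z)) \<otimes>\<^bsub>G\<^esub> \<gamma> (g z)))"
      using 1 s by (intro R_mult[symmetric]) auto
    also have "\<dots> = g z"
      using 1 by (simp flip: m_assoc)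
    finally have *: "g z = R (f z) (inv\<^bsub>G\<^esub> (\<gamma> (f z)) \<otimes>\<^bsub>G\<^esub> \<gamma> (g z))" by simp
    have "division (f z) (R (f z) (inv\<^bsub>G\<^esub> (\<gamma> (f z)) \<otimes>\<^bsub>G\<^esub> \<gamma> (g z))) = inv\<^bsub>G\<^esub> (\<gamma> (f z)) \<otimes>\<^bsub>G\<^esub> \<gamma> (g z)"
      by (rule division_R) (use 1 elim in auto)
    then show ?case using * by simp
  qed
  ultimately show ?thesis by (rule smooth_at_cong[OF Y])
qed

end

section \<open>Associated bundles\<close>

locale associated_bundle_data = principal_bundle_data G \<G> P Q R \<pi>
  for G :: "('g, 'x) monoid_scheme"
    and \<G> :: "('g, 'eg::real_inner) atlas"
    and P :: "('p, 'ep::real_inner) atlas"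
    and Q :: "('q, 'eq::real_inner) atlas"
    and R :: "'p \<Rightarrow> 'g \<Rightarrow> 'p"
    and \<pi> :: "'p \<Rightarrow> 'q" +
  fixes W :: "('w, 'ew::real_inner) atlas"
    and \<Phi> :: "'g \<Rightarrow> 'w \<Rightarrow> 'w"
  assumes manifold_W: "manifold W" and action: "smooth_left_action G \<G> W \<Phi>"
begin

abbreviation M :: "(('p \<times> 'w) set, 'eq \<times> 'ew) atlas" where
  "M \<equiv> assoc_bundle G P Q W R \<Phi> \<pi>"

abbreviation \<kappa> :: "'p \<Rightarrow> 'w \<Rightarrow> ('p \<times> 'w) set" where
  "\<kappa> \<equiv> assoc_class G P W R \<Phi>"

abbreviation \<rho> :: "('p \<times> 'w) set \<Rightarrow> 'q" where
  "\<rho> \<equiv> assoc_proj \<pi>"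

lemma regular_W: "regular_atlas W"
  by (rule manifold_regular_atlas[OF manifold_W])

lemma smooth_Phi:
  assumes "g \<in> carrier G" "w \<in> points W"
  shows "smooth_at (\<G> \<times>\<^sub>M W) W (\<lambda>z. \<Phi> (fst z) (snd z)) (g, w)"
proof -
  have "smooth_map (\<G> \<times>\<^sub>M W) W (\<lambda>z. \<Phi> (fst z) (snd z))"
    using action by (simp add: smooth_left_action_def case_prod_beta')
  then show ?thesis
    using smooth_map_smooth_at[OF regular_prod[OF regular_G regular_W] regular_W] assms
    by (simp add: points_prod points_G)
qed

lemma smooth_at_Phi:
  assumes Y: "regular_atlas Y" and f: "smooth_at Y \<G> f y" and g: "smooth_at Y W g y"
  shows "smooth_at Y W (\<lambda>z. \<Phi> (f z) (g z)) y"
  using smooth_at_compose[OF Y regular_prod[OF regular_G regular_W] regular_W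
      smooth_at_Pair[OF Y regular_G regular_W f g] smooth_Phi] smooth_at_in(2)[OF f] smooth_at_in(2)[OF g]
  by (simp add: points_G)

lemma Phi_in: "g \<in> carrier G \<Longrightarrow> w \<in> points W \<Longrightarrow> \<Phi> g w \<in> points W"
  using smooth_at_in(2)[OF smooth_Phi] by simp

lemma Phi_one: "w \<in> points W \<Longrightarrow> \<Phi> \<one>\<^bsub>G\<^esub> w = w"
  using action by (simp add: smooth_left_action_def)

lemma Phi_mult:
  "w \<in> points W \<Longrightarrow> g \<in> carrier G \<Longrightarrow> h \<in> carrier G \<Longrightarrow> \<Phi> (g \<otimes>\<^bsub>G\<^esub> h) w = \<Phi> g (\<Phi> h w)"
  using action by (simp add: smooth_left_action_def)

section \<open>Equivalence classes and their representatives\<close>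

lemma in_kappa_iff:
  assumes "w \<in> points W"
  shows "(p', w') \<in> \<kappa> p w \<longleftrightarrow> p' \<in> points P \<and> (\<exists>g\<in>carrier G. p = R p' g \<and> w' = \<Phi> g w)"
  using assms by (auto simp: assoc_class_def assoc_rel_def)

lemma kappa_refl: "p \<in> points P \<Longrightarrow> w \<in> points W \<Longrightarrow> (p, w) \<in> \<kappa> p w"
  by (auto simp: in_kappa_iff R_one Phi_one intro!: bexI[of _ "\<one>\<^bsub>G\<^esub>"])

text \<open>Replacing the group element h by h g^(-1), or by h g, matches the representatives of one
  class with those of the other. It also shows that the image of a pair under
  \<open>assoc_rel\<close> is already its whole equivalence class.\<close>

lemma kappa_R:
  assumes p: "p \<in> points P" and g: "g \<in> carrier G" and w: "w \<in> points W"
  shows "\<kappa> (R p g) w = \<kappa> p (\<Phi> g w)"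
proof -
  note gw = Phi_in[OF g w]
  have "(\<exists>h\<in>carrier G. R p g = R p' h \<and> w' = \<Phi> h w) \<longleftrightarrow>
      (\<exists>h\<in>carrier G. p = R p' h \<and> w' = \<Phi> h (\<Phi> g w))" if p': "p' \<in> points P" for p' w'
  proof
    assume "\<exists>h\<in>carrier G. R p g = R p' h \<and> w' = \<Phi> h w"
    then obtain h where h: "h \<in> carrier G" "R p g = R p' h" "w' = \<Phi> h w" by blast
    have "p = R (R p g) (inv\<^bsub>G\<^esub> g)"
      using p g by (simp flip: R_mult add: R_one)
    also have "\<dots> = R p' (h \<otimes>\<^bsub>G\<^esub> inv\<^bsub>G\<^esub> g)"
      using p' g h by (simp add: R_mult)
    finally have "p = R p' (h \<otimes>\<^bsub>G\<^esub> inv\<^bsub>G\<^esub> g)" .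
    moreover have "w' = \<Phi> (h \<otimes>\<^bsub>G\<^esub> inv\<^bsub>G\<^esub> g) (\<Phi> g w)"
      using w g h by (simp flip: Phi_mult add: m_assoc)
    ultimately show "\<exists>h\<in>carrier G. p = R p' h \<and> w' = \<Phi> h (\<Phi> g w)"
      using h g by blast
  next
    assume "\<exists>h\<in>carrier G. p = R p' h \<and> w' = \<Phi> h (\<Phi> g w)"
    then obtain h where h: "h \<in> carrier G" "p = R p' h" "w' = \<Phi> h (\<Phi> g w)" by blast
    then show "\<exists>h\<in>carrier G. R p g = R p' h \<and> w' = \<Phi> h w"
      using g w p' by (intro bexI[of _ "h \<otimes>\<^bsub>G\<^esub> g"]) (simp_all add: R_mult Phi_mult)
  qed
  then have "(p', w') \<in> \<kappa> (R p g) w \<longleftrightarrow> (p', w') \<in> \<kappa> p (\<Phi> g w)" for p' w'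
    by (auto simp: in_kappa_iff[OF w] in_kappa_iff[OF gw])
  then show ?thesis by auto
qed

text \<open>Since (p', w') represents its own class, it is a representative of the class of (p, w),
  which yields a group element; freeness of the action identifies it with the inverse of
  \<open>division p p'\<close>.\<close>

lemma kappa_eqD:
  assumes p: "p \<in> points P" "p' \<in> points P" and w: "w \<in> points W" "w' \<in> points W"
    and eq: "\<kappa> p w = \<kappa> p' w'"
  shows "\<pi> p = \<pi> p'" "w = \<Phi> (division p p') w'"
proof -
  have "(p', w') \<in> \<kappa> p w" using kappa_refl[OF p(2) w(2)] eq by simp
  then obtain g where g: "g \<in> carrier G" "p = R p' g" "w' = \<Phi> g w"
    using in_kappa_iff[OF w(1)] by blast
  have "R p (inv\<^bsub>G\<^esub> g) = p'"
    using p g by (simp flip: R_mult add: R_one)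
  then have "division p p' = inv\<^bsub>G\<^esub> g"
    using division_R[OF p(1), of "inv\<^bsub>G\<^esub> g"] g by simp
  then show "w = \<Phi> (division p p') w'"
    using g w by (simp flip: Phi_mult add: Phi_one)
  show "\<pi> p = \<pi> p'" using g p by (simp add: pi_R)
qed

lemma kappa_inj:
  "p \<in> points P \<Longrightarrow> w \<in> points W \<Longrightarrow> w' \<in> points W \<Longrightarrow> \<kappa> p w = \<kappa> p w' \<Longrightarrow> w = w'"
  using kappa_eqD(2)[of p p w w'] by (simp add: division_self Phi_one)

lemma rho_kappa:
  assumes "p \<in> points P" "w \<in> points W" shows "\<rho> (\<kappa> p w) = \<pi> p"
  unfolding assoc_proj_def
proof (rule the_equality)
  show "\<forall>(p', w')\<in>\<kappa> p w. \<pi> p' = \<pi> p"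
    using assms by (auto simp: in_kappa_iff pi_R)
  show "q = \<pi> p" if "\<forall>(p', w')\<in>\<kappa> p w. \<pi> p' = q" for q
    using bspec[OF that kappa_refl[OF assms]] by simp
qed

text \<open>The change of frame within a fibre; it produces the transition functions of the
  associated bundle.\<close>

lemma kappa_division:
  assumes "p \<in> points P" "p' \<in> points P" "\<pi> p = \<pi> p'" "w \<in> points W"
  shows "\<kappa> p' w = \<kappa> p (\<Phi> (division p p') w)"
  using kappa_R[OF assms(1) division(1)[OF assms(1-3)] assms(4)] division(2)[OF assms(1-3)] by simp

section \<open>Bundle charts and the smooth structure of the total space\<close>

definition bundle_chart ::
  "'q set \<Rightarrow> ('q \<Rightarrow> 'p) \<Rightarrow> ('q, 'eq) chart \<Rightarrow> ('w, 'ew) chart \<Rightarrow> (('p \<times> 'w) set, 'eq \<times> 'ew) chart" where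
  "bundle_chart U \<sigma> c d =
    (let D = (U \<inter> cdom c) \<times> cdom d; t = (\<lambda>(q, w). \<kappa> (\<sigma> q) w)
      in Chart (t ` D) (map_prod (cmap c) (cmap d) \<circ> inv_into D t))"

lemma assoc_bundle_charts:
  "M = {bundle_chart U \<sigma> c d | U \<sigma> c d. local_section U \<sigma> \<and> c \<in> Q \<and> d \<in> W}"
  unfolding assoc_bundle_def bundle_chart_def local_section_def by blast

lemma bundle_chart_in:
  "local_section U \<sigma> \<Longrightarrow> c \<in> Q \<Longrightarrow> d \<in> W \<Longrightarrow> bundle_chart U \<sigma> c d \<in> M"
  by (auto simp: assoc_bundle_charts)

lemma cdom_bundle_chart:
  "cdom (bundle_chart U \<sigma> c d) = (\<lambda>(q, w). \<kappa> (\<sigma> q) w) ` ((U \<inter> cdom c) \<times> cdom d)"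
  by (simp add: bundle_chart_def Let_def)

lemma cdom_bundle_chartI:
  "q \<in> U \<Longrightarrow> q \<in> cdom c \<Longrightarrow> w \<in> cdom d \<Longrightarrow> \<kappa> (\<sigma> q) w \<in> cdom (bundle_chart U \<sigma> c d)"
  by (auto simp: cdom_bundle_chart)

lemma section_kappa_inj:
  assumes \<sigma>: "local_section U \<sigma>" and q: "q \<in> U" "q' \<in> U" and w: "w \<in> points W" "w' \<in> points W"
    and eq: "\<kappa> (\<sigma> q) w = \<kappa> (\<sigma> q') w'"
  shows "q = q'" "w = w'"
proof -
  note s = local_sectionD[OF \<sigma> q(1)] and s' = local_sectionD[OF \<sigma> q(2)]
  show qq: "q = q'" using kappa_eqD(1)[OF s(3) s'(3) w eq] s(4) s'(4) by simp
  show "w = w'" using kappa_inj[OF s(3) w] eq qq by simp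
qed

lemma cmap_bundle_chart:
  assumes \<sigma>: "local_section U \<sigma>" and cd: "d \<in> W" and q: "q \<in> U" "q \<in> cdom c" and w: "w \<in> cdom d"
  shows "cmap (bundle_chart U \<sigma> c d) (\<kappa> (\<sigma> q) w) = (cmap c q, cmap d w)"
proof -
  have inj: "inj_on (\<lambda>(q, w). \<kappa> (\<sigma> q) w) ((U \<inter> cdom c) \<times> cdom d)"
    using section_kappa_inj[OF \<sigma>] chart_in_points[OF cd] unfolding inj_on_def by (clarsimp, metis)
  show ?thesis
    using inv_into_f_f[OF inj, of "(q, w)"] q w by (simp add: bundle_chart_def Let_def)
qed

text \<open>Since [\<sigma> q, w] = [\<sigma>' q, \<delta>(q) w] with \<delta>(q) the group element
  from \<sigma>' q to \<sigma> q, this map is the passage between two trivializations of M. Its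
  smoothness rests on that of \<open>division\<close>.\<close>

lemma smooth_at_transition:
  assumes \<sigma>: "local_section U \<sigma>" and \<sigma>': "local_section U' \<sigma>'" and q: "q \<in> U" "q \<in> U'" and w: "w \<in> points W"
  shows "smooth_at (Q \<times>\<^sub>M W) (Q \<times>\<^sub>M W) (\<lambda>z. (fst z, \<Phi> (division (\<sigma>' (fst z)) (\<sigma> (fst z))) (snd z))) (q, w)"
proof -
  note QW = regular_prod[OF regular_Q regular_W]
  have pt: "(q, w) \<in> points (Q \<times>\<^sub>M W)"
    using local_sectionD(1)[OF \<sigma> q(1)] w by (simp add: points_prod)
  note f = smooth_at_fst[OF regular_Q regular_W pt] and s = smooth_at_snd[OF regular_Q regular_W pt]
  have "\<forall>\<^sub>F z in mnhds (Q \<times>\<^sub>M W) (q, w). fst z \<in> U" "\<forall>\<^sub>F z in mnhds (Q \<times>\<^sub>M W) (q, w). fst z \<in> U'"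
    using smooth_at_eventually[OF f] local_sectionD(5)[OF \<sigma> q(1)] local_sectionD(5)[OF \<sigma>' q(2)] by simp_all
  then have "\<forall>\<^sub>F z in mnhds (Q \<times>\<^sub>M W) (q, w). \<pi> (\<sigma>' (fst z)) = \<pi> (\<sigma> (fst z))"
    by eventually_elim (simp add: local_sectionD(4)[OF \<sigma>] local_sectionD(4)[OF \<sigma>'])
  moreover have "smooth_at Q P \<sigma> (fst (q, w))" "smooth_at Q P \<sigma>' (fst (q, w))"
    using local_sectionD(2)[OF \<sigma> q(1)] local_sectionD(2)[OF \<sigma>' q(2)] by simp_all
  ultimately show ?thesis
    by (intro smooth_at_Pair[OF QW regular_Q regular_W] f smooth_at_Phi[OF QW] smooth_at_division[OF QW]
        s smooth_at_compose[OF QW regular_Q regular_P f])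
qed

text \<open>A bundle chart is a product chart of Q \<times> W seen through a section. Overlaps can
  therefore be transported to subsets of Q \<times> W, where openness and smoothness follow from the
  change of trivialization T.\<close>

lemma regular_M: "regular_atlas M"
  unfolding regular_atlas_def
proof
  show "fin_dim TYPE('eq \<times> 'ew)"
    by (intro fin_dim_prod regular_atlas_fin[OF regular_Q] regular_atlas_fin[OF regular_W])
  note QW = regular_prod[OF regular_Q regular_W]
  show "smooth_atlas M"
    unfolding smooth_atlas_def
  proof (intro conjI ballI)
    fix C assume "C \<in> M"
    then obtain U \<sigma> c d where C: "C = bundle_chart U \<sigma> c d" and \<sigma>: "local_section U \<sigma>"
      and c: "c \<in> Q" and d: "d \<in> W"
      by (auto simp: assoc_bundle_charts)
    note cmC = cmap_bundle_chart[OF \<sigma> d]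
    have inj: "inj_on (cmap c) (cdom c)" "inj_on (cmap d) (cdom d)"
      using regular_Q regular_W c d by (auto simp: regular_atlas_def smooth_atlas_def)
    show injC: "inj_on (cmap C) (cdom C)"
    proof (rule inj_onI)
      fix m m' assume m: "m \<in> cdom C" "m' \<in> cdom C" "cmap C m = cmap C m'"
      then obtain q w q' w' where *: "q \<in> U" "q \<in> cdom c" "w \<in> cdom d" "m = \<kappa> (\<sigma> q) w"
        "q' \<in> U" "q' \<in> cdom c" "w' \<in> cdom d" "m' = \<kappa> (\<sigma> q') w'"
        by (auto simp: C cdom_bundle_chart)
      with m(3) have "cmap c q = cmap c q'" "cmap d w = cmap d w'" by (simp_all add: C cmC)
      with * show "m = m'" using inj_onD[OF inj(1)] inj_onD[OF inj(2)] by metis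
    qed
    fix C' assume "C' \<in> M"
    then obtain U' \<sigma>' c' d' where C': "C' = bundle_chart U' \<sigma>' c' d'" and \<sigma>': "local_section U' \<sigma>'"
      and c': "c' \<in> Q" and d': "d' \<in> W"
      by (auto simp: assoc_bundle_charts)
    define T where "T = (\<lambda>z. (fst z, \<Phi> (division (\<sigma>' (fst z)) (\<sigma> (fst z))) (snd z)))"
    \<comment> \<open>The part of Q \<times> W that corresponds to the overlap: both sections are
      defined there and the transported point lies in the second pair of charts.\<close>
    define E where "E = {(q, w). q \<in> U \<and> q \<in> cdom c \<and> w \<in> cdom d \<and> q \<in> U' \<and> q \<in> cdom c' \<and>
      snd (T (q, w)) \<in> cdom d'}"
    have T: "smooth_at (Q \<times>\<^sub>M W) (Q \<times>\<^sub>M W) T (q, w)" if "q \<in> U" "q \<in> U'" "w \<in> cdom d" for q w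
      unfolding T_def by (rule smooth_at_transition[OF \<sigma> \<sigma>' that(1,2) chart_in_points[OF d that(3)]])
    have kT: "\<kappa> (\<sigma> q) w = \<kappa> (\<sigma>' q) (snd (T (q, w)))" if "q \<in> U" "q \<in> U'" "w \<in> points W" for q w
      using kappa_division[OF local_sectionD(3)[OF \<sigma>' that(2)] local_sectionD(3)[OF \<sigma> that(1)] _ that(3)]
        local_sectionD(4)[OF \<sigma>' that(2)] local_sectionD(4)[OF \<sigma> that(1)] by (simp add: T_def)
    have dom: "cdom C \<inter> cdom C' = (\<lambda>(q, w). \<kappa> (\<sigma> q) w) ` E"
    proof (intro equalityI subsetI)
      fix m assume m: "m \<in> cdom C \<inter> cdom C'"
      then obtain q w where qw: "q \<in> U" "q \<in> cdom c" "w \<in> cdom d" "m = \<kappa> (\<sigma> q) w"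
        by (auto simp: C cdom_bundle_chart)
      from m obtain q' w' where qw': "q' \<in> U'" "q' \<in> cdom c'" "w' \<in> cdom d'" "m = \<kappa> (\<sigma>' q') w'"
        by (auto simp: C' cdom_bundle_chart)
      note w = chart_in_points[OF d qw(3)] chart_in_points[OF d' qw'(3)]
      have "q = q'"
        using kappa_eqD(1)[OF local_sectionD(3)[OF \<sigma> qw(1)] local_sectionD(3)[OF \<sigma>' qw'(1)] w] qw qw'
          local_sectionD(4)[OF \<sigma> qw(1)] local_sectionD(4)[OF \<sigma>' qw'(1)] by simp
      with qw qw' have q: "q \<in> U'" "q \<in> cdom c'" by auto
      have "smooth_at (Q \<times>\<^sub>M W) (Q \<times>\<^sub>M W) T (q, w)" by (rule T[OF qw(1) q(1) qw(3)])
      then have "snd (T (q, w)) \<in> points W"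
        using smooth_at_in(2) by (fastforce simp: points_prod T_def)
      then have "snd (T (q, w)) = w'"
        using kappa_inj[OF local_sectionD(3)[OF \<sigma>' q(1)] _ w(2)] kT[OF qw(1) q(1) w(1)] qw(4) qw'(4) \<open>q = q'\<close>
        by simp
      then have "(q, w) \<in> E" using qw q qw' by (simp add: E_def)
      then show "m \<in> (\<lambda>(q, w). \<kappa> (\<sigma> q) w) ` E" using qw(4) by force
    next
      fix m assume "m \<in> (\<lambda>(q, w). \<kappa> (\<sigma> q) w) ` E"
      then obtain q w where qw: "(q, w) \<in> E" "m = \<kappa> (\<sigma> q) w" by auto
      then have "m = \<kappa> (\<sigma>' q) (snd (T (q, w)))"
        using kT chart_in_points[OF d] by (auto simp: E_def)
      with qw show "m \<in> cdom C \<inter> cdom C'"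
        using cdom_bundle_chartI[of q U c w d \<sigma>] cdom_bundle_chartI[of q U' c' "snd (T (q, w))" d' \<sigma>']
        by (auto simp: E_def C C')
    qed
    let ?C = "prod_chart c d" and ?C' = "prod_chart c' d'"
    have pc: "?C \<in> Q \<times>\<^sub>M W" "?C' \<in> Q \<times>\<^sub>M W" using c d c' d' by (simp_all add: prod_chart_in)
    \<comment> \<open>In the coordinates of C the overlap is a product-chart image, so openness is
      decided in Q \<times> W without inverting a bundle chart.\<close>
    have img: "cmap C ` (cdom C \<inter> cdom C') = cmap ?C ` (cdom ?C \<inter> E)"
      unfolding dom image_image
      by (rule image_cong) (auto simp: E_def C cmC)
    show op: "open (cmap C ` (cdom C \<inter> cdom C'))"
      unfolding img
    proof (rule open_chart_imageI[OF QW pc(1)])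
      fix z assume z: "z \<in> cdom ?C \<inter> E"
      obtain q w where qw: "z = (q, w)" by (cases z)
      have q: "q \<in> U" "q \<in> U'" "q \<in> cdom c" "q \<in> cdom c'" "w \<in> cdom d" "snd (T (q, w)) \<in> cdom d'"
        using z by (auto simp: qw E_def)
      have pt: "(q, w) \<in> points (Q \<times>\<^sub>M W)"
        using chart_in_points[OF c q(3)] chart_in_points[OF d q(5)] by (simp add: points_prod)
      note f = smooth_at_eventually[OF smooth_at_fst[OF regular_Q regular_W pt]]
      note s = smooth_at_eventually[OF smooth_at_snd[OF regular_Q regular_W pt]]
      note T' = smooth_at_compose[OF QW QW regular_W T[OF q(1,2,5)]
          smooth_at_snd[OF regular_Q regular_W smooth_at_in(2)[OF T[OF q(1,2,5)]]]]
      show "\<forall>\<^sub>F y in mnhds (Q \<times>\<^sub>M W) z. y \<in> E"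
        unfolding qw
        using f[of "\<lambda>q. q \<in> U"] f[of "\<lambda>q. q \<in> U'"] f[of "\<lambda>q. q \<in> cdom c"] f[of "\<lambda>q. q \<in> cdom c'"]
          s[of "\<lambda>w. w \<in> cdom d"] smooth_at_eventually[OF T' eventually_cdom[OF regular_W d' q(6)]]
          local_sectionD(5)[OF \<sigma> q(1)] local_sectionD(5)[OF \<sigma>' q(2)]
          eventually_cdom[OF regular_Q c q(3)] eventually_cdom[OF regular_Q c' q(4)]
          eventually_cdom[OF regular_W d q(5)]
        by (simp add: E_def case_prod_beta eventually_conj_iff)
    qed
    have "smooth_on (cmap C ` (cdom C \<inter> cdom C')) (\<lambda>a. cmap ?C' (T (cinv ?C a)))"
      unfolding img
    proof (rule smooth_on_if_smooth_near)
      fix a assume "a \<in> cmap ?C ` (cdom ?C \<inter> E)"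
      then obtain q w where a: "a = cmap ?C (q, w)" "(q, w) \<in> E" "(q, w) \<in> cdom ?C" by auto
      have "T (q, w) \<in> cdom ?C'" using a(2) by (auto simp: E_def T_def)
      from smooth_fun_atD[OF smooth_at_cmap[OF T pc(2) this] pc(1) a(3)] a
      show "smooth_near (\<lambda>a. cmap ?C' (T (cinv ?C a))) a" by (auto simp: E_def)
    qed
    then show "smooth_on (cmap C ` (cdom C \<inter> cdom C')) (cmap C' \<circ> cinv C)"
    proof (rule smooth_on_cong[OF _ op])
      fix a assume "a \<in> cmap C ` (cdom C \<inter> cdom C')"
      then obtain q w where a: "a = cmap C (\<kappa> (\<sigma> q) w)" "(q, w) \<in> E"
        unfolding dom by auto
      then have q: "q \<in> U" "q \<in> U'" "q \<in> cdom c" "q \<in> cdom c'" "w \<in> cdom d" "snd (T (q, w)) \<in> cdom d'"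
        by (auto simp: E_def)
      have "cinv C a = \<kappa> (\<sigma> q) w"
        using inv_into_f_f[OF injC] a(1) q cdom_bundle_chartI[of q U c w d \<sigma>] by (simp add: C)
      moreover have "cinv ?C a = (q, w)"
        using cinv_cmap[OF QW pc(1), of "(q, w)"] q by (simp add: a(1) C cmC)
      ultimately show "cmap ?C' (T (cinv ?C a)) = (cmap C' \<circ> cinv C) a"
        using kT[OF q(1,2) chart_in_points[OF d q(5)]] cmap_bundle_chart[OF \<sigma>' d' q(2,4,6)]
        by (simp add: C') (simp add: T_def)
    qed
  qed
qed

section \<open>Points of the total space and smoothness of the quotient map\<close>

lemma section_points: "local_section U \<sigma> \<Longrightarrow> q \<in> U \<Longrightarrow> w \<in> points W \<Longrightarrow> \<exists>C\<in>M. \<kappa> (\<sigma> q) w \<in> cdom C"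
  using local_sectionD(1) bundle_chart_in cdom_bundle_chartI by (metis points_chart)

lemma points_M: "points M = {\<kappa> p w | p w. p \<in> points P \<and> w \<in> points W}"
proof (intro equalityI subsetI)
  fix m assume "m \<in> points M"
  then obtain U \<sigma> c d where "m \<in> cdom (bundle_chart U \<sigma> c d)" "local_section U \<sigma>" "d \<in> W"
    by (auto simp: points_chart assoc_bundle_charts)
  then show "m \<in> {\<kappa> p w | p w. p \<in> points P \<and> w \<in> points W}"
    using local_sectionD(3) chart_in_points by (fastforce simp: cdom_bundle_chart)
next
  fix m assume "m \<in> {\<kappa> p w | p w. p \<in> points P \<and> w \<in> points W}"
  then obtain p w where pw: "p \<in> points P" "w \<in> points W" "m = \<kappa> p w" by blast
  obtain U \<sigma> where "local_section U \<sigma>" "\<pi> p \<in> U" "\<sigma> (\<pi> p) = p"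
    using local_trivialization[OF pw(1)] by metis
  then show "m \<in> points M"
    using section_points[of U \<sigma> "\<pi> p" w] pw by (simp add: points_chart)
qed

lemma kappa_in: "p \<in> points P \<Longrightarrow> w \<in> points W \<Longrightarrow> \<kappa> p w \<in> points M"
  by (auto simp: points_M)

lemma eventually_cinv_bundle_chart:
  assumes \<sigma>: "local_section U \<sigma>" and c: "c \<in> Q" and d: "d \<in> W"
    and q: "q \<in> U" "q \<in> cdom c" and w: "w \<in> cdom d"
  shows "\<forall>\<^sub>F a in nhds (cmap c q, cmap d w).
    cinv c (fst a) \<in> U \<inter> cdom c \<and> cinv d (snd a) \<in> cdom d \<and>
    cmap c (cinv c (fst a)) = fst a \<and> cmap d (cinv d (snd a)) = snd a \<and>
    cinv (bundle_chart U \<sigma> c d) a = \<kappa> (\<sigma> (cinv c (fst a))) (cinv d (snd a))"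
proof -
  let ?z = "(cmap c q, cmap d w)"
  have "\<forall>\<^sub>F a in nhds (cmap c q). a \<in> cimg c \<and> cinv c a \<in> U"
    using local_sectionD(5)[OF \<sigma> q(1)] eventually_cimg[OF regular_Q c q(2)]
    by (simp add: eventually_mnhds_chart[OF regular_Q c q(2)] eventually_conj)
  moreover have "filterlim fst (nhds (cmap c q)) (nhds ?z)"
    using tendsto_fst[OF filterlim_ident[of "nhds ?z"]] by simp
  ultimately have 1: "\<forall>\<^sub>F a in nhds ?z. fst a \<in> cimg c \<and> cinv c (fst a) \<in> U"
    by (rule eventually_compose_filterlim)
  have "filterlim snd (nhds (cmap d w)) (nhds ?z)"
    using tendsto_snd[OF filterlim_ident[of "nhds ?z"]] by simp
  from eventually_compose_filterlim[OF eventually_cimg[OF regular_W d w] this]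
  have 2: "\<forall>\<^sub>F a in nhds ?z. snd a \<in> cimg d" .
  from 1 2 show ?thesis
  proof eventually_elim
    case (elim a)
    then have *: "cinv c (fst a) \<in> U" "cinv c (fst a) \<in> cdom c" "cinv d (snd a) \<in> cdom d"
      "cmap c (cinv c (fst a)) = fst a" "cmap d (cinv d (snd a)) = snd a"
      using cinv_in[of "fst a" c] cinv_in[of "snd a" d] cmap_cinv[of "fst a" c] cmap_cinv[of "snd a" d] by auto
    have "a = cmap (bundle_chart U \<sigma> c d) (\<kappa> (\<sigma> (cinv c (fst a))) (cinv d (snd a)))"
      using cmap_bundle_chart[OF \<sigma> d *(1,2,3)] * by simp
    then have "cinv (bundle_chart U \<sigma> c d) a = \<kappa> (\<sigma> (cinv c (fst a))) (cinv d (snd a))"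
      using cinv_cmap[OF regular_M bundle_chart_in[OF \<sigma> c d] cdom_bundle_chartI[OF *(1,2,3)]] by metis
    with * show ?case by simp
  qed
qed

text \<open>The bundle chart of \<sigma> inverts exactly this map, so in suitable charts its
  coordinate expression is the identity.\<close>

lemma smooth_section_kappa:
  assumes \<sigma>: "local_section U \<sigma>" and q: "q \<in> U" and w: "w \<in> points W"
  shows "smooth_at (Q \<times>\<^sub>M W) M (\<lambda>z. \<kappa> (\<sigma> (fst z)) (snd z)) (q, w)"
proof -
  obtain c where c: "c \<in> Q" "q \<in> cdom c" using local_sectionD(1)[OF \<sigma> q] by (rule pointsE)
  obtain d where d: "d \<in> W" "w \<in> cdom d" using w by (rule pointsE)
  have ev: "\<forall>\<^sub>F z in mnhds Q q. z \<in> U" by (rule local_sectionD(5)[OF \<sigma> q])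
  have pt: "(q, w) \<in> points (Q \<times>\<^sub>M W)"
    using chart_in_points[OF c] w by (simp add: points_prod)
  have evU: "\<forall>\<^sub>F a in nhds (cmap c q, cmap d w). fst (cinv (prod_chart c d) a) \<in> U"
    using smooth_at_eventually[OF smooth_at_fst[OF regular_Q regular_W pt], of "\<lambda>q. q \<in> U"] ev
      eventually_mnhds_chart[OF regular_prod[OF regular_Q regular_W] prod_chart_in[OF c(1) d(1)],
        of "(q, w)"] c d by simp
  note evp = eventually_cinv_prod_chart[OF regular_Q c(1) regular_W d(1) c(2) d(2)]
  show ?thesis
  proof (rule smooth_atI[where f = "\<lambda>z. \<kappa> (\<sigma> (fst z)) (snd z)",
        OF regular_prod[OF regular_Q regular_W] regular_M prod_chart_in[OF c(1) d(1)] _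
        bundle_chart_in[OF \<sigma> c(1) d(1)]])
    show "\<forall>\<^sub>F a in nhds (cmap (prod_chart c d) (q, w)).
        \<kappa> (\<sigma> (fst (cinv (prod_chart c d) a))) (snd (cinv (prod_chart c d) a))
        \<in> cdom (bundle_chart U \<sigma> c d)"
      using eventually_conj[OF evU evp] unfolding prod_chart_simps map_prod_simp
      by (rule eventually_mono) (auto intro!: cdom_bundle_chartI simp: cinv_in)
    have "\<forall>\<^sub>F a in nhds (cmap c q, cmap d w). a = cmap (bundle_chart U \<sigma> c d)
        (\<kappa> (\<sigma> (fst (cinv (prod_chart c d) a))) (snd (cinv (prod_chart c d) a)))"
      using eventually_conj[OF evU evp]
      by (rule eventually_mono) (auto simp: cmap_bundle_chart[OF \<sigma> d(1)] cinv_in cmap_cinv)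
    from smooth_near_cong[OF smooth_near_ident this]
    show "smooth_near (\<lambda>a. cmap (bundle_chart U \<sigma> c d)
        (\<kappa> (\<sigma> (fst (cinv (prod_chart c d) a))) (snd (cinv (prod_chart c d) a))))
        (cmap (prod_chart c d) (q, w))" by simp
  qed (use c d q in \<open>auto intro: cdom_bundle_chartI\<close>)
qed

text \<open>Near p, [p', w] = [\<sigma>(\<pi> p'), \<delta>(p') w] with \<delta>(p') the group
  element from \<sigma>(\<pi> p') to p'. This moves the representative onto a section, where
  \<open>smooth_section_kappa\<close> applies.\<close>

lemma smooth_kappa:
  assumes p: "p \<in> points P" and w: "w \<in> points W"
  shows "smooth_at (P \<times>\<^sub>M W) M (\<lambda>z. \<kappa> (fst z) (snd z)) (p, w)"
proof -
  note PW = regular_prod[OF regular_P regular_W] and QW = regular_prod[OF regular_Q regular_W]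
  have pt: "(p, w) \<in> points (P \<times>\<^sub>M W)" using p w by (simp add: points_prod)
  note f = smooth_at_fst[OF regular_P regular_W pt] and s = smooth_at_snd[OF regular_P regular_W pt]
  obtain U \<sigma> where \<sigma>: "local_section U \<sigma>" "\<pi> p \<in> U" "\<sigma> (\<pi> p) = p"
    using local_trivialization[OF p] by metis
  have pf: "smooth_at (P \<times>\<^sub>M W) Q (\<lambda>z. \<pi> (fst z)) (p, w)"
    using smooth_at_compose[OF PW regular_P regular_Q f] smooth_pi[OF p] by simp
  have spf: "smooth_at (P \<times>\<^sub>M W) P (\<lambda>z. \<sigma> (\<pi> (fst z))) (p, w)"
    using smooth_at_compose[OF PW regular_Q regular_P pf] local_sectionD(2)[OF \<sigma>(1,2)] by simp
  have evU: "\<forall>\<^sub>F z in mnhds (P \<times>\<^sub>M W) (p, w). \<pi> (fst z) \<in> U"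
    using smooth_at_eventually[OF pf] local_sectionD(5)[OF \<sigma>(1,2)] by simp
  have "\<forall>\<^sub>F z in mnhds (P \<times>\<^sub>M W) (p, w). \<pi> (\<sigma> (\<pi> (fst z))) = \<pi> (fst z)"
    using evU by eventually_elim (rule local_sectionD(4)[OF \<sigma>(1)])
  from smooth_at_Phi[OF PW smooth_at_division[OF PW spf f this] s]
  have F: "smooth_at (P \<times>\<^sub>M W) W (\<lambda>z. \<Phi> (division (\<sigma> (\<pi> (fst z))) (fst z)) (snd z)) (p, w)" .
  have "smooth_at (P \<times>\<^sub>M W) M
      (\<lambda>z. \<kappa> (\<sigma> (\<pi> (fst z))) (\<Phi> (division (\<sigma> (\<pi> (fst z))) (fst z)) (snd z))) (p, w)"
    using smooth_at_compose[OF PW QW regular_M smooth_at_Pair[OF PW regular_Q regular_W pf F],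
        of "\<lambda>z. \<kappa> (\<sigma> (fst z)) (snd z)"]
      smooth_section_kappa[OF \<sigma>(1,2), of "\<Phi> (division (\<sigma> (\<pi> p)) p) w"] smooth_at_in(2)[OF F]
    by simp
  then show ?thesis
  proof (rule smooth_at_cong[OF PW])
    show "\<forall>\<^sub>F z in mnhds (P \<times>\<^sub>M W) (p, w).
        \<kappa> (\<sigma> (\<pi> (fst z))) (\<Phi> (division (\<sigma> (\<pi> (fst z))) (fst z)) (snd z)) = \<kappa> (fst z) (snd z)"
      using evU eventually_points[OF PW pt]
    proof eventually_elim
      case (elim z)
      then show ?case
        using local_sectionD(3,4)[OF \<sigma>(1) elim(1)]
        by (intro kappa_division[symmetric]) (auto simp: points_prod)
    qed
  qed
qed

lemma smooth_at_kappa: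
  assumes Y: "regular_atlas Y" and f: "smooth_at Y P f y" and g: "smooth_at Y W g y"
  shows "smooth_at Y M (\<lambda>z. \<kappa> (f z) (g z)) y"
  using smooth_at_compose[OF Y regular_prod[OF regular_P regular_W] regular_M
      smooth_at_Pair[OF Y regular_P regular_W f g] smooth_kappa] smooth_at_in(2)[OF f] smooth_at_in(2)[OF g]
  by simp

lemma smooth_kappa_left:
  "p \<in> points P \<Longrightarrow> w \<in> points W \<Longrightarrow> smooth_at P M (\<lambda>p'. \<kappa> p' w) p"
  by (intro smooth_at_kappa regular_P smooth_at_ident smooth_at_const regular_W)

lemma smooth_kappa_right:
  "p \<in> points P \<Longrightarrow> w \<in> points W \<Longrightarrow> smooth_at W M (\<kappa> p) w"
  using smooth_at_kappa[OF regular_W smooth_at_const[OF regular_P, of w W p] smooth_at_ident[OF regular_W]] by simp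

section \<open>Base point and fibre coordinate of a point of the total space\<close>

definition "fibre_coord \<sigma> m = (THE w. w \<in> points W \<and> m = \<kappa> (\<sigma> (\<rho> m)) w)"

lemma fibre_coord_kappa:
  assumes "local_section U \<sigma>" "q \<in> U" "w \<in> points W"
  shows "fibre_coord \<sigma> (\<kappa> (\<sigma> q) w) = w"
  unfolding fibre_coord_def
  by (rule the_equality)
    (use assms local_sectionD(3,4)[OF assms(1,2)] in \<open>auto simp: rho_kappa dest: kappa_inj\<close>)

text \<open>A representative (p, w) is moved onto the section at the cost of acting on w by the
  group element from \<sigma>(\<pi> p) to p.\<close>

lemma section_representation:
  assumes \<sigma>: "local_section U \<sigma>" and m: "m \<in> points M" "\<rho> m \<in> U"
  shows "fibre_coord \<sigma> m \<in> points W" "m = \<kappa> (\<sigma> (\<rho> m)) (fibre_coord \<sigma> m)"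
proof -
  obtain p w where pw: "p \<in> points P" "w \<in> points W" "m = \<kappa> p w"
    using m(1) by (auto simp: points_M)
  then have q: "\<pi> p \<in> U" "\<rho> m = \<pi> p" using m(2) by (auto simp: rho_kappa)
  note s = local_sectionD[OF \<sigma> q(1)]
  let ?w = "\<Phi> (division (\<sigma> (\<pi> p)) p) w"
  have w: "?w \<in> points W" using division(1)[OF s(3) pw(1) s(4)] pw(2) by (rule Phi_in)
  have "m = \<kappa> (\<sigma> (\<rho> m)) ?w"
    using kappa_division[OF s(3) pw(1) s(4) pw(2)] pw(3) q by simp
  moreover from this have "fibre_coord \<sigma> m = ?w"
    using fibre_coord_kappa[OF \<sigma> q(1) w] q(2) by simp
  ultimately show "fibre_coord \<sigma> m \<in> points W" "m = \<kappa> (\<sigma> (\<rho> m)) (fibre_coord \<sigma> m)"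
    using w by simp_all
qed

lemma smooth_rho:
  assumes m: "m \<in> points M" shows "smooth_at M Q \<rho> m"
proof -
  obtain p w where pw: "p \<in> points P" "w \<in> points W" "m = \<kappa> p w"
    using m by (auto simp: points_M)
  obtain U \<sigma> where \<sigma>: "local_section U \<sigma>" "\<pi> p \<in> U" "\<sigma> (\<pi> p) = p"
    using local_trivialization[OF pw(1)] by metis
  obtain c where c: "c \<in> Q" "\<pi> p \<in> cdom c" using pi_in[OF pw(1)] by (rule pointsE)
  obtain d where d: "d \<in> W" "w \<in> cdom d" using pw(2) by (rule pointsE)
  have m': "m = \<kappa> (\<sigma> (\<pi> p)) w" using pw \<sigma> by simp
  have cm: "cmap (bundle_chart U \<sigma> c d) m = (cmap c (\<pi> p), cmap d w)"
    unfolding m' by (rule cmap_bundle_chart[OF \<sigma>(1) d(1) \<sigma>(2) c(2) d(2)])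
  have ev: "\<forall>\<^sub>F a in nhds (cmap c (\<pi> p), cmap d w).
      \<rho> (cinv (bundle_chart U \<sigma> c d) a) = cinv c (fst a) \<and> cinv c (fst a) \<in> cdom c \<and>
      cmap c (cinv c (fst a)) = fst a"
    using eventually_cinv_bundle_chart[OF \<sigma>(1) c(1) d(1) \<sigma>(2) c(2) d(2)]
    by eventually_elim (auto simp: rho_kappa local_sectionD(3,4)[OF \<sigma>(1)] chart_in_points[OF d(1)])
  show ?thesis
  proof (rule smooth_atI[where f = \<rho>, OF regular_M regular_Q bundle_chart_in[OF \<sigma>(1) c(1) d(1)] _ c(1)])
    show "m \<in> cdom (bundle_chart U \<sigma> c d)"
      unfolding m' by (rule cdom_bundle_chartI[OF \<sigma>(2) c(2) d(2)])
    show "\<rho> m \<in> cdom c" using c pw by (simp add: rho_kappa)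
    show "\<forall>\<^sub>F a in nhds (cmap (bundle_chart U \<sigma> c d) m). \<rho> (cinv (bundle_chart U \<sigma> c d) a) \<in> cdom c"
      unfolding cm using ev by eventually_elim simp
    show "smooth_near (\<lambda>a. cmap c (\<rho> (cinv (bundle_chart U \<sigma> c d) a))) (cmap (bundle_chart U \<sigma> c d) m)"
      unfolding cm
      by (rule smooth_near_cong[OF smooth_near_fst[OF smooth_near_ident]]) (rule eventually_mono[OF ev], simp)
  qed
qed

text \<open>In the bundle chart built from \<sigma> itself the fibre coordinate is the second
  projection; a chart from another section would bring in the group action.\<close>

lemma smooth_fibre_coord:
  assumes \<sigma>: "local_section U \<sigma>" and m: "m \<in> points M" "\<rho> m \<in> U"
  shows "smooth_at M W (fibre_coord \<sigma>) m"
proof -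
  define q w where "q = \<rho> m" and "w = fibre_coord \<sigma> m"
  have q: "q \<in> U" and w: "w \<in> points W" and m': "m = \<kappa> (\<sigma> q) w"
    using section_representation[OF \<sigma> m] m(2) by (simp_all add: q_def w_def)
  obtain c where c: "c \<in> Q" "q \<in> cdom c" using local_sectionD(1)[OF \<sigma> q] by (rule pointsE)
  obtain d where d: "d \<in> W" "w \<in> cdom d" using w by (rule pointsE)
  have cm: "cmap (bundle_chart U \<sigma> c d) m = (cmap c q, cmap d w)"
    unfolding m' by (rule cmap_bundle_chart[OF \<sigma> d(1) q c(2) d(2)])
  have ev: "\<forall>\<^sub>F a in nhds (cmap c q, cmap d w).
      fibre_coord \<sigma> (cinv (bundle_chart U \<sigma> c d) a) = cinv d (snd a) \<and> cinv d (snd a) \<in> cdom d \<and>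
      cmap d (cinv d (snd a)) = snd a"
    using eventually_cinv_bundle_chart[OF \<sigma> c(1) d(1) q c(2) d(2)]
    by eventually_elim (auto simp: fibre_coord_kappa[OF \<sigma>] chart_in_points[OF d(1)])
  show ?thesis
  proof (rule smooth_atI[where f = "fibre_coord \<sigma>", OF regular_M regular_W
        bundle_chart_in[OF \<sigma> c(1) d(1)] _ d(1)])
    show "m \<in> cdom (bundle_chart U \<sigma> c d)"
      unfolding m' by (rule cdom_bundle_chartI[OF q c(2) d(2)])
    show "fibre_coord \<sigma> m \<in> cdom d" using d(2) by (simp add: w_def)
    show "\<forall>\<^sub>F a in nhds (cmap (bundle_chart U \<sigma> c d) m).
        fibre_coord \<sigma> (cinv (bundle_chart U \<sigma> c d) a) \<in> cdom d"
      unfolding cm using ev by eventually_elim simp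
    show "smooth_near (\<lambda>a. cmap d (fibre_coord \<sigma> (cinv (bundle_chart U \<sigma> c d) a)))
        (cmap (bundle_chart U \<sigma> c d) m)"
      unfolding cm
      by (rule smooth_near_cong[OF smooth_near_snd[OF smooth_near_ident]]) (rule eventually_mono[OF ev], simp)
  qed
qed

end

section \<open>Horizontal lifts\<close>

locale principal_connection_data = principal_bundle_data G \<G> P Q R \<pi>
  for G :: "('g, 'x) monoid_scheme"
    and \<G> :: "('g, 'eg::real_inner) atlas"
    and P :: "('p, 'ep::real_inner) atlas"
    and Q :: "('q, 'eq::real_inner) atlas"
    and R :: "'p \<Rightarrow> 'g \<Rightarrow> 'p"
    and \<pi> :: "'p \<Rightarrow> 'q" +
  fixes A :: "'p \<Rightarrow> ('p, 'ep) tvec \<Rightarrow> ('g, 'eg) tvec"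
  assumes connection: "principal_connection G \<G> P R A"
begin

lemma one_in: "\<one>\<^bsub>G\<^esub> \<in> points \<G>"
  by (simp add: points_G)

lemma tlinear_A: "p \<in> points P \<Longrightarrow> tlinear (tspace P p) (tspace \<G> \<one>\<^bsub>G\<^esub>) (A p)"
  using connection by (simp add: principal_connection_def)

lemma A_generator:
  "p \<in> points P \<Longrightarrow> \<xi> \<in> tspace \<G> \<one>\<^bsub>G\<^esub> \<Longrightarrow> A p (tmap \<G> P (R p) \<one>\<^bsub>G\<^esub> \<xi>) = \<xi>"
  using connection by (simp add: principal_connection_def)

lemma A_equivariant:
  "p \<in> points P \<Longrightarrow> g \<in> carrier G \<Longrightarrow> v \<in> tspace P p \<Longrightarrow>
    A (R p g) (tmap P P (\<lambda>p'. R p' g) p v) = Ad G \<G> (inv\<^bsub>G\<^esub> g) (A p v)"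
  using connection by (simp add: principal_connection_def)

lemma smooth_R_right: "p \<in> points P \<Longrightarrow> g \<in> carrier G \<Longrightarrow> smooth_at \<G> P (R p) g"
  using smooth_at_R[OF regular_G smooth_at_const[OF regular_P] smooth_at_ident[OF regular_G]]
  by (simp add: points_G)

lemma smooth_R_left: "p \<in> points P \<Longrightarrow> g \<in> carrier G \<Longrightarrow> smooth_at P P (\<lambda>p'. R p' g) p"
  by (intro smooth_at_R regular_P smooth_at_ident smooth_at_const regular_G) (simp_all add: points_G)

section \<open>Infinitesimal generators and vertical vectors\<close>

lemma generator_in:
  assumes "p \<in> points P" "\<xi> \<in> tspace \<G> \<one>\<^bsub>G\<^esub>"
  shows "tmap \<G> P (R p) \<one>\<^bsub>G\<^esub> \<xi> \<in> tspace P p"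
  using tmap_in_tspace[OF regular_G regular_P smooth_R_right[OF assms(1) one_closed] assms(2)] assms(1)
  by (simp add: R_one)

text \<open>The orbit map g -> p g stays in one fibre, so its composition with \<pi> is constant on
  the group.\<close>

lemma pi_generator:
  assumes p: "p \<in> points P" and \<xi>: "\<xi> \<in> tspace \<G> \<one>\<^bsub>G\<^esub>"
  shows "tmap P Q \<pi> p (tmap \<G> P (R p) \<one>\<^bsub>G\<^esub> \<xi>) = tzero"
proof -
  have "tmap P Q \<pi> p (tmap \<G> P (R p) \<one>\<^bsub>G\<^esub> \<xi>) = tmap \<G> Q (\<lambda>g. \<pi> (R p g)) \<one>\<^bsub>G\<^esub> \<xi>"
    using tmap_compose[OF regular_G regular_P regular_Q smooth_R_right[OF p one_closed] _ \<xi>, of \<pi>]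
      smooth_pi[OF p] by (simp add: R_one[OF p])
  also have "\<dots> = tmap \<G> Q (\<lambda>_. \<pi> p) \<one>\<^bsub>G\<^esub> \<xi>"
  proof (rule tmap_cong[OF regular_G regular_Q smooth_at_const[OF regular_Q one_in pi_in[OF p]] _ \<xi>])
    show "\<forall>\<^sub>F g in mnhds \<G> \<one>\<^bsub>G\<^esub>. \<pi> p = \<pi> (R p g)"
      using eventually_points[OF regular_G one_in]
      by eventually_elim (simp add: pi_R p points_G)
  qed
  also have "\<dots> = tzero" by (rule tmap_const[OF regular_G regular_Q one_in pi_in[OF p] \<xi>])
  finally show ?thesis .
qed

text \<open>Differentiate p' = \<sigma>(\<pi> p') \<gamma>(p') at p with \<sigma>(\<pi> p) = p and
  \<gamma>(p) = 1. The \<sigma> part vanishes on a vertical h, and the remaining part is the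
  generator of \<xi>, the image of h under the tangent map of \<gamma>.\<close>

lemma vertical_eq_generator:
  assumes p: "p \<in> points P" and h: "h \<in> tspace P p" and vert: "tmap P Q \<pi> p h = tzero"
  shows "\<exists>\<xi>\<in>tspace \<G> \<one>\<^bsub>G\<^esub>. h = tmap \<G> P (R p) \<one>\<^bsub>G\<^esub> \<xi>"
proof -
  obtain U \<sigma> where \<sigma>: "local_section U \<sigma>" "\<pi> p \<in> U" "\<sigma> (\<pi> p) = p"
    using local_trivialization[OF p] by metis
  define \<gamma> where "\<gamma> = (\<lambda>p'. division (\<sigma> (\<pi> p')) p')"
  note s = local_sectionD(2)[OF \<sigma>(1,2)]
  have sp: "smooth_at P P (\<lambda>p'. \<sigma> (\<pi> p')) p"
    by (rule smooth_at_compose[OF regular_P regular_Q regular_P smooth_pi[OF p] s])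
  have evU: "\<forall>\<^sub>F p' in mnhds P p. \<pi> p' \<in> U"
    by (rule smooth_at_eventually[OF smooth_pi[OF p] local_sectionD(5)[OF \<sigma>(1,2)]])
  have "\<forall>\<^sub>F p' in mnhds P p. \<pi> (\<sigma> (\<pi> p')) = \<pi> p'"
    using evU by eventually_elim (rule local_sectionD(4)[OF \<sigma>(1)])
  then have \<gamma>: "smooth_at P \<G> \<gamma> p"
    unfolding \<gamma>_def by (rule smooth_at_division[OF regular_P sp smooth_at_ident[OF regular_P p]])
  have \<gamma>1: "\<gamma> p = \<one>\<^bsub>G\<^esub>" by (simp add: \<gamma>_def \<sigma>(3) division_self p)
  have 0: "tmap P P (\<lambda>p'. \<sigma> (\<pi> p')) p h = tzero"
    using tmap_compose[OF regular_P regular_Q regular_P smooth_pi[OF p] s h]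
      tlinear_tzero[OF regular_Q tlinear_tmap[OF regular_Q regular_P s]] vert by simp
  have R1: "smooth_at P P (\<lambda>m. R m \<one>\<^bsub>G\<^esub>) p" by (rule smooth_R_left[OF p one_closed])
  have ev: "\<forall>\<^sub>F p' in mnhds P p. p' = R (\<sigma> (\<pi> p')) (\<gamma> p')"
    using evU eventually_points[OF regular_P p]
    by eventually_elim (simp add: \<gamma>_def division(2) local_sectionD(3,4)[OF \<sigma>(1)])
  have "h = tmap P P (\<lambda>p'. p') p h" by (rule tmap_ident[OF regular_P p h, symmetric])
  also have "\<dots> = tmap P P (\<lambda>p'. R (\<sigma> (\<pi> p')) (\<gamma> p')) p h"
    by (rule tmap_cong[OF regular_P regular_P smooth_at_ident[OF regular_P p] ev h, symmetric])
  also have "\<dots> = tadd (tmap P P (\<lambda>m. R m \<one>\<^bsub>G\<^esub>) p (tmap P P (\<lambda>p'. \<sigma> (\<pi> p')) p h))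
      (tmap \<G> P (R p) \<one>\<^bsub>G\<^esub> (tmap P \<G> \<gamma> p h))"
    using tmap_split[OF regular_P regular_P regular_G regular_P sp \<gamma>, of "\<lambda>z. R (fst z) (snd z)", OF _ h]
      smooth_R[OF p one_closed] by (simp add: \<sigma>(3) \<gamma>1)
  also have "\<dots> = tmap \<G> P (R p) \<one>\<^bsub>G\<^esub> (tmap P \<G> \<gamma> p h)"
    using tlinear_tzero[OF regular_P tlinear_tmap[OF regular_P regular_P R1]]
    by (simp add: 0 tvec_algebra)
  finally show ?thesis
    using tmap_in_tspace[OF regular_P regular_G \<gamma> h] \<gamma>1 by auto
qed

text \<open>The difference of two lifts is vertical, hence a generator of some \<xi>. The connection
  returns \<xi> from its generator but vanishes on the difference, so \<xi> and the difference are
  zero.\<close>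

lemma hor_lift_unique:
  assumes p: "p \<in> points P" and h: "h \<in> tspace P p" "A p h = tzero"
    and h': "h' \<in> tspace P p" "A p h' = tzero" and eq: "tmap P Q \<pi> p h = tmap P Q \<pi> p h'"
  shows "h = h'"
proof -
  let ?d = "tsub h h'"
  have d: "?d \<in> tspace P p" by (rule tspace_tsub[OF regular_P h(1) h'(1)])
  have "tmap P Q \<pi> p ?d = tzero"
    using tlinear_tsub[OF regular_P tlinear_tmap[OF regular_P regular_Q smooth_pi[OF p]] h(1) h'(1)] eq
    by (simp add: tvec_algebra)
  then obtain \<xi> where \<xi>: "\<xi> \<in> tspace \<G> \<one>\<^bsub>G\<^esub>" "?d = tmap \<G> P (R p) \<one>\<^bsub>G\<^esub> \<xi>"
    using vertical_eq_generator[OF p d] by blast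
  have "A p ?d = tzero"
    using tlinear_tsub[OF regular_P tlinear_A[OF p] h(1) h'(1)] h(2) h'(2) by (simp add: tvec_algebra)
  then have "\<xi> = tzero" using A_generator[OF p \<xi>(1)] \<xi>(2) by simp
  then have "?d = tzero"
    using tlinear_tzero[OF regular_G tlinear_tmap[OF regular_G regular_P smooth_R_right[OF p one_closed]]] \<xi>(2)
    by simp
  then have "tadd (tsub h h') h' = tadd tzero h'" by simp
  then show ?thesis by (simp add: tvec_algebra)
qed

text \<open>A reproduces generators, so the correction cancels A h0; generators are vertical, so the
  projection is unchanged. Being valid for any lift h0, the formula stands in for the definite
  description where smoothness matters.\<close>

lemma hor_lift_eq:
  assumes p: "p \<in> points P" and h0: "h0 \<in> tspace P p"
  defines "h \<equiv> tsub h0 (tmap \<G> P (R p) \<one>\<^bsub>G\<^esub> (A p h0))"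
  shows "hor_lift P Q \<pi> A p (tmap P Q \<pi> p h0) = h"
    and "h \<in> tspace P p" "A p h = tzero" "tmap P Q \<pi> p h = tmap P Q \<pi> p h0"
proof -
  note \<xi> = tlinear_in[OF tlinear_A[OF p] h0]
  note gen = generator_in[OF p \<xi>]
  show 1: "h \<in> tspace P p" unfolding h_def by (rule tspace_tsub[OF regular_P h0 gen])
  show 2: "A p h = tzero"
    unfolding h_def using tlinear_tsub[OF regular_P tlinear_A[OF p] h0 gen]
    by (simp add: A_generator[OF p \<xi>] tvec_algebra)
  show 3: "tmap P Q \<pi> p h = tmap P Q \<pi> p h0"
    unfolding h_def
    using tlinear_tsub[OF regular_P tlinear_tmap[OF regular_P regular_Q smooth_pi[OF p]] h0 gen]
    by (simp add: pi_generator[OF p \<xi>] tvec_algebra)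
  show "hor_lift P Q \<pi> A p (tmap P Q \<pi> p h0) = h"
    unfolding hor_lift_def by (rule the_equality) (use 1 2 3 hor_lift_unique[OF p] in auto)
qed

text \<open>The section may miss p, so it is translated by the fixed group element from
  \<sigma>(\<pi> p) to p. The tangent map of the translated section gives a lift of u that is not
  necessarily horizontal.\<close>

lemma section_lift:
  assumes \<sigma>: "local_section U \<sigma>" "\<pi> p \<in> U" and p: "p \<in> points P" and u: "u \<in> tspace Q (\<pi> p)"
  defines "s \<equiv> \<lambda>q. R (\<sigma> q) (division (\<sigma> (\<pi> p)) p)"
  shows "smooth_at Q P s (\<pi> p)" "s (\<pi> p) = p" "tmap Q P s (\<pi> p) u \<in> tspace P p"
    "tmap P Q \<pi> p (tmap Q P s (\<pi> p) u) = u"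
proof -
  let ?g = "division (\<sigma> (\<pi> p)) p"
  note sec = local_sectionD[OF \<sigma>]
  note g = division[OF sec(3) p sec(4)]
  show s: "smooth_at Q P s (\<pi> p)"
    unfolding s_def by (rule smooth_at_R[OF regular_Q sec(2) smooth_at_const[OF regular_G sec(1)]])
      (simp add: points_G g)
  show sp: "s (\<pi> p) = p" by (simp add: s_def g)
  show "tmap Q P s (\<pi> p) u \<in> tspace P p"
    using tmap_in_tspace[OF regular_Q regular_P s u] by (simp add: sp)
  have "\<forall>\<^sub>F q in mnhds Q (\<pi> p). q = \<pi> (s q)"
    using sec(5) by eventually_elim (simp add: s_def pi_R local_sectionD(3,4)[OF \<sigma>(1)] g)
  from tmap_cong[OF regular_Q regular_Q smooth_at_ident[OF regular_Q sec(1)] this u]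
  have "tmap Q Q (\<lambda>q. \<pi> (s q)) (\<pi> p) u = u"
    by (simp add: tmap_ident[OF regular_Q sec(1) u])
  then show "tmap P Q \<pi> p (tmap Q P s (\<pi> p) u) = u"
    using tmap_compose[OF regular_Q regular_P regular_Q s _ u, of \<pi>] smooth_pi[OF p] by (simp add: sp)
qed

lemma hor_lift:
  assumes p: "p \<in> points P" and u: "u \<in> tspace Q (\<pi> p)"
  shows "hor_lift P Q \<pi> A p u \<in> tspace P p" "A p (hor_lift P Q \<pi> A p u) = tzero"
    "tmap P Q \<pi> p (hor_lift P Q \<pi> A p u) = u"
proof -
  obtain U \<sigma> where \<sigma>: "local_section U \<sigma>" "\<pi> p \<in> U"
    using local_trivialization[OF p] by metis
  note l = section_lift[OF \<sigma> p u]
  show "hor_lift P Q \<pi> A p u \<in> tspace P p" "A p (hor_lift P Q \<pi> A p u) = tzero"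
    "tmap P Q \<pi> p (hor_lift P Q \<pi> A p u) = u"
    using hor_lift_eq[OF p l(3)] by (simp_all add: l(4))
qed

lemma hor_lift_eqI:
  assumes p: "p \<in> points P" and h: "h \<in> tspace P p" "A p h = tzero"
  shows "hor_lift P Q \<pi> A p (tmap P Q \<pi> p h) = h"
  using hor_lift_eq(1)[OF p h(1)] h(2)
    tlinear_tzero[OF regular_G tlinear_tmap[OF regular_G regular_P smooth_R_right[OF p one_closed]]]
  by (simp add: tvec_algebra)

text \<open>Sums and multiples of horizontal vectors are horizontal, so each is the lift of its own
  projection.\<close>

lemma tlinear_hor_lift:
  assumes p: "p \<in> points P"
  shows "tlinear (tspace Q (\<pi> p)) (tspace P p) (hor_lift P Q \<pi> A p)"
proof -
  note T = tlinear_tmap[OF regular_P regular_Q smooth_pi[OF p]] and A = tlinear_A[OF p] and H = hor_lift[OF p]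
  have "hor_lift P Q \<pi> A p (tadd u v) = tadd (hor_lift P Q \<pi> A p u) (hor_lift P Q \<pi> A p v)"
    if u: "u \<in> tspace Q (\<pi> p)" and v: "v \<in> tspace Q (\<pi> p)" for u v
    using hor_lift_eqI[OF p tspace_tadd[OF regular_P H(1)[OF u] H(1)[OF v]]]
      tlinear_tadd[OF T H(1)[OF u] H(1)[OF v]] tlinear_tadd[OF A H(1)[OF u] H(1)[OF v]]
    by (simp add: H u v tvec_algebra)
  moreover have "hor_lift P Q \<pi> A p (tscale r u) = tscale r (hor_lift P Q \<pi> A p u)"
    if u: "u \<in> tspace Q (\<pi> p)" for u r
  proof -
    have "tscale r tzero = (tzero :: ('g, 'eg) tvec)" by (simp add: fun_eq_iff)
    then show ?thesis
      using hor_lift_eqI[OF p tspace_tscale[OF regular_P H(1)[OF u]], of r]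
        tlinear_tscale[OF T H(1)[OF u]] tlinear_tscale[OF A H(1)[OF u]]
      by (simp add: H u)
  qed
  ultimately show ?thesis using H(1) by (auto simp: tlinear_def)
qed

text \<open>Right translation preserves horizontality, by equivariance of A and linearity of
  \<open>Ad\<close>, and it preserves the projection because \<pi> is invariant. Uniqueness of lifts
  does the rest. This makes the induced connection on M independent of representatives.\<close>

lemma hor_lift_equivariant:
  assumes p: "p \<in> points P" and g: "g \<in> carrier G" and u: "u \<in> tspace Q (\<pi> p)"
  shows "hor_lift P Q \<pi> A (R p g) u = tmap P P (\<lambda>p'. R p' g) p (hor_lift P Q \<pi> A p u)"
proof -
  note Rg = smooth_R_left[OF p g] and H = hor_lift[OF p u] and pg = R_in[OF p g]
  let ?h = "tmap P P (\<lambda>p'. R p' g) p (hor_lift P Q \<pi> A p u)"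
  have h: "?h \<in> tspace P (R p g)" by (rule tmap_in_tspace[OF regular_P regular_P Rg H(1)])
  have conj: "smooth_at \<G> \<G> (\<lambda>h. inv\<^bsub>G\<^esub> g \<otimes>\<^bsub>G\<^esub> h \<otimes>\<^bsub>G\<^esub> inv\<^bsub>G\<^esub> (inv\<^bsub>G\<^esub> g)) \<one>\<^bsub>G\<^esub>"
    by (intro smooth_at_mult regular_G smooth_at_const one_in smooth_at_ident) (simp_all add: points_G g)
  have "A (R p g) ?h = Ad G \<G> (inv\<^bsub>G\<^esub> g) tzero"
    using A_equivariant[OF p g H(1)] H(2) by simp
  also have "\<dots> = tzero"
    unfolding Ad_def by (rule tlinear_tzero[OF regular_G tlinear_tmap[OF regular_G regular_G conj]])
  finally have A0: "A (R p g) ?h = tzero" .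
  have "tmap P Q \<pi> (R p g) ?h = tmap P Q (\<lambda>p'. \<pi> (R p' g)) p (hor_lift P Q \<pi> A p u)"
    by (rule tmap_compose[OF regular_P regular_P regular_Q Rg smooth_pi[OF pg] H(1), symmetric])
  also have "\<dots> = tmap P Q \<pi> p (hor_lift P Q \<pi> A p u)"
  proof (rule tmap_cong[OF regular_P regular_Q smooth_pi[OF p] _ H(1)])
    show "\<forall>\<^sub>F p' in mnhds P p. \<pi> p' = \<pi> (R p' g)"
      using eventually_points[OF regular_P p] by eventually_elim (simp add: pi_R g)
  qed
  finally have "tmap P Q \<pi> (R p g) ?h = u" by (simp add: H(3))
  then show ?thesis using hor_lift_eqI[OF pg h A0] by simp
qed

text \<open>By definition A is smooth on fields with constant coordinates in a chart of P, seen in a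
  chart around the unit; \<open>smooth_along_linear\<close> passes to any smooth field.\<close>

lemma smooth_along_A:
  assumes Y: "regular_atlas Y" and X: "smooth_along Y P f X y"
  shows "smooth_along Y \<G> (\<lambda>_. \<one>\<^bsub>G\<^esub>) (\<lambda>z. A (f z) (X z)) y"
proof -
  note f = smooth_alongD(1)[OF X]
  note y = smooth_at_in(1)[OF f]
  obtain c where c: "c \<in> P" "f y \<in> cdom c" using smooth_at_in(2)[OF f] by (rule pointsE)
  obtain k where k: "k \<in> \<G>" "\<one>\<^bsub>G\<^esub> \<in> cdom k" using one_in by (rule pointsE)
  have one: "smooth_at Y \<G> (\<lambda>_. \<one>\<^bsub>G\<^esub>) y" by (rule smooth_at_const[OF regular_G y one_in])
  note evP = smooth_along_eventually_points[OF regular_P X]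
  show ?thesis
  proof (rule smooth_along_linear[OF Y regular_P regular_G X c one])
    show "\<forall>\<^sub>F z in mnhds Y y. tlinear (tspace P (f z)) (tspace \<G> \<one>\<^bsub>G\<^esub>) (A (f z))"
      using evP by eventually_elim (rule tlinear_A)
    fix e
    have evc: "\<forall>\<^sub>F p in mnhds P (f y). p \<in> cdom c" by (rule eventually_cdom[OF regular_P c])
    have "smooth_on (cimg c) (\<lambda>a. A (cinv c a) (tcoord P c (cinv c a) e) k)"
      using connection c k by (simp add: principal_connection_def)
    then have "smooth_near (\<lambda>a. A (cinv c a) (tcoord P c (cinv c a) e) k) (cmap c (f y))"
      by (rule smooth_nearI[rotated -1]) (use c in \<open>auto intro: open_cimg regular_P\<close>)
    then have "smooth_fun_at P (\<lambda>p. A p (tcoord P c p e) k) (f y)"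
      by (rule smooth_fun_atI[OF regular_P c])
    from smooth_fun_at_compose[OF Y regular_P f this]
    show "smooth_along Y \<G> (\<lambda>_. \<one>\<^bsub>G\<^esub>) (\<lambda>z. A (f z) (tcoord P c (f z) e)) y"
    proof (rule smooth_alongI[where X = "\<lambda>z. A (f z) (tcoord P c (f z) e)", OF Y regular_G one _ k, rotated])
      show "\<forall>\<^sub>F z in mnhds Y y. A (f z) (tcoord P c (f z) e) \<in> tspace \<G> \<one>\<^bsub>G\<^esub>"
        using smooth_at_eventually[OF f evc]
      proof eventually_elim
        case (elim z)
        show ?case
          by (rule tlinear_in[OF tlinear_A[OF chart_in_points[OF c(1) elim]]
                tcoord_in_tspace[OF regular_P c(1) elim]])
      qed
    qed
  qed
qed

text \<open>The definite description is replaced by the formula of \<open>hor_lift_eq\<close>, with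
  the initial lift taken from a translated section. Both this lift and the generator are tangent
  maps of families depending on the parameter, so \<open>smooth_along_tmap\<close> covers
  them.\<close>

lemma smooth_along_hor_lift:
  assumes Y: "regular_atlas Y" and f: "smooth_at Y P f y"
    and X: "smooth_along Y Q (\<lambda>z. \<pi> (f z)) X y"
  shows "smooth_along Y P f (\<lambda>z. hor_lift P Q \<pi> A (f z) (X z)) y"
proof -
  note y = smooth_at_in(1)[OF f] and p = smooth_at_in(2)[OF f]
  note pf = smooth_alongD(1)[OF X]
  obtain U \<sigma> where \<sigma>: "local_section U \<sigma>" "\<pi> (f y) \<in> U"
    using local_trivialization[OF p] by metis
  note sec = local_sectionD[OF \<sigma>]
  \<comment> \<open>For each z the section is translated so as to pass through f z. The group
    element depends on z but not on q, so the tangent map of s z differentiates in q alone.\<close>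
  define s where "s = (\<lambda>z q. R (\<sigma> q) (division (\<sigma> (\<pi> (f z))) (f z)))"
  have evU: "\<forall>\<^sub>F z in mnhds Y y. \<pi> (f z) \<in> U" by (rule smooth_at_eventually[OF pf sec(5)])
  have evP: "\<forall>\<^sub>F z in mnhds Y y. f z \<in> points P"
    by (rule smooth_at_eventually[OF f eventually_points[OF regular_P p]])
  have "\<forall>\<^sub>F z in mnhds Y y. \<pi> (\<sigma> (\<pi> (f z))) = \<pi> (f z)"
    using evU by eventually_elim (rule local_sectionD(4)[OF \<sigma>(1)])
  from smooth_at_division[OF Y smooth_at_compose[OF Y regular_Q regular_P pf sec(2)] f this]
  have div: "smooth_at Y \<G> (\<lambda>z. division (\<sigma> (\<pi> (f z))) (f z)) y" .
  note YQ = regular_prod[OF Y regular_Q]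
  have pt: "(y, \<pi> (f y)) \<in> points (Y \<times>\<^sub>M Q)"
    using y sec(1) by (simp add: points_prod)
  have "smooth_at (Y \<times>\<^sub>M Q) P (\<lambda>z. s (fst z) (snd z)) (y, \<pi> (f y))"
    unfolding s_def
    using smooth_at_compose[OF YQ regular_Q regular_P smooth_at_snd[OF Y regular_Q pt], of \<sigma>]
      smooth_at_compose[OF YQ Y regular_G smooth_at_fst[OF Y regular_Q pt],
        of "\<lambda>z. division (\<sigma> (\<pi> (f z))) (f z)"] sec(2) div
    by (intro smooth_at_R[OF YQ]) simp_all
  from smooth_along_tmap[OF Y regular_Q regular_P this X]
  have "smooth_along Y P (\<lambda>z. s z (\<pi> (f z))) (\<lambda>z. tmap Q P (s z) (\<pi> (f z)) (X z)) y" .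
  then have h0: "smooth_along Y P f (\<lambda>z. tmap Q P (s z) (\<pi> (f z)) (X z)) y"
  proof (rule smooth_along_cong[OF Y])
    show "\<forall>\<^sub>F z in mnhds Y y. s z (\<pi> (f z)) = f z \<and>
        tmap Q P (s z) (\<pi> (f z)) (X z) = tmap Q P (s z) (\<pi> (f z)) (X z)"
      using evU evP by eventually_elim (simp add: s_def division(2) local_sectionD(3,4)[OF \<sigma>(1)])
  qed
  have pt1: "(y, \<one>\<^bsub>G\<^esub>) \<in> points (Y \<times>\<^sub>M \<G>)"
    using y by (simp add: points_prod points_G)
  note YG = regular_prod[OF Y regular_G]
  \<comment> \<open>The generator at f z is the tangent map at the unit of the orbit map of f z,
    again a family of maps with parameter z.\<close>
  have "smooth_at (Y \<times>\<^sub>M \<G>) P (\<lambda>z. R (f (fst z)) (snd z)) (y, \<one>\<^bsub>G\<^esub>)"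
    using smooth_at_compose[OF YG Y regular_P smooth_at_fst[OF Y regular_G pt1], of f] f
    by (intro smooth_at_R[OF YG] smooth_at_snd[OF Y regular_G pt1]) simp
  from smooth_along_tmap[OF Y regular_G regular_P this smooth_along_A[OF Y h0]]
  have gen: "smooth_along Y P (\<lambda>z. R (f z) \<one>\<^bsub>G\<^esub>)
      (\<lambda>z. tmap \<G> P (R (f z)) \<one>\<^bsub>G\<^esub> (A (f z) (tmap Q P (s z) (\<pi> (f z)) (X z)))) y" .
  have "smooth_along Y P f
      (\<lambda>z. tmap \<G> P (R (f z)) \<one>\<^bsub>G\<^esub> (A (f z) (tmap Q P (s z) (\<pi> (f z)) (X z)))) y"
    by (rule smooth_along_cong[OF Y gen]) (rule eventually_mono[OF evP], simp add: R_one)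
  from smooth_along_tsub[OF regular_P h0 this] show ?thesis
  proof (rule smooth_along_cong[OF Y])
    show "\<forall>\<^sub>F z in mnhds Y y. f z = f z \<and>
        tsub (tmap Q P (s z) (\<pi> (f z)) (X z))
          (tmap \<G> P (R (f z)) \<one>\<^bsub>G\<^esub> (A (f z) (tmap Q P (s z) (\<pi> (f z)) (X z)))) =
        hor_lift P Q \<pi> A (f z) (X z)"
      using evU evP smooth_alongD(2)[OF X]
    proof eventually_elim
      case (elim z)
      note l = section_lift[OF \<sigma>(1) elim]
      show ?case
        using hor_lift_eq(1)[OF elim(2) l(3)] by (simp add: l(4) s_def)
    qed
  qed
qed

end

section \<open>The induced connection and the fibre operator\<close>

locale associated_connection_data =
  associated_bundle_data G \<G> P Q R \<pi> W \<Phi> + principal_connection_data G \<G> P Q R \<pi> A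
  for G :: "('g, 'x) monoid_scheme"
    and \<G> :: "('g, 'eg::real_inner) atlas"
    and P :: "('p, 'ep::real_inner) atlas"
    and Q :: "('q, 'eq::real_inner) atlas"
    and R :: "'p \<Rightarrow> 'g \<Rightarrow> 'p"
    and \<pi> :: "'p \<Rightarrow> 'q"
    and W :: "('w, 'ew::real_inner) atlas"
    and \<Phi> :: "'g \<Rightarrow> 'w \<Rightarrow> 'w"
    and A :: "'p \<Rightarrow> ('p, 'ep) tvec \<Rightarrow> ('g, 'eg) tvec"
begin

section \<open>Horizontal lifts and vertical projection on the total space\<close>

lemma tmap_rho_kappa_left:
  assumes p: "p \<in> points P" and w: "w \<in> points W" and h: "h \<in> tspace P p"
  shows "tmap M Q \<rho> (\<kappa> p w) (tmap P M (\<lambda>p'. \<kappa> p' w) p h) = tmap P Q \<pi> p h"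
proof -
  have "tmap M Q \<rho> (\<kappa> p w) (tmap P M (\<lambda>p'. \<kappa> p' w) p h) = tmap P Q (\<lambda>p'. \<rho> (\<kappa> p' w)) p h"
    by (rule tmap_compose[OF regular_P regular_M regular_Q smooth_kappa_left[OF p w]
          smooth_rho[OF kappa_in[OF p w]] h, symmetric])
  also have "\<dots> = tmap P Q \<pi> p h"
  proof (rule tmap_cong[OF regular_P regular_Q smooth_pi[OF p] _ h])
    show "\<forall>\<^sub>F p' in mnhds P p. \<pi> p' = \<rho> (\<kappa> p' w)"
      using eventually_points[OF regular_P p] by eventually_elim (simp add: rho_kappa w)
  qed
  finally show ?thesis .
qed

text \<open>Another representative has the form (p', g w) with p = p' g. Equivariance of the lifts
  on P and [p'' g, w] = [p'', g w] show that both representatives give the same vector.\<close>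

lemma assoc_hor_lift_kappa:
  assumes p: "p \<in> points P" and w: "w \<in> points W" and u: "u \<in> tspace Q (\<pi> p)"
  shows "assoc_hor_lift P Q \<pi> A M \<kappa> (\<kappa> p w) u = tmap P M (\<lambda>p'. \<kappa> p' w) p (hor_lift P Q \<pi> A p u)"
  unfolding assoc_hor_lift_def
proof (rule the_equality)
  show "\<forall>(p', w')\<in>\<kappa> p w. tmap P M (\<lambda>p'. \<kappa> p' w) p (hor_lift P Q \<pi> A p u) =
      tmap P M (\<lambda>p'. \<kappa> p' w') p' (hor_lift P Q \<pi> A p' u)"
  proof clarify
    fix p' w' assume "(p', w') \<in> \<kappa> p w"
    then obtain g where p': "p' \<in> points P" and g: "g \<in> carrier G" "p = R p' g" "w' = \<Phi> g w"
      using in_kappa_iff[OF w] by blast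
    have u': "u \<in> tspace Q (\<pi> p')" using u g p' by (simp add: pi_R)
    note H = hor_lift(1)[OF p' u'] and w' = Phi_in[OF g(1) w]
    have "tmap P M (\<lambda>p'. \<kappa> p' w) p (hor_lift P Q \<pi> A p u) =
        tmap P M (\<lambda>p''. \<kappa> (R p'' g) w) p' (hor_lift P Q \<pi> A p' u)"
      using tmap_compose[OF regular_P regular_P regular_M smooth_R_left[OF p' g(1)] _ H, of "\<lambda>p'. \<kappa> p' w"]
        smooth_kappa_left[OF p w] hor_lift_equivariant[OF p' g(1) u'] by (simp flip: g(2))
    also have "\<dots> = tmap P M (\<lambda>p''. \<kappa> p'' w') p' (hor_lift P Q \<pi> A p' u)"
      unfolding g(3)
    proof (rule tmap_cong[OF regular_P regular_M smooth_kappa_left[OF p' w'] _ H])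
      show "\<forall>\<^sub>F p'' in mnhds P p'. \<kappa> p'' (\<Phi> g w) = \<kappa> (R p'' g) w"
        using eventually_points[OF regular_P p'] by eventually_elim (simp add: kappa_R g w)
    qed
    finally show "tmap P M (\<lambda>p'. \<kappa> p' w) p (hor_lift P Q \<pi> A p u) =
      tmap P M (\<lambda>p'. \<kappa> p' w') p' (hor_lift P Q \<pi> A p' u)" .
  qed
next
  fix h assume "\<forall>(p', w')\<in>\<kappa> p w. h = tmap P M (\<lambda>p'. \<kappa> p' w') p' (hor_lift P Q \<pi> A p' u)"
  from bspec[OF this kappa_refl[OF p w]]
  show "h = tmap P M (\<lambda>p'. \<kappa> p' w) p (hor_lift P Q \<pi> A p u)" by simp
qed

text \<open>Applying the tangent map of \<rho> to any splitting of s into a vertical and a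
  horizontal part forces the latter to be the lift of the projection of s. Hence the splitting is
  unique and u is what remains.\<close>

lemma ver_proj_kappa:
  assumes p: "p \<in> points P" and w: "w \<in> points W" and s: "s \<in> tspace M (\<kappa> p w)"
  defines "u \<equiv> tsub s (tmap P M (\<lambda>p'. \<kappa> p' w) p (hor_lift P Q \<pi> A p (tmap M Q \<rho> (\<kappa> p w) s)))"
  shows "ver_proj P Q \<pi> A M \<kappa> (\<kappa> p w) s = u" "u \<in> tspace M (\<kappa> p w)" "tmap M Q \<rho> (\<kappa> p w) u = tzero"
proof -
  note m = kappa_in[OF p w] and rk = rho_kappa[OF p w]
  note sr = smooth_rho[OF m]
  note Tr = tlinear_tmap[OF regular_M regular_Q sr]
  have AHL: "assoc_hor_lift P Q \<pi> A M \<kappa> (\<kappa> p w) a \<in> tspace M (\<kappa> p w)"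
    "tmap M Q \<rho> (\<kappa> p w) (assoc_hor_lift P Q \<pi> A M \<kappa> (\<kappa> p w) a) = a"
    if a: "a \<in> tspace Q (\<pi> p)" for a
    using tmap_in_tspace[OF regular_P regular_M smooth_kappa_left[OF p w] hor_lift(1)[OF p a]]
      tmap_rho_kappa_left[OF p w hor_lift(1)[OF p a]] hor_lift(3)[OF p a]
    by (simp_all add: assoc_hor_lift_kappa[OF p w a])
  let ?a = "tmap M Q \<rho> (\<kappa> p w) s"
  have a: "?a \<in> tspace Q (\<pi> p)" using tmap_in_tspace[OF regular_M regular_Q sr s] by (simp add: rk)
  have u: "u = tsub s (assoc_hor_lift P Q \<pi> A M \<kappa> (\<kappa> p w) ?a)"
    by (simp add: u_def assoc_hor_lift_kappa[OF p w a])
  show uT: "u \<in> tspace M (\<kappa> p w)" unfolding u by (rule tspace_tsub[OF regular_M s AHL(1)[OF a]])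
  show u0: "tmap M Q \<rho> (\<kappa> p w) u = tzero"
    unfolding u using tlinear_tsub[OF regular_M Tr s AHL(1)[OF a]] AHL(2)[OF a] by (simp add: tvec_algebra)
  show "ver_proj P Q \<pi> A M \<kappa> (\<kappa> p w) s = u"
    unfolding ver_proj_def
  proof (rule the_equality)
    show "u \<in> ver_space M Q \<rho> (\<kappa> p w) \<and> (\<exists>h\<in>hor_space P Q \<pi> A M \<kappa> (\<kappa> p w). s = tadd u h)"
      using uT u0 a by (auto simp: ver_space_def hor_space_def rk u tvec_algebra intro!: bexI[of _ ?a])
    fix u' assume u': "u' \<in> ver_space M Q \<rho> (\<kappa> p w) \<and> (\<exists>h\<in>hor_space P Q \<pi> A M \<kappa> (\<kappa> p w). s = tadd u' h)"
    then obtain b where b: "b \<in> tspace Q (\<pi> p)" "s = tadd u' (assoc_hor_lift P Q \<pi> A M \<kappa> (\<kappa> p w) b)"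
      by (auto simp: hor_space_def rk)
    from u' have v: "u' \<in> tspace M (\<kappa> p w)" "tmap M Q \<rho> (\<kappa> p w) u' = tzero" by (auto simp: ver_space_def)
    have "?a = b"
      using tlinear_tadd[OF Tr v(1) AHL(1)[OF b(1)]] AHL(2)[OF b(1)] v(2) b(2) by (simp add: tvec_algebra)
    then show "u' = u" unfolding u by (simp add: b(2) tvec_algebra)
  qed
qed

text \<open>The first identity differentiates a left inverse. For the second, m' = [\<sigma>(\<rho>
  m'), fibre coordinate of m'] is differentiated at [p, w]; on a vertical vector the \<sigma> part
  contributes zero and only the fibre part remains.\<close>

lemma fibre_coord_inverse:
  assumes \<sigma>: "local_section U \<sigma>" "\<pi> p \<in> U" "\<sigma> (\<pi> p) = p" and p: "p \<in> points P" and w: "w \<in> points W"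
  shows "v \<in> tspace W w \<Longrightarrow> tmap M W (fibre_coord \<sigma>) (\<kappa> p w) (tmap W M (\<kappa> p) w v) = v"
    and "s \<in> tspace M (\<kappa> p w) \<Longrightarrow> tmap M Q \<rho> (\<kappa> p w) s = tzero \<Longrightarrow>
      tmap W M (\<kappa> p) w (tmap M W (fibre_coord \<sigma>) (\<kappa> p w) s) = s"
proof -
  note m = kappa_in[OF p w] and rk = rho_kappa[OF p w]
  have U: "\<rho> (\<kappa> p w) \<in> U" using \<sigma>(2) rk by simp
  have fk: "fibre_coord \<sigma> (\<kappa> p w') = w'" if "w' \<in> points W" for w'
    using fibre_coord_kappa[OF \<sigma>(1,2) that] by (simp add: \<sigma>(3))
  note fc = smooth_fibre_coord[OF \<sigma>(1) m U]
  show "tmap M W (fibre_coord \<sigma>) (\<kappa> p w) (tmap W M (\<kappa> p) w v) = v" if v: "v \<in> tspace W w"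
  proof -
    have "tmap M W (fibre_coord \<sigma>) (\<kappa> p w) (tmap W M (\<kappa> p) w v) = tmap W W (\<lambda>w'. fibre_coord \<sigma> (\<kappa> p w')) w v"
      by (rule tmap_compose[OF regular_W regular_M regular_W smooth_kappa_right[OF p w] fc v, symmetric])
    also have "\<dots> = tmap W W (\<lambda>w'. w') w v"
    proof (rule tmap_cong[OF regular_W regular_W smooth_at_ident[OF regular_W w] _ v])
      show "\<forall>\<^sub>F w' in mnhds W w. w' = fibre_coord \<sigma> (\<kappa> p w')"
        using eventually_points[OF regular_W w] by eventually_elim (simp add: fk)
    qed
    finally show ?thesis by (simp add: tmap_ident[OF regular_W w v])
  qed
  show "tmap W M (\<kappa> p) w (tmap M W (fibre_coord \<sigma>) (\<kappa> p w) s) = s"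
    if s: "s \<in> tspace M (\<kappa> p w)" and vert: "tmap M Q \<rho> (\<kappa> p w) s = tzero"
  proof -
    have sec: "smooth_at Q P \<sigma> (\<rho> (\<kappa> p w))" by (rule local_sectionD(2)[OF \<sigma>(1) U])
    have sr: "smooth_at M P (\<lambda>m. \<sigma> (\<rho> m)) (\<kappa> p w)"
      by (rule smooth_at_compose[OF regular_M regular_Q regular_P smooth_rho[OF m] sec])
    have 0: "tmap M P (\<lambda>m. \<sigma> (\<rho> m)) (\<kappa> p w) s = tzero"
      using tmap_compose[OF regular_M regular_Q regular_P smooth_rho[OF m] sec s] vert
        tlinear_tzero[OF regular_Q tlinear_tmap[OF regular_Q regular_P sec]] by simp
    have ev: "\<forall>\<^sub>F m' in mnhds M (\<kappa> p w). m' = \<kappa> (\<sigma> (\<rho> m')) (fibre_coord \<sigma> m')"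
      using smooth_at_eventually[OF smooth_rho[OF m] local_sectionD(5)[OF \<sigma>(1) U]]
        eventually_points[OF regular_M m]
      by eventually_elim (rule section_representation(2)[OF \<sigma>(1)])
    have "s = tmap M M (\<lambda>m. m) (\<kappa> p w) s" by (rule tmap_ident[OF regular_M m s, symmetric])
    also have "\<dots> = tmap M M (\<lambda>m'. \<kappa> (\<sigma> (\<rho> m')) (fibre_coord \<sigma> m')) (\<kappa> p w) s"
      by (rule tmap_cong[OF regular_M regular_M smooth_at_ident[OF regular_M m] ev s, symmetric])
    also have "\<dots> = tadd (tmap P M (\<lambda>p'. \<kappa> p' w) p (tmap M P (\<lambda>m. \<sigma> (\<rho> m)) (\<kappa> p w) s))
        (tmap W M (\<kappa> p) w (tmap M W (fibre_coord \<sigma>) (\<kappa> p w) s))"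
      using tmap_split[OF regular_M regular_P regular_W regular_M sr fc,
          of "\<lambda>z. \<kappa> (fst z) (snd z)", OF _ s] smooth_kappa[OF p w]
      by (simp add: rk \<sigma>(3) fk[OF w])
    also have "\<dots> = tmap W M (\<kappa> p) w (tmap M W (fibre_coord \<sigma>) (\<kappa> p w) s)"
      using tlinear_tzero[OF regular_P tlinear_tmap[OF regular_P regular_M smooth_kappa_left[OF p w]]]
      by (simp add: 0 tvec_algebra)
    finally show ?thesis by simp
  qed
qed

lemma tmap_kappa_right_inj:
  assumes p: "p \<in> points P" and w: "w \<in> points W"
  shows "inj_on (tmap W M (\<kappa> p) w) (tspace W w)"
proof -
  obtain U \<sigma> where \<sigma>: "local_section U \<sigma>" "\<pi> p \<in> U" "\<sigma> (\<pi> p) = p"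
    using local_trivialization[OF p] by metis
  show ?thesis
    by (rule inj_on_inverseI[where g = "tmap M W (fibre_coord \<sigma>) (\<kappa> p w)"])
      (rule fibre_coord_inverse(1)[OF \<sigma> p w])
qed

text \<open>\<open>inv_into\<close> carries no information on smoothness. On vertical vectors, which
  lie in the range of this injective tangent map, it agrees with the tangent map of a smooth
  function.\<close>

lemma inv_into_tmap_kappa:
  assumes \<sigma>: "local_section U \<sigma>" "\<pi> p \<in> U" "\<sigma> (\<pi> p) = p" and p: "p \<in> points P" and w: "w \<in> points W"
    and s: "s \<in> tspace M (\<kappa> p w)" "tmap M Q \<rho> (\<kappa> p w) s = tzero"
  shows "inv_into (tspace W w) (tmap W M (\<kappa> p) w) s = tmap M W (fibre_coord \<sigma>) (\<kappa> p w) s"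
    "tmap M W (fibre_coord \<sigma>) (\<kappa> p w) s \<in> tspace W w"
proof -
  have fc: "smooth_at M W (fibre_coord \<sigma>) (\<kappa> p w)"
    by (rule smooth_fibre_coord[OF \<sigma>(1) kappa_in[OF p w]]) (simp add: rho_kappa p w \<sigma>(2))
  show T: "tmap M W (fibre_coord \<sigma>) (\<kappa> p w) s \<in> tspace W w"
    using tmap_in_tspace[OF regular_M regular_W fc s(1)] fibre_coord_kappa[OF \<sigma>(1,2) w] \<sigma>(3) by simp
  show "inv_into (tspace W w) (tmap W M (\<kappa> p) w) s = tmap M W (fibre_coord \<sigma>) (\<kappa> p w) s"
    by (rule inv_into_f_eq[OF tmap_kappa_right_inj[OF p w] T]) (rule fibre_coord_inverse(2)[OF \<sigma> p w s])
qed

text \<open>Every [p, g z] with g z in W lies over \<pi>(p), so the single section \<sigma> and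
  lifts at the single point p suffice for all z near y.\<close>

lemma smooth_along_fibre_coord_ver_proj:
  assumes Y: "regular_atlas Y" and \<sigma>: "local_section U \<sigma>" "\<pi> p \<in> U" "\<sigma> (\<pi> p) = p"
    and p: "p \<in> points P" and g: "smooth_at Y W g y"
    and X: "smooth_along Y M (\<lambda>z. \<kappa> p (g z)) X y"
  shows "smooth_along Y W g (\<lambda>z. inv_into (tspace W (g z)) (tmap W M (\<kappa> p) (g z))
    (ver_proj P Q \<pi> A M \<kappa> (\<kappa> p (g z)) (X z))) y"
proof -
  note y = smooth_at_in(1)[OF g] and w = smooth_at_in(2)[OF g]
  note m = kappa_in[OF p w]
  have evW: "\<forall>\<^sub>F z in mnhds Y y. g z \<in> points W"
    by (rule smooth_at_eventually[OF g eventually_points[OF regular_W w]])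
  have cp: "smooth_at Y P (\<lambda>_. p) y" by (rule smooth_at_const[OF regular_P y p])
  have U: "\<rho> (\<kappa> p (g y)) \<in> U" using \<sigma>(2) rho_kappa[OF p w] by simp
  have "smooth_along Y Q (\<lambda>z. \<rho> (\<kappa> p (g z))) (\<lambda>z. tmap M Q \<rho> (\<kappa> p (g z)) (X z)) y"
    by (rule smooth_along_tmap_const[where f = "\<lambda>z. \<kappa> p (g z)", OF Y regular_M regular_Q smooth_rho[OF m] X])
  \<comment> \<open>The base point is now constant, so the projected vectors stay in one tangent
    space and are lifted at the fixed point p.\<close>
  then have "smooth_along Y Q (\<lambda>z. \<pi> p) (\<lambda>z. tmap M Q \<rho> (\<kappa> p (g z)) (X z)) y"
    by (rule smooth_along_cong[OF Y]) (rule eventually_mono[OF evW], simp add: rho_kappa p)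
  from smooth_along_hor_lift[OF Y cp this]
  have H: "smooth_along Y P (\<lambda>_. p) (\<lambda>z. hor_lift P Q \<pi> A p (tmap M Q \<rho> (\<kappa> p (g z)) (X z))) y" .
  note YP = regular_prod[OF Y regular_P]
  have pt: "(y, p) \<in> points (Y \<times>\<^sub>M P)" using y p by (simp add: points_prod)
  have "smooth_at (Y \<times>\<^sub>M P) M (\<lambda>z. \<kappa> (snd z) (g (fst z))) (y, p)"
    using smooth_at_compose[OF YP Y regular_W smooth_at_fst[OF Y regular_P pt], of g] g
    by (intro smooth_at_kappa[OF YP] smooth_at_snd[OF Y regular_P pt]) simp
  from smooth_along_tmap[where h = "\<lambda>z p'. \<kappa> p' (g z)", OF Y regular_P regular_M this H]
  have "smooth_along Y M (\<lambda>z. \<kappa> p (g z)) (\<lambda>z. tmap P M (\<lambda>p'. \<kappa> p' (g z)) p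
      (hor_lift P Q \<pi> A p (tmap M Q \<rho> (\<kappa> p (g z)) (X z)))) y" .
  from smooth_along_tsub[OF regular_M X this]
  have "smooth_along Y M (\<lambda>z. \<kappa> p (g z)) (\<lambda>z. ver_proj P Q \<pi> A M \<kappa> (\<kappa> p (g z)) (X z)) y"
  proof (rule smooth_along_cong[OF Y])
    show "\<forall>\<^sub>F z in mnhds Y y. \<kappa> p (g z) = \<kappa> p (g z) \<and>
        tsub (X z) (tmap P M (\<lambda>p'. \<kappa> p' (g z)) p (hor_lift P Q \<pi> A p (tmap M Q \<rho> (\<kappa> p (g z)) (X z)))) =
        ver_proj P Q \<pi> A M \<kappa> (\<kappa> p (g z)) (X z)"
      using evW smooth_alongD(2)[OF X] by eventually_elim (simp add: ver_proj_kappa(1) p)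
  qed
  from smooth_along_tmap_const[where f = "\<lambda>z. \<kappa> p (g z)",
      OF Y regular_M regular_W smooth_fibre_coord[OF \<sigma>(1) m U] this]
  show ?thesis
  proof (rule smooth_along_cong[OF Y])
    show "\<forall>\<^sub>F z in mnhds Y y. fibre_coord \<sigma> (\<kappa> p (g z)) = g z \<and>
        tmap M W (fibre_coord \<sigma>) (\<kappa> p (g z)) (ver_proj P Q \<pi> A M \<kappa> (\<kappa> p (g z)) (X z)) =
        inv_into (tspace W (g z)) (tmap W M (\<kappa> p) (g z)) (ver_proj P Q \<pi> A M \<kappa> (\<kappa> p (g z)) (X z))"
      using evW smooth_alongD(2)[OF X]
    proof eventually_elim
      case (elim z)
      note V = ver_proj_kappa[OF p elim]
      show ?case
        using fibre_coord_kappa[OF \<sigma>(1,2) elim(1)] inv_into_tmap_kappa(1)[OF \<sigma> p elim(1) V(2,3)]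
        by (simp add: V(1) \<sigma>(3))
    qed
  qed
qed

end

section \<open>Projectable operators\<close>

locale projectable_operator_data = associated_connection_data G \<G> P Q R \<pi> W \<Phi> A
  for G :: "('g, 'x) monoid_scheme"
    and \<G> :: "('g, 'eg::real_inner) atlas"
    and P :: "('p, 'ep::real_inner) atlas"
    and Q :: "('q, 'eq::real_inner) atlas"
    and R :: "'p \<Rightarrow> 'g \<Rightarrow> 'p"
    and \<pi> :: "'p \<Rightarrow> 'q"
    and W :: "('w, 'ew::real_inner) atlas"
    and \<Phi> :: "'g \<Rightarrow> 'w \<Rightarrow> 'w"
    and A :: "'p \<Rightarrow> ('p, 'ep) tvec \<Rightarrow> ('g, 'eg) tvec" +
  fixes N :: "('n, 'en::real_inner) atlas"
    and S :: "'n \<Rightarrow> ('p \<times> 'w) set \<Rightarrow> ('n, 'en) tvec \<Rightarrow> (('p \<times> 'w) set, 'eq \<times> 'ew) tvec"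
  assumes manifold_N: "manifold N" and operator: "stratonovich N M S" and projectable: "projectable N M Q \<rho> S"
begin

abbreviation "S_Q \<equiv> projected_operator M Q \<rho> S"

abbreviation "fibre_op \<equiv> fibre_operator P Q W \<pi> A M \<kappa> S"

lemma regular_N: "regular_atlas N"
  by (rule manifold_regular_atlas[OF manifold_N])

section \<open>The projected operator\<close>

lemma S_Q_kappa:
  assumes x: "x \<in> points N" and p: "p \<in> points P" and w: "w \<in> points W" and v: "v \<in> tspace N x"
  shows "S_Q x (\<pi> p) v = tmap M Q \<rho> (\<kappa> p w) (S x (\<kappa> p w) v)"
  unfolding projected_operator_def
proof (rule the_equality)
  note m = kappa_in[OF p w] and rk = rho_kappa[OF p w]
  show "\<forall>m\<in>points M. \<rho> m = \<pi> p \<longrightarrow> tmap M Q \<rho> (\<kappa> p w) (S x (\<kappa> p w) v) = tmap M Q \<rho> m (S x m v)"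
    using projectable x m v rk unfolding projectable_def by metis
  show "u = tmap M Q \<rho> (\<kappa> p w) (S x (\<kappa> p w) v)"
    if "\<forall>m\<in>points M. \<rho> m = \<pi> p \<longrightarrow> u = tmap M Q \<rho> m (S x m v)" for u
    using that m rk by blast
qed

lemma tlinear_S_kappa:
  assumes x: "x \<in> points N" and p: "p \<in> points P" and w: "w \<in> points W"
  shows "tlinear (tspace N x) (tspace M (\<kappa> p w)) (S x (\<kappa> p w))"
  by (rule stratonovich_tlinear[OF operator x kappa_in[OF p w]])

lemma tlinear_S_Q:
  assumes x: "x \<in> points N" and p: "p \<in> points P" and w: "w \<in> points W"
  shows "tlinear (tspace N x) (tspace Q (\<pi> p)) (S_Q x (\<pi> p))"
proof (rule tlinear_cong[OF regular_N S_Q_kappa[OF x p w, symmetric]])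
  show "tlinear (tspace N x) (tspace Q (\<pi> p)) (\<lambda>v. tmap M Q \<rho> (\<kappa> p w) (S x (\<kappa> p w) v))"
    using tlinear_compose[OF tlinear_S_kappa[OF x p w]
        tlinear_tmap[OF regular_M regular_Q smooth_rho[OF kappa_in[OF p w]]]]
    by (simp add: rho_kappa p w)
qed

text \<open>The operator on Q is read off from S at points of M over q, and q -> [\<sigma> q, w]
  with w fixed chooses such points smoothly. An element w has to be given because M has no points
  when W has none.\<close>

lemma smooth_along_S_Q:
  assumes Y: "regular_atlas Y" and f: "smooth_at Y N f y" and g: "smooth_at Y Q g y"
    and c: "c \<in> N" "f y \<in> cdom c" and w: "w \<in> points W"
  shows "smooth_along Y Q g (\<lambda>z. S_Q (f z) (g z) (tcoord N c (f z) e)) y"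
proof -
  note y = smooth_at_in(1)[OF f]
  obtain p where p: "p \<in> points P" "\<pi> p = g y" using pi_surj[OF smooth_at_in(2)[OF g]] by blast
  obtain U \<sigma> where \<sigma>: "local_section U \<sigma>" "g y \<in> U" using local_trivialization[OF p(1)] p(2) by metis
  note sec = local_sectionD[OF \<sigma>]
  have k: "smooth_at Y M (\<lambda>z. \<kappa> (\<sigma> (g z)) w) y"
    by (intro smooth_at_kappa[OF Y] smooth_at_compose[OF Y regular_Q regular_P g sec(2)]
        smooth_at_const[OF regular_W y w])
  note m = kappa_in[OF sec(3) w]
  have "smooth_along Y Q (\<lambda>z. \<rho> (\<kappa> (\<sigma> (g z)) w))
      (\<lambda>z. tmap M Q \<rho> (\<kappa> (\<sigma> (g z)) w) (S (f z) (\<kappa> (\<sigma> (g z)) w) (tcoord N c (f z) e))) y"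
    by (rule smooth_along_tmap_const[where f = "\<lambda>z. \<kappa> (\<sigma> (g z)) w", OF Y regular_M regular_Q smooth_rho[OF m]
          stratonovich_smooth_along[OF Y regular_N regular_M operator f k c]])
  then show ?thesis
  proof (rule smooth_along_cong[OF Y])
    show "\<forall>\<^sub>F z in mnhds Y y. \<rho> (\<kappa> (\<sigma> (g z)) w) = g z \<and>
        tmap M Q \<rho> (\<kappa> (\<sigma> (g z)) w) (S (f z) (\<kappa> (\<sigma> (g z)) w) (tcoord N c (f z) e)) =
        S_Q (f z) (g z) (tcoord N c (f z) e)"
      using smooth_at_eventually[OF g sec(5)] smooth_at_eventually[OF f eventually_cdom[OF regular_N c]]
    proof eventually_elim
      case (elim z)
      note s = local_sectionD(3,4)[OF \<sigma>(1) elim(1)]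
      show ?case
        using S_Q_kappa[OF chart_in_points[OF c(1) elim(2)] s(1) w tcoord_in_tspace[OF regular_N c(1) elim(2)]]
        by (simp add: s(2) rho_kappa[OF s(1) w])
    qed
  qed
qed

section \<open>The fibre operator\<close>

lemma fibre_op:
  assumes x: "x \<in> points N" and p: "p \<in> points P" and w: "w \<in> points W" and v: "v \<in> tspace N x"
  shows "fibre_op x p w v \<in> tspace W w"
    "tmap W M (\<kappa> p) w (fibre_op x p w v) = ver_proj P Q \<pi> A M \<kappa> (\<kappa> p w) (S x (\<kappa> p w) v)"
proof -
  obtain U \<sigma> where \<sigma>: "local_section U \<sigma>" "\<pi> p \<in> U" "\<sigma> (\<pi> p) = p"
    using local_trivialization[OF p] by metis
  note V = ver_proj_kappa[OF p w tlinear_in[OF tlinear_S_kappa[OF x p w] v]]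
  note I = inv_into_tmap_kappa[OF \<sigma> p w V(2,3)]
  show "fibre_op x p w v \<in> tspace W w"
    "tmap W M (\<kappa> p) w (fibre_op x p w v) = ver_proj P Q \<pi> A M \<kappa> (\<kappa> p w) (S x (\<kappa> p w) v)"
    using I fibre_coord_inverse(2)[OF \<sigma> p w V(2,3)] by (simp_all add: fibre_operator_def V(1))
qed

text \<open>Characterises the fibre operator by its defining relation instead of
  \<open>inv_into\<close>; uniqueness and invariance are both obtained from it.\<close>

lemma fibre_op_eqI:
  assumes x: "x \<in> points N" and p: "p \<in> points P" and w: "w \<in> points W" and v: "v \<in> tspace N x"
    and u: "u \<in> tspace W w"
    and eq: "tmap W M (\<kappa> p) w u = ver_proj P Q \<pi> A M \<kappa> (\<kappa> p w) (S x (\<kappa> p w) v)"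
  shows "u = fibre_op x p w v"
  by (rule inj_onD[OF tmap_kappa_right_inj[OF p w] _ u fibre_op(1)[OF x p w v]])
    (simp add: eq fibre_op(2)[OF x p w v])

text \<open>\<open>inv_into\<close> is not manifestly linear. Through a section the operator becomes
  a composite of linear maps: S, removal of the horizontal part, and the tangent map of the fibre
  coordinate.\<close>

lemma tlinear_fibre_op:
  assumes x: "x \<in> points N" and p: "p \<in> points P" and w: "w \<in> points W"
  shows "tlinear (tspace N x) (tspace W w) (fibre_op x p w)"
proof -
  obtain U \<sigma> where \<sigma>: "local_section U \<sigma>" "\<pi> p \<in> U" "\<sigma> (\<pi> p) = p"
    using local_trivialization[OF p] by metis
  note S = tlinear_S_kappa[OF x p w] and m = kappa_in[OF p w] and rk = rho_kappa[OF p w]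
  have fc: "smooth_at M W (fibre_coord \<sigma>) (\<kappa> p w)"
    by (rule smooth_fibre_coord[OF \<sigma>(1) m]) (simp add: rk \<sigma>(2))
  have Tf: "tlinear (tspace M (\<kappa> p w)) (tspace W w) (tmap M W (fibre_coord \<sigma>) (\<kappa> p w))"
    using tlinear_tmap[OF regular_M regular_W fc] fibre_coord_kappa[OF \<sigma>(1,2) w] \<sigma>(3) by simp
  have Tr: "tlinear (tspace M (\<kappa> p w)) (tspace Q (\<pi> p)) (tmap M Q \<rho> (\<kappa> p w))"
    using tlinear_tmap[OF regular_M regular_Q smooth_rho[OF m]] by (simp add: rk)
  note H = tlinear_compose[OF tlinear_compose[OF Tr tlinear_hor_lift[OF p]]
      tlinear_tmap[OF regular_P regular_M smooth_kappa_left[OF p w]]]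
  note F = tlinear_compose[OF tlinear_compose[OF S tlinear_diff[OF regular_M tlinear_ident H]] Tf]
  show ?thesis
  proof (rule tlinear_cong[OF regular_N _ F])
    fix v assume v: "v \<in> tspace N x"
    note V = ver_proj_kappa[OF p w tlinear_in[OF S v]]
    show "tmap M W (fibre_coord \<sigma>) (\<kappa> p w) (tsub (S x (\<kappa> p w) v) (tmap P M (\<lambda>p'. \<kappa> p' w) p
        (hor_lift P Q \<pi> A p (tmap M Q \<rho> (\<kappa> p w) (S x (\<kappa> p w) v))))) = fibre_op x p w v"
      using inv_into_tmap_kappa(1)[OF \<sigma> p w V(2,3)] by (simp add: fibre_operator_def V(1))
  qed
qed

lemma smooth_along_fibre_op:
  assumes Y: "regular_atlas Y" and f: "smooth_at Y N f y" and g: "smooth_at Y W g y"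
    and c: "c \<in> N" "f y \<in> cdom c" and p: "p \<in> points P"
  shows "smooth_along Y W g (\<lambda>z. fibre_op (f z) p (g z) (tcoord N c (f z) e)) y"
proof -
  obtain U \<sigma> where \<sigma>: "local_section U \<sigma>" "\<pi> p \<in> U" "\<sigma> (\<pi> p) = p"
    using local_trivialization[OF p] by metis
  have k: "smooth_at Y M (\<lambda>z. \<kappa> p (g z)) y"
    by (rule smooth_at_kappa[OF Y smooth_at_const[OF regular_P smooth_at_in(1)[OF f] p] g])
  show ?thesis
    unfolding fibre_operator_def
    by (rule smooth_along_fibre_coord_ver_proj[OF Y \<sigma> p g
          stratonovich_smooth_along[OF Y regular_N regular_M operator f k c]])
qed

lemma stratonovich_fibre_op:
  assumes p: "p \<in> points P"
  shows "stratonovich N W (\<lambda>x. fibre_op x p)"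
proof (rule stratonovichI[OF regular_N regular_W tlinear_fibre_op[OF _ p]])
  fix x w c e assume c: "c \<in> N" "x \<in> cdom c" and w: "w \<in> points W"
  have pt: "(x, w) \<in> points (N \<times>\<^sub>M W)"
    using chart_in_points[OF c] w by (simp add: points_prod)
  show "smooth_along (N \<times>\<^sub>M W) W snd (\<lambda>z. fibre_op (fst z) p (snd z) (tcoord N c (fst z) e)) (x, w)"
    by (rule smooth_along_fibre_op[OF regular_prod[OF regular_N regular_W]
          smooth_at_fst[OF regular_N regular_W pt] smooth_at_snd[OF regular_N regular_W pt] c(1) _ p])
      (simp add: c)
qed auto

section \<open>The operator on P \<times> W\<close>

lemma tlinear_lift_S_Q:
  assumes "x \<in> points N" "p \<in> points P" "w \<in> points W"
  shows "tlinear (tspace N x) (tspace P p) (\<lambda>v. hor_lift P Q \<pi> A p (S_Q x (\<pi> p) v))"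
  by (rule tlinear_compose[OF tlinear_S_Q[OF assms] tlinear_hor_lift[OF assms(2)]])

lemma smooth_along_lift_S_Q:
  assumes Y: "regular_atlas Y" and f: "smooth_at Y N f y" and g: "smooth_at Y P g y"
    and c: "c \<in> N" "f y \<in> cdom c" and w: "w \<in> points W"
  shows "smooth_along Y P g (\<lambda>z. hor_lift P Q \<pi> A (g z) (S_Q (f z) (\<pi> (g z)) (tcoord N c (f z) e))) y"
  by (rule smooth_along_hor_lift[OF Y g smooth_along_S_Q[OF Y f
          smooth_at_compose[OF Y regular_P regular_Q g smooth_pi[OF smooth_at_in(2)[OF g]]] c w]])

lemma smooth_at_triple:
  assumes "x \<in> points N" "p \<in> points P" "w \<in> points W"
  defines "Y \<equiv> N \<times>\<^sub>M (P \<times>\<^sub>M W)"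
  shows "regular_atlas Y" "smooth_at Y N fst (x, (p, w))" "smooth_at Y P (\<lambda>z. fst (snd z)) (x, (p, w))"
    "smooth_at Y W (\<lambda>z. snd (snd z)) (x, (p, w))"
proof -
  note PW = regular_prod[OF regular_P regular_W]
  show Y: "regular_atlas Y" unfolding Y_def by (rule regular_prod[OF regular_N PW])
  have pt: "(x, (p, w)) \<in> points (N \<times>\<^sub>M (P \<times>\<^sub>M W))" "(p, w) \<in> points (P \<times>\<^sub>M W)"
    using assms by (simp_all add: points_prod)
  show "smooth_at Y N fst (x, (p, w))" unfolding Y_def by (rule smooth_at_fst[OF regular_N PW pt(1)])
  have s: "smooth_at Y (P \<times>\<^sub>M W) snd (x, (p, w))" unfolding Y_def by (rule smooth_at_snd[OF regular_N PW pt(1)])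
  show "smooth_at Y P (\<lambda>z. fst (snd z)) (x, (p, w))"
    using smooth_at_compose[OF Y PW regular_P s, of fst] smooth_at_fst[OF regular_P regular_W pt(2)] by simp
  show "smooth_at Y W (\<lambda>z. snd (snd z)) (x, (p, w))"
    using smooth_at_compose[OF Y PW regular_W s, of snd] smooth_at_snd[OF regular_P regular_W pt(2)] by simp
qed

lemma dep_stratonovich_lift_S_Q:
  "dep_stratonovich N P W (\<lambda>x p w v. hor_lift P Q \<pi> A p (S_Q x (\<pi> p) v))"
proof (rule dep_stratonovichI[OF regular_N regular_P regular_W tlinear_lift_S_Q])
  fix x p w c e assume c: "c \<in> N" "x \<in> cdom c" and p: "p \<in> points P" and w: "w \<in> points W"
  note t = smooth_at_triple[OF chart_in_points[OF c] p w]
  show "smooth_along (N \<times>\<^sub>M (P \<times>\<^sub>M W)) P (\<lambda>z. fst (snd z)) (\<lambda>z. hor_lift P Q \<pi> A (fst (snd z))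
      (S_Q (fst z) (\<pi> (fst (snd z))) (tcoord N c (fst z) e))) (x, (p, w))"
    by (rule smooth_along_lift_S_Q[OF t(1-3) c(1) _ w]) (simp add: c)
qed auto

text \<open>The fibre component is evaluated at the fixed p0 rather than at the moving point of P,
  since its smoothness is established for a fixed point. Independence later identifies the result
  with \<open>S_PW\<close>.\<close>

lemma stratonovich_tpair:
  assumes p0: "p0 \<in> points P"
  shows "stratonovich N (P \<times>\<^sub>M W) (\<lambda>x m v. tpair P W (fst m) (snd m)
    (hor_lift P Q \<pi> A (fst m) (S_Q x (\<pi> (fst m)) v)) (fibre_op x p0 (snd m) v))"
proof (rule stratonovichI[OF regular_N regular_prod[OF regular_P regular_W]])
  fix x m assume x: "x \<in> points N" and m: "m \<in> points (P \<times>\<^sub>M W)"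
  obtain p w where pw: "m = (p, w)" by (cases m)
  have pt: "p \<in> points P" "w \<in> points W" using m by (simp_all add: pw points_prod)
  show "tlinear (tspace N x) (tspace (P \<times>\<^sub>M W) m) (\<lambda>v. tpair P W (fst m) (snd m)
      (hor_lift P Q \<pi> A (fst m) (S_Q x (\<pi> (fst m)) v)) (fibre_op x p0 (snd m) v))"
    using tlinear_tpair[OF regular_P regular_W pt regular_N tlinear_lift_S_Q[OF x pt]
        tlinear_fibre_op[OF x p0 pt(2)]] by (simp add: pw)
next
  fix x m c e assume c: "c \<in> N" "x \<in> cdom c" and m: "m \<in> points (P \<times>\<^sub>M W)"
  obtain p w where pw: "m = (p, w)" by (cases m)
  have pt: "p \<in> points P" "w \<in> points W" using m by (simp_all add: pw points_prod)
  note t = smooth_at_triple[OF chart_in_points[OF c] pt]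
  have "smooth_along (N \<times>\<^sub>M (P \<times>\<^sub>M W)) (P \<times>\<^sub>M W) (\<lambda>z. (fst (snd z), snd (snd z)))
      (\<lambda>z. tpair P W (fst (snd z)) (snd (snd z))
        (hor_lift P Q \<pi> A (fst (snd z)) (S_Q (fst z) (\<pi> (fst (snd z))) (tcoord N c (fst z) e)))
        (fibre_op (fst z) p0 (snd (snd z)) (tcoord N c (fst z) e))) (x, (p, w))"
    by (rule smooth_along_tpair[OF t(1) regular_P regular_W smooth_along_lift_S_Q[OF t(1-3) c(1) _ pt(2)]
          smooth_along_fibre_op[OF t(1,2,4) c(1) _ p0]]) (simp_all add: c)
  then show "smooth_along (N \<times>\<^sub>M (P \<times>\<^sub>M W)) (P \<times>\<^sub>M W) snd
      (\<lambda>z. tpair P W (fst (snd z)) (snd (snd z))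
        (hor_lift P Q \<pi> A (fst (snd z)) (S_Q (fst z) (\<pi> (fst (snd z))) (tcoord N c (fst z) e)))
        (fibre_op (fst z) p0 (snd (snd z)) (tcoord N c (fst z) e))) (x, m)"
    by (simp add: pw)
qed

text \<open>The linearity and smoothness conditions evaluate an operator only at points and on
  tangent vectors there, so agreement on these transfers them.\<close>

lemma stratonovich_cong:
  assumes S: "stratonovich N K T" and K: "regular_atlas K"
    and eq: "\<And>x m v. x \<in> points N \<Longrightarrow> m \<in> points K \<Longrightarrow> v \<in> tspace N x \<Longrightarrow> T x m v = T' x m v"
  shows "stratonovich N K T'"
  unfolding stratonovich_def
proof (intro conjI ballI allI)
  show "tlinear (tspace N x) (tspace K y) (T' x y)" if "x \<in> points N" "y \<in> points K" for x y
    by (rule tlinear_cong[OF regular_N eq stratonovich_tlinear[OF S that]]) (use that in auto)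
  fix c d e assume c: "c \<in> N" "d \<in> K"
  have "smooth_on (cimg c \<times> cimg d) (\<lambda>(a, b). T (cinv c a) (cinv d b) (tcoord N c (cinv c a) e) d)"
    using S c by (simp add: stratonovich_def)
  then show "smooth_on (cimg c \<times> cimg d) (\<lambda>(a, b). T' (cinv c a) (cinv d b) (tcoord N c (cinv c a) e) d)"
  proof (rule smooth_on_cong[OF _ open_Times[OF open_cimg[OF regular_N c(1)] open_cimg[OF K c(2)]]], clarify)
    fix x y assume x: "x \<in> cdom c" and y: "y \<in> cdom d"
    have "T x y (tcoord N c x e) = T' x y (tcoord N c x e)"
      by (rule eq[OF chart_in_points[OF c(1) x] chart_in_points[OF c(2) y] tcoord_in_tspace[OF regular_N c(1) x]])
    then show "T (cinv c (cmap c x)) (cinv d (cmap d y)) (tcoord N c (cinv c (cmap c x)) e) d =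
        T' (cinv c (cmap c x)) (cinv d (cmap d y)) (tcoord N c (cinv c (cmap c x)) e) d"
      by (simp add: cinv_cmap[OF regular_N c(1) x] cinv_cmap[OF K c(2) y])
  qed
qed

text \<open>Both sides agree after applying the injective map \<open>T\<^sub>w\<kappa>\<^sub>p\<close>, because \<open>[p, g w] = [p g, w]\<close> and the
  fibre operator may be computed at \<open>p g\<close> instead of \<open>p\<close>.\<close>

lemma invariant_fibre_op:
  assumes p0: "p0 \<in> points P"
    and independent: "\<And>x w p p' v. x \<in> points N \<Longrightarrow> w \<in> points W \<Longrightarrow> p \<in> points P \<Longrightarrow> p' \<in> points P \<Longrightarrow>
      v \<in> tspace N x \<Longrightarrow> fibre_op x p w v = fibre_op x p' w v"
  shows "invariant_operator G N W \<Phi> (\<lambda>x. fibre_op x p0)"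
  unfolding invariant_operator_def
proof (intro ballI)
  fix g x w v assume g: "g \<in> carrier G" and x: "x \<in> points N" and w: "w \<in> points W" and v: "v \<in> tspace N x"
  note gw = Phi_in[OF g w] and pg = R_in[OF p0 g]
  have Phi: "smooth_at W W (\<Phi> g) w"
    using smooth_at_Phi[OF regular_W smooth_at_const[OF regular_G w] smooth_at_ident[OF regular_W w]] g
    by (simp add: points_G)
  note F = fibre_op(1)[OF x p0 w v]
  note TF = tmap_in_tspace[OF regular_W regular_W Phi F]
  have "tmap W M (\<kappa> p0) (\<Phi> g w) (tmap W W (\<Phi> g) w (fibre_op x p0 w v)) =
      tmap W M (\<lambda>w'. \<kappa> p0 (\<Phi> g w')) w (fibre_op x p0 w v)"
    by (rule tmap_compose[OF regular_W regular_W regular_M Phi smooth_kappa_right[OF p0 gw] F, symmetric])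
  also have "\<dots> = tmap W M (\<kappa> (R p0 g)) w (fibre_op x p0 w v)"
  proof (rule tmap_cong[OF regular_W regular_M smooth_kappa_right[OF pg w] _ F])
    show "\<forall>\<^sub>F w' in mnhds W w. \<kappa> (R p0 g) w' = \<kappa> p0 (\<Phi> g w')"
      using eventually_points[OF regular_W w] by eventually_elim (simp add: kappa_R p0 g)
  qed
  also have "\<dots> = tmap W M (\<kappa> (R p0 g)) w (fibre_op x (R p0 g) w v)"
    by (simp only: independent[OF x w p0 pg v])
  also have "\<dots> = ver_proj P Q \<pi> A M \<kappa> (\<kappa> p0 (\<Phi> g w)) (S x (\<kappa> p0 (\<Phi> g w)) v)"
    using fibre_op(2)[OF x pg w v] by (simp add: kappa_R[OF p0 g w])
  finally have "tmap W W (\<Phi> g) w (fibre_op x p0 w v) = fibre_op x p0 (\<Phi> g w) v"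
    by (rule fibre_op_eqI[OF x p0 gw v TF])
  then show "fibre_op x p0 (\<Phi> g w) v = tmap W W (\<Phi> g) w (fibre_op x p0 w v)" by simp
qed

end

text \<open>Uniqueness is equality at points and on tangent vectors, because the values of total
  functions elsewhere are arbitrary. A point of P provides p0; without one the defining relation
  would be vacuous.\<close>

theorem corollary5p2:
  fixes G :: "('g, 'x) monoid_scheme"
    and \<G> :: "('g, 'eg::real_inner) atlas"
    and P :: "('p, 'ep::real_inner) atlas"
    and Q :: "('q, 'eq::real_inner) atlas"
    and W :: "('w, 'ew::real_inner) atlas"
    and N :: "('n, 'en::real_inner) atlas"
    and R :: "'p \<Rightarrow> 'g \<Rightarrow> 'p"
    and \<Phi> :: "'g \<Rightarrow> 'w \<Rightarrow> 'w"
    and \<pi> :: "'p \<Rightarrow> 'q"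
    and A :: "'p \<Rightarrow> ('p, 'ep) tvec \<Rightarrow> ('g, 'eg) tvec"
    and M :: "(('p \<times> 'w) set, 'eq \<times> 'ew) atlas"
    and \<kappa> :: "'p \<Rightarrow> 'w \<Rightarrow> ('p \<times> 'w) set"
    and S :: "'n \<Rightarrow> ('p \<times> 'w) set \<Rightarrow> ('n, 'en) tvec \<Rightarrow> (('p \<times> 'w) set, 'eq \<times> 'ew) tvec"
    and S_Q :: "'n \<Rightarrow> 'q \<Rightarrow> ('n, 'en) tvec \<Rightarrow> ('q, 'eq) tvec"
    and S_PW :: "'n \<Rightarrow> 'p \<times> 'w \<Rightarrow> ('n, 'en) tvec \<Rightarrow> ('p \<times> 'w, 'ep \<times> 'ew) tvec"
  assumes principal: "principal_bundle G \<G> P Q R \<pi>"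
    and nonempty: "points P \<noteq> {}"
    and fibre: "manifold W" "smooth_left_action G \<G> W \<Phi>" "effective G W \<Phi>"
    and M_eq: "M = assoc_bundle G P Q W R \<Phi> \<pi>"
    and kappa_eq: "\<kappa> = assoc_class G P W R \<Phi>"
    and source: "manifold N"
    and operator: "stratonovich N M S" "projectable N M Q (assoc_proj \<pi>) S"
    and S_Q_eq: "S_Q = projected_operator M Q (assoc_proj \<pi>) S"
    and connection: "principal_connection G \<G> P R A"
    and S_PW_eq: "S_PW = (\<lambda>x (p, w) v.
      tpair P W p w (hor_lift P Q \<pi> A p (S_Q x (\<pi> p) v)) (fibre_operator P Q W \<pi> A M \<kappa> S x p w v))"
    and independent: "\<And>x w p p' v. x \<in> points N \<Longrightarrow> w \<in> points W \<Longrightarrow> p \<in> points P \<Longrightarrow> p' \<in> points P \<Longrightarrow>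
      v \<in> tspace N x \<Longrightarrow>
      fibre_operator P Q W \<pi> A M \<kappa> S x p w v = fibre_operator P Q W \<pi> A M \<kappa> S x p' w v"
  shows "\<exists>S_W.
    (stratonovich N W S_W \<and> invariant_operator G N W \<Phi> S_W \<and>
     (\<forall>x\<in>points N. \<forall>w\<in>points W. \<forall>p\<in>points P. \<forall>v\<in>tspace N x.
        tmap W M (\<kappa> p) w (S_W x w v) = ver_proj P Q \<pi> A M \<kappa> (\<kappa> p w) (S x (\<kappa> p w) v))) \<and>
    (\<forall>S_W'.
       stratonovich N W S_W' \<and> invariant_operator G N W \<Phi> S_W' \<and>
       (\<forall>x\<in>points N. \<forall>w\<in>points W. \<forall>p\<in>points P. \<forall>v\<in>tspace N x.
          tmap W M (\<kappa> p) w (S_W' x w v) = ver_proj P Q \<pi> A M \<kappa> (\<kappa> p w) (S x (\<kappa> p w) v)) \<longrightarrow>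
       (\<forall>x\<in>points N. \<forall>w\<in>points W. \<forall>v\<in>tspace N x. S_W' x w v = S_W x w v)) \<and>
    skew_product N P W S_PW (\<lambda>x p w v. hor_lift P Q \<pi> A p (S_Q x (\<pi> p) v)) S_W"
proof -
  interpret B: projectable_operator_data G \<G> P Q R \<pi> W \<Phi> A N S
    by unfold_locales (use principal fibre connection source operator in \<open>simp_all add: M_eq\<close>)
  obtain p0 where p0: "p0 \<in> points P" using nonempty by blast
  note M_eq [simp] and kappa_eq [simp]
  define S_W where "S_W = (\<lambda>x. fibre_operator P Q W \<pi> A M \<kappa> S x p0)"
  have indep: "fibre_operator P Q W \<pi> A M \<kappa> S x p w v = S_W x w v"
    if "x \<in> points N" "w \<in> points W" "p \<in> points P" "v \<in> tspace N x" for x w p v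
    unfolding S_W_def by (rule independent[OF that(1-3) p0 that(4)])
  have strat: "stratonovich N W S_W"
    using B.stratonovich_fibre_op[OF p0] by (simp add: S_W_def)
  have inv: "invariant_operator G N W \<Phi> S_W"
    unfolding S_W_def M_eq kappa_eq by (rule B.invariant_fibre_op[OF p0 independent[unfolded M_eq kappa_eq]])
  have rel: "tmap W M (\<kappa> p) w (S_W x w v) = ver_proj P Q \<pi> A M \<kappa> (\<kappa> p w) (S x (\<kappa> p w) v)"
    if "x \<in> points N" "w \<in> points W" "p \<in> points P" "v \<in> tspace N x" for x w p v
    using B.fibre_op(2)[OF that(1,3,2,4)] indep[OF that] by simp
  \<comment> \<open>Being a Stratonovich operator puts the value of S_W' into the tangent space at
    w, where the tangent map of \<kappa> at p0 is injective; the relation at p0 alone then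
    decides.\<close>
  have uniq: "S_W' x w v = S_W x w v"
    if S_W': "stratonovich N W S_W'"
      "\<forall>x\<in>points N. \<forall>w\<in>points W. \<forall>p\<in>points P. \<forall>v\<in>tspace N x.
        tmap W M (\<kappa> p) w (S_W' x w v) = ver_proj P Q \<pi> A M \<kappa> (\<kappa> p w) (S x (\<kappa> p w) v)"
      and x: "x \<in> points N" and w: "w \<in> points W" and v: "v \<in> tspace N x" for S_W' x w v
    using B.fibre_op_eqI[OF x p0 w v tlinear_in[OF stratonovich_tlinear[OF S_W'(1) x w] v]]
      S_W'(2) x w v p0 by (simp add: S_W_def)
  \<comment> \<open>Independence replaces the moving p in the fibre component by p0, so
    \<open>S_PW\<close> agrees at all points with the operator already known to be smooth.\<close>
  have PW: "stratonovich N (P \<times>\<^sub>M W) S_PW"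
    by (rule B.stratonovich_cong[OF B.stratonovich_tpair[OF p0]
          regular_prod[OF B.regular_P B.regular_W]])
      (use indep in \<open>auto simp: S_PW_eq S_Q_eq S_W_def points_prod\<close>)
  have dep: "dep_stratonovich N P W (\<lambda>x p w v. hor_lift P Q \<pi> A p (S_Q x (\<pi> p) v))"
    using B.dep_stratonovich_lift_S_Q by (simp add: S_Q_eq)
  have "skew_product N P W S_PW (\<lambda>x p w v. hor_lift P Q \<pi> A p (S_Q x (\<pi> p) v)) S_W"
    unfolding skew_product_def using PW dep strat indep by (simp add: S_PW_eq)
  with strat inv rel uniq show ?thesis
    by (intro exI[of _ S_W]) blast
qed

end
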